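(* Let $s\in(0,1]$ and $p\in[1,+\infty)$ be such that $sp=N$ and $s\neq p$. Then, for any $\widetilde s$ and $\widetilde p$ satisfying $\widetilde s\,\widetilde p=N$, there exist two positive constants $C_1=C_1(N,\widetilde s,\widetilde p)$ and $C_2=C_2(N,s,p,\widetilde s,\widetilde p)$ such that, for any $u\in W^{s,p}(\mathbb{R}^N)$, $$\|u\|_{BMO}\le C_1\,\|u\|_{W^{\widetilde s,\widetilde p}(\mathbb{R}^N)}\le C_2\,\|u\|_{W^{s,p}(\mathbb{R}^N)}.$$
   Context: $N\ge1$ is an integer and functions are real-valued and measurable. For $s\in[0,1]$ and $p\in[1,+\infty)$ define $[u]_{W^{0,p}(\mathbb{R}^N)}:=\|u\|_{L^p(\mathbb{R}^N)}$, $[u]_{W^{1,p}(\mathbb{R}^N)}:=\|\nabla u\|_{L^p(\mathbb{R}^N)}$ (weak gradient) and, for $s\in(0,1)$, $$[u]_{W^{s,p}(\mathbb{R}^N)}:=\left(c_{N,s,p}\iint_{\mathbb{R}^N\times\mathbb{R}^N}\frac{|u(x)-u(y)|^p}{|x-y|^{N+sp}}\,dx\,dy\right)^{1/p},\qquad c_{N,s,p}:=\frac{s\,2^{2s-1}\,\Gamma\left(\frac{ps+p+N-2}{2}\right)}{\pi^{N/2}\,\Gamma(1-s)}.$$ Set $W^{s,p}(\mathbb{R}^N):=\{u\in L^p(\mathbb{R}^N):[u]_{W^{s,p}(\mathbb{R}^N)}<+\infty\}$, with norm $\|u\|_{W^{0,p}(\mathbb{R}^N)}:=\|u\|_{L^p(\mathbb{R}^N)}$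 if $s=0$ and $\|u\|_{W^{s,p}(\mathbb{R}^N)}:=\big([u]^p_{W^{s,p}(\mathbb{R}^N)}+\|u\|^p_{L^p(\mathbb{R}^N)}\big)^{1/p}$ if $s\in(0,1]$. The spaces $W^{\widetilde s,\widetilde p}(\mathbb{R}^N)$ are defined in the same way. The BMO norm (a seminorm) is, up to equivalence, $$\|u\|_{BMO}:=\sup_{x\in\mathbb{R}^N,\ r>0}\frac{1}{|B_r(x)|^2}\iint_{B_r(x)\times B_r(x)}|u(y)-u(z)|\,dy\,dz,$$ where $B_r(x)$ is the open ball of radius $r$ centred at $x$.
   Formalization: The pairs (s̃, p̃) with s̃p̃ = N are restricted to s̃ ≤ s; for s̃ > s no C₂ exists, since for u(x/λ) with u a fixed bump the W^{s̃,p̃} norm grows like λ^{s̃} but the W^{s,p} norm only like λ^{s} as λ → ∞. *)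

theory Defs
  imports "HOL-Analysis.Analysis"
begin

(* Powers of extended nonnegative reals, used only with exponent a > 0. *)
definition ennreal_powr :: "ennreal \<Rightarrow> real \<Rightarrow> ennreal" (infixr "epowr" 80) where
  "x epowr a = (if x = \<infinity> then \<infinity> else ennreal (enn2real x powr a))"

definition Lp_norm :: "real \<Rightarrow> (real ^ 'n \<Rightarrow> 'b::real_normed_vector) \<Rightarrow> ennreal" where
  "Lp_norm p f = (\<integral>\<^sup>+ x. ennreal (norm (f x) powr p) \<partial>lebesgue) epowr (1 / p)"

definition partial_deriv :: "'n \<Rightarrow> (real ^ 'n \<Rightarrow> real) \<Rightarrow> real ^ 'n \<Rightarrow> real" where
  "partial_deriv i f x = frechet_derivative f (at x) (axis i 1)"

(* C-infinity: every iterated partial derivative is (Frechet) differentiable everywhere. *)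
definition smooth :: "(real ^ 'n \<Rightarrow> real) \<Rightarrow> bool" where
  "smooth f \<longleftrightarrow> (\<forall>is x. foldr partial_deriv is f differentiable (at x))"

definition test_function :: "(real ^ 'n \<Rightarrow> real) \<Rightarrow> bool" where
  "test_function \<phi> \<longleftrightarrow> smooth \<phi> \<and> compact (closure {x. \<phi> x \<noteq> 0})"

definition locally_integrable :: "(real ^ 'n \<Rightarrow> 'b::euclidean_space) \<Rightarrow> bool" where
  "locally_integrable f \<longleftrightarrow> (\<forall>K. compact K \<longrightarrow> set_integrable lebesgue K f)"

definition is_weak_gradient :: "(real ^ 'n \<Rightarrow> real) \<Rightarrow> (real ^ 'n \<Rightarrow> real ^ 'n) \<Rightarrow> bool" where
  "is_weak_gradient u G \<longleftrightarrow>
     locally_integrable u \<and> locally_integrable G \<and>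
     (\<forall>\<phi> i. test_function \<phi> \<longrightarrow>
        (LINT x|lebesgue. u x * partial_deriv i \<phi> x) = - (LINT x|lebesgue. G x $ i * \<phi> x))"

(* Weak gradients are unique almost everywhere, so the choice does not affect L^p norms. *)
definition weak_gradient :: "(real ^ 'n \<Rightarrow> real) \<Rightarrow> real ^ 'n \<Rightarrow> real ^ 'n" where
  "weak_gradient u = (SOME G. is_weak_gradient u G)"

definition sobolev_const :: "real \<Rightarrow> real \<Rightarrow> real \<Rightarrow> real" where
  "sobolev_const N s p =
     s * 2 powr (2 * s - 1) * Gamma ((p * s + p + N - 2) / 2) / (pi powr (N / 2) * Gamma (1 - s))"

(* The integrand on the diagonal x = y is 0, by the conventions 0 powr a = 0 and 0 / 0 = 0;
   the diagonal is a null set. *)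
definition gagliardo_seminorm :: "real \<Rightarrow> real \<Rightarrow> (real ^ 'n \<Rightarrow> real) \<Rightarrow> ennreal" where
  "gagliardo_seminorm s p u =
     (ennreal (sobolev_const (real CARD('n)) s p) *
      (\<integral>\<^sup>+ (x, y). ennreal (\<bar>u x - u y\<bar> powr p / norm (x - y) powr (real CARD('n) + s * p))
         \<partial>(lebesgue \<Otimes>\<^sub>M lebesgue))) epowr (1 / p)"

(* Meaningful for 0 \<le> s \<le> 1 and p \<ge> 1. *)
definition sobolev_seminorm :: "real \<Rightarrow> real \<Rightarrow> (real ^ 'n \<Rightarrow> real) \<Rightarrow> ennreal" where
  "sobolev_seminorm s p u =
     (if s = 0 then Lp_norm p u
      else if s = 1 then
        (if \<exists>G. is_weak_gradient u G then Lp_norm p (weak_gradient u) else \<infinity>)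
      else gagliardo_seminorm s p u)"

definition sobolev_space :: "real \<Rightarrow> real \<Rightarrow> (real ^ 'n \<Rightarrow> real) set" where
  "sobolev_space s p =
     {u \<in> borel_measurable lebesgue. Lp_norm p u < \<infinity> \<and> sobolev_seminorm s p u < \<infinity>}"

(* Takes the value \<infinity> on measurable functions outside the space. *)
definition sobolev_norm :: "real \<Rightarrow> real \<Rightarrow> (real ^ 'n \<Rightarrow> real) \<Rightarrow> ennreal" where
  "sobolev_norm s p u =
     (if s = 0 then Lp_norm p u
      else (sobolev_seminorm s p u epowr p + Lp_norm p u epowr p) epowr (1 / p))"

definition bmo_norm :: "(real ^ 'n \<Rightarrow> real) \<Rightarrow> ennreal" where
  "bmo_norm u =
     (SUP x. SUP r \<in> {0<..}.
        ennreal (1 / (measure lebesgue (ball x r))\<^sup>2) *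
        (\<integral>\<^sup>+ (y, z) \<in> ball x r \<times> ball x r. ennreal \<bar>u y - u z\<bar> \<partial>(lebesgue \<Otimes>\<^sub>M lebesgue)))"

end

theory Submission
  imports Defs "HOL-Computational_Algebra.Polynomial"
begin

text \<open>
  Since \<open>N + s p = 2 N\<close>, all fractional seminorms involved are energies
  \<open>I\<^sub>q = \<integral>\<integral> \<bar>u x - u y\<bar>\<^bsup>q\<^esup> / \<bar>x - y\<bar>\<^bsup>2N\<^esup>\<close> with different exponents \<open>q\<close>.
  Let \<open>O x r\<close> be the mean oscillation of \<open>u\<close> on the ball of radius \<open>r\<close> about \<open>x\<close>.
  Telescoping over dyadic balls bounds \<open>\<bar>u x - u y\<bar>\<close> by sums of \<open>O\<close> at smaller scales, and
  the scaling of \<open>\<bar>h\<bar>\<^bsup>-2N\<^esup>\<close> makes these sums converge, so that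
  \<open>I\<^sub>q \<le> C \<integral>\<integral> O x \<bar>h\<bar>\<^bsup>q\<^esup> \<bar>h\<bar>\<^bsup>-2N\<^esup>\<close>. For \<open>s < 1\<close>
  Jensen's inequality bounds both \<open>O\<^bsup>p\<^esup>\<close> and its energy by \<open>I\<^sub>p\<close>, and for \<open>q \<ge> p\<close> the
  two combine to \<open>I\<^sub>q \<le> C I\<^sub>p\<^bsup>q/p\<^esup>\<close>. For \<open>s = 1\<close>, \<open>p = N \<ge> 2\<close>,
  the weak gradient gives \<open>O x r \<le> C r g\<close> with \<open>g\<close> the mean of \<open>\<bar>\<nabla>u\<bar>\<close> over the ball, and a
  layer cake argument (weak type estimate and \<open>O\<close> bounded) gives the same conclusion for \<open>q > N\<close>.
  In both cases \<open>O\<close> is bounded by the seminorm, which is the BMO estimate.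
\<close>

subsection \<open>Powers of extended nonnegative reals and averages over balls\<close>

text \<open>Telescoping reaches \<open>v x\<close> only at Lebesgue points, and these are extracted
  from the energy itself. A local integral of the differences with weight
  \<open>norm h powr (- 3N/2)\<close> is finite for almost every \<open>x\<close>; any exponent
  strictly between \<open>N\<close> and \<open>2N\<close> would do, above \<open>N\<close> to beat
  the averaging, below \<open>2N\<close> for finiteness. The gradient case is an endpoint: the
  \<open>N\<close>-th power of \<open>C r g\<close>, integrated against the weight, leaves
  \<open>norm h powr (- N)\<close>, which diverges at zero and at infinity. Truncation at a level
  \<open>t\<close> removes small \<open>h\<close>, \<open>q > N\<close> controls small levels, and
  the tail converges only for \<open>N \<ge> 2\<close>. The hypothesis \<open>s \<noteq> p\<close>
  excludes just \<open>s = p = N = 1\<close>, where a bump with ever steeper flanks keeps the mass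
  of its gradient while its fractional energies grow without bound. A weak gradient acts only on
  test functions, so indicators of boxes must be limits of test functions; hence the explicit bumps.
  Estimates are made for Borel representatives, where iterated integrals can be exchanged, and in
  \<open>ennreal\<close>, where infinite values are ordinary values.\<close>

lemma epowr_ennreal: "0 \<le> a \<Longrightarrow> ennreal a epowr q = ennreal (a powr q)"
  by (simp add: ennreal_powr_def)

lemma epowr_top [simp]: "top epowr q = top"
  by (simp add: ennreal_powr_def)

lemma epowr_zero [simp]: "0 epowr q = 0"
  by (simp add: ennreal_powr_def)

lemma epowr_one [simp]: "x epowr 1 = x"
  by (cases x) (simp_all add: ennreal_powr_def)

lemma epowr_eq_zero_iff [simp]: "x epowr q = 0 \<longleftrightarrow> x = 0"
  by (cases x) (auto simp: ennreal_powr_def)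

lemma epowr_eq_top_iff [simp]: "x epowr q = top \<longleftrightarrow> x = top"
  by (cases x) (auto simp: ennreal_powr_def)

lemma epowr_less_top_iff [simp]: "x epowr q < top \<longleftrightarrow> x < top"
  by (simp add: less_top[symmetric])

lemma epowr_mono: "x \<le> y \<Longrightarrow> 0 \<le> q \<Longrightarrow> x epowr q \<le> y epowr q"
  by (cases x; cases y) (auto simp: ennreal_powr_def powr_mono2 top_unique intro!: ennreal_leI)

text \<open>The laws of exponents hold for all real exponents and all values:
  \<open>0 epowr q = 0\<close>, \<open>top epowr q = top\<close> for every \<open>q\<close>, and
  \<open>0 * top = 0\<close> match on both sides. In particular the exponent \<open>0\<close> fixes
  \<open>0\<close> and \<open>top\<close>.\<close>

lemma epowr_mult: "(x * y) epowr q = x epowr q * y epowr q"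
proof (cases "x = top \<or> y = top")
  case True
  then show ?thesis
    by (cases "x = 0 \<or> y = 0") (auto simp: ennreal_mult_top ennreal_top_mult)
next
  case False
  then obtain a b where "x = ennreal a" "0 \<le> a" "y = ennreal b" "0 \<le> b"
    by (metis ennreal_cases)
  then show ?thesis
    by (simp add: epowr_ennreal powr_mult flip: ennreal_mult)
qed

lemma epowr_epowr: "(x epowr a) epowr b = x epowr (a * b)"
  by (cases x) (simp_all add: epowr_ennreal powr_powr)

lemma epowr_add: "x epowr (a + b) = x epowr a * x epowr b"
  by (cases x) (simp_all add: epowr_ennreal powr_add flip: ennreal_mult)

lemma epowr_cancel: "q \<noteq> 0 \<Longrightarrow> (x epowr (1 / q)) epowr q = x" "q \<noteq> 0 \<Longrightarrow> (x epowr q) epowr (1 / q) = x"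
  by (simp_all add: epowr_epowr)

lemma borel_measurable_epowr [measurable]:
  assumes [measurable]: "f \<in> borel_measurable M"
  shows "(\<lambda>x. f x epowr q) \<in> borel_measurable M"
  unfolding infinity_ennreal_def ennreal_powr_def by measurable

lemma epowr_sum_le:
  assumes "0 \<le> q"
  shows "(x + y) epowr q \<le> ennreal (2 powr q) * (x epowr q + y epowr q)"
proof -
  have "(x + y) \<le> 2 * max x y"
    by (metis add_mono max.cobounded1 max.cobounded2 mult_2)
  then have "(x + y) epowr q \<le> (2 * max x y) epowr q"
    by (rule epowr_mono[OF _ assms])
  also have "\<dots> = ennreal (2 powr q) * max x y epowr q"
    using epowr_ennreal[of 2 q] by (simp add: epowr_mult)
  also have "max x y epowr q \<le> x epowr q + y epowr q"
    by (simp add: max_def)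
  finally show ?thesis by (simp add: mult_left_mono)
qed

lemma epowr_sum3_le:
  assumes "0 \<le> q"
  shows "(x + y + z) epowr q \<le> ennreal (4 powr q) * (x epowr q + y epowr q + z epowr q)"
proof -
  have 1: "1 \<le> ennreal (2 powr q)" using assms by (simp add: ge_one_powr_ge_zero)
  have "(x + y + z) epowr q \<le> ennreal (2 powr q) * ((x + y) epowr q + z epowr q)"
    by (rule epowr_sum_le[OF assms])
  also have "\<dots> \<le> ennreal (2 powr q) * (ennreal (2 powr q) * (x epowr q + y epowr q) + ennreal (2 powr q) * z epowr q)"
    using mult_right_mono[OF 1, of "z epowr q"] epowr_sum_le[OF assms, of x y]
    by (intro mult_left_mono add_mono) auto
  also have "\<dots> = ennreal (4 powr q) * (x epowr q + y epowr q + z epowr q)"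
    using powr_mult[of 2 2 q] by (simp add: distrib_left ennreal_mult mult.assoc add.assoc)
  finally show ?thesis .
qed

text \<open>Each term is at most \<open>2 powr (- \<epsilon> k / q)\<close> times the
  \<open>q\<close>-th root of the weighted series, and these factors form a geometric series. The
  weight \<open>2 powr (\<epsilon> k)\<close> is affordable because rescaling the
  \<open>k\<close>-th term will gain more than it loses.\<close>

lemma epowr_suminf_le:
  assumes q: "0 < q" and \<epsilon>: "0 < \<epsilon>"
  shows "(\<Sum>k. a k) epowr q \<le> ennreal ((1 / (1 - 2 powr (- \<epsilon> / q))) powr q) * (\<Sum>k. ennreal (2 powr (\<epsilon> * real k)) * a k epowr q)"
proof -
  define S where "S = (\<Sum>k. ennreal (2 powr (\<epsilon> * real k)) * a k epowr q)"
  define t where "t = 2 powr (- \<epsilon> / q)"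
  have t: "0 < t" "t < 1"
    using q \<epsilon> by (auto simp: t_def powr_less_one)
  have "a k \<le> ennreal (t ^ k) * S epowr (1 / q)" for k
  proof -
    have "ennreal (2 powr (\<epsilon> * real k)) * a k epowr q \<le> S"
      unfolding S_def using sum_le_suminf[OF summableI, of "{k}"] by simp
    then have "(ennreal (2 powr (\<epsilon> * real k)) * a k epowr q) epowr (1 / q) \<le> S epowr (1 / q)"
      using q by (intro epowr_mono) auto
    then have "ennreal (2 powr (\<epsilon> * real k / q)) * a k \<le> S epowr (1 / q)"
      using q by (simp add: epowr_mult epowr_cancel epowr_ennreal powr_powr)
    then have "ennreal (t ^ k) * (ennreal (2 powr (\<epsilon> * real k / q)) * a k) \<le> ennreal (t ^ k) * S epowr (1 / q)"
      by (rule mult_left_mono) simp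
    moreover have "t ^ k * 2 powr (\<epsilon> * real k / q) = 1"
      unfolding t_def by (simp add: powr_realpow[symmetric] powr_powr flip: powr_add)
    then have "ennreal (t ^ k) * ennreal (2 powr (\<epsilon> * real k / q)) = 1"
      using t by (simp flip: ennreal_mult)
    ultimately show ?thesis
      by (simp add: mult.assoc[symmetric])
  qed
  then have "(\<Sum>k. a k) \<le> (\<Sum>k. ennreal (t ^ k) * S epowr (1 / q))"
    by (intro suminf_le) auto
  also have "\<dots> = ennreal (1 / (1 - t)) * S epowr (1 / q)"
    using t suminf_geometric[of t] by (simp add: suminf_ennreal2 summable_geometric)
  finally have "(\<Sum>k. a k) epowr q \<le> (ennreal (1 / (1 - t)) * S epowr (1 / q)) epowr q"
    using q by (intro epowr_mono) auto
  also have "\<dots> = ennreal ((1 / (1 - t)) powr q) * S"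
    using q t by (simp add: epowr_mult epowr_cancel epowr_ennreal)
  finally show ?thesis by (simp add: S_def t_def)
qed

text \<open>A form of Jensen's inequality with a superfluous factor, from
  \<open>f \<le> t + t\<^bsup>1-q\<^esup> f\<^bsup>q\<^esup>\<close> with \<open>t = (\<integral> w f\<^bsup>q\<^esup>)\<^bsup>1/q\<^esup>\<close>.\<close>

lemma jensen_epowr:
  assumes [measurable]: "w \<in> borel_measurable M" "f \<in> borel_measurable M"
    and w: "(\<integral>\<^sup>+ x. w x \<partial>M) \<le> 1" and q: "1 \<le> q"
  shows "(\<integral>\<^sup>+ x. w x * f x \<partial>M) epowr q \<le> ennreal (2 powr q) * (\<integral>\<^sup>+ x. w x * f x epowr q \<partial>M)"
proof -
  define J where "J = (\<integral>\<^sup>+ x. w x * f x epowr q \<partial>M)"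
  have bound: "(\<integral>\<^sup>+ x. w x * f x \<partial>M) \<le> ennreal t + ennreal (t powr (1 - q)) * J" if t: "0 < t" for t
  proof -
    have pt: "a \<le> ennreal t + ennreal (t powr (1 - q)) * a epowr q" for a
    proof (cases a)
      case (real b)
      have "b \<le> t + t powr (1 - q) * b powr q"
      proof (cases "b \<le> t")
        case False
        then have "t powr (q - 1) \<le> b powr (q - 1)"
          using t q by (intro powr_mono2) auto
        then have "b * 1 \<le> b * (t powr (1 - q) * b powr (q - 1))"
          using t False by (intro mult_left_mono)
            (auto simp: powr_diff field_simps)
        also have "\<dots> = t powr (1 - q) * b powr q"
          using t False by (simp add: powr_diff)
        finally show ?thesis using t by simp
      qed (use t in \<open>simp add: add_increasing2\<close>)
      then show ?thesis
        using real t by (simp add: epowr_ennreal flip: ennreal_mult ennreal_plus)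
    qed (use t in \<open>simp add: ennreal_mult_top\<close>)
    have "(\<integral>\<^sup>+ x. w x * f x \<partial>M) \<le> (\<integral>\<^sup>+ x. ennreal t * w x + ennreal (t powr (1 - q)) * (w x * f x epowr q) \<partial>M)"
      using mult_left_mono[OF pt, of "w _"] by (intro nn_integral_mono) (simp add: algebra_simps)
    also have "\<dots> = ennreal t * (\<integral>\<^sup>+ x. w x \<partial>M) + ennreal (t powr (1 - q)) * J"
      by (simp add: nn_integral_add nn_integral_cmult J_def)
    also have "\<dots> \<le> ennreal t + ennreal (t powr (1 - q)) * J"
      using mult_left_mono[OF w, of "ennreal t"] by simp
    finally show ?thesis .
  qed
  have "(\<integral>\<^sup>+ x. w x * f x \<partial>M) \<le> 2 * J epowr (1 / q)"
  proof (cases J)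
    case (real j)
    show ?thesis
    proof (cases "j = 0")
      \<comment> \<open>For \<open>J = 0\<close> the choice of \<open>t\<close> degenerates to
        \<open>0\<close>; the bound is used for every \<open>t > 0\<close> instead.\<close>
      case True
      then have "(\<integral>\<^sup>+ x. w x * f x \<partial>M) \<le> 0 + ennreal t" if "0 < t" for t
        using bound[OF that] real by simp
      then have "(\<integral>\<^sup>+ x. w x * f x \<partial>M) \<le> 0"
        by (rule ennreal_le_epsilon)
      then show ?thesis by simp
    next
      case False
      then have j: "0 < j" using real by simp
      define t where "t = j powr (1 / q)"
      have t: "0 < t" using j by (simp add: t_def)
      have "t powr (1 - q) * j = t"
      proof -
        have "j = t powr q" using j q by (simp add: t_def powr_powr)
        then have "t powr (1 - q) * j = t powr (1 - q + q)" by (simp only: powr_add)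
        then show ?thesis using t by simp
      qed
      then have "ennreal (t powr (1 - q)) * J = ennreal t"
        using real by (simp flip: ennreal_mult)
      then have "(\<integral>\<^sup>+ x. w x * f x \<partial>M) \<le> ennreal t + ennreal t" using bound[OF t] by simp
      also have "\<dots> = 2 * J epowr (1 / q)"
        using real by (simp add: t_def epowr_ennreal mult_2)
      finally show ?thesis .
    qed
  qed (use q in \<open>simp add: ennreal_mult_top\<close>)
  then have "(\<integral>\<^sup>+ x. w x * f x \<partial>M) epowr q \<le> (2 * J epowr (1 / q)) epowr q"
    using q by (intro epowr_mono) auto
  also have "\<dots> = ennreal (2 powr q) * J"
    using q epowr_ennreal[of 2 q] by (simp add: epowr_mult epowr_cancel)
  finally show ?thesis by (simp add: J_def)
qed

section \<open>Affine changes of variables and averages over balls\<close>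

lemma nn_integral_lborel_shift:
  fixes f :: "'a::euclidean_space \<Rightarrow> ennreal"
  assumes [measurable]: "f \<in> borel_measurable borel"
  shows "(\<integral>\<^sup>+ x. f (t + x) \<partial>lborel) = (\<integral>\<^sup>+ x. f x \<partial>lborel)"
  by (subst lborel_affine[of 1 t]) (simp_all add: nn_integral_density nn_integral_distr)

lemma nn_integral_lborel_affine:
  fixes f :: "'a::euclidean_space \<Rightarrow> ennreal"
  assumes [measurable]: "f \<in> borel_measurable borel" and c: "c \<noteq> 0"
  shows "(\<integral>\<^sup>+ x. f (t + c *\<^sub>R x) \<partial>lborel) = ennreal (\<bar>1 / c\<bar> ^ DIM('a)) * (\<integral>\<^sup>+ x. f x \<partial>lborel)"
proof -
  have "(\<integral>\<^sup>+ x. f x \<partial>lborel) = ennreal (\<bar>c\<bar> ^ DIM('a)) * (\<integral>\<^sup>+ x. f (t + c *\<^sub>R x) \<partial>lborel)"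
    by (subst lborel_affine[OF c, of t])
       (simp add: nn_integral_density nn_integral_distr nn_integral_cmult ennreal_power)
  moreover have "ennreal (\<bar>1 / c\<bar> ^ DIM('a)) * ennreal (\<bar>c\<bar> ^ DIM('a)) = 1"
    using c by (simp flip: ennreal_mult power_mult_distrib)
  ultimately show ?thesis
    by (simp add: mult.assoc[symmetric])
qed

text \<open>Total in \<open>r\<close>: for \<open>r \<le> 0\<close> the ball is empty and the value
  is \<open>0\<close>, so bounds for oscillations can be stated for every real radius.\<close>

definition ball_avg :: "('a::euclidean_space \<Rightarrow> ennreal) \<Rightarrow> 'a \<Rightarrow> real \<Rightarrow> ennreal" where
  "ball_avg f x r = ennreal (inverse (unit_ball_vol (real DIM('a)) * r ^ DIM('a))) *
     (\<integral>\<^sup>+ z. indicator (ball x r) z * f z \<partial>lborel)"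

lemma ball_in_sets_borel [measurable]: "ball (x::'a::metric_space) r \<in> sets borel"
  by (simp add: borel_open)

lemma borel_measurable_ball_avg [measurable (raw)]:
  fixes a :: "'b \<Rightarrow> 'a::euclidean_space"
  assumes [measurable]: "a \<in> borel_measurable M" "r \<in> borel_measurable M"
    "(\<lambda>(y, z). f y z) \<in> borel_measurable (M \<Otimes>\<^sub>M borel)"
  shows "(\<lambda>y. ball_avg (f y) (a y) (r y)) \<in> borel_measurable M"
proof -
  have [measurable]: "(\<lambda>(y, z). indicator (ball (a y) (r y)) z :: ennreal) \<in> borel_measurable (M \<Otimes>\<^sub>M borel)"
  proof -
    have "(\<lambda>(y, z). indicator (ball (a y) (r y)) z :: ennreal) =
        (\<lambda>p. if dist (a (fst p)) (snd p) < r (fst p) then 1 else 0)"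
      by (auto simp: indicator_def)
    then show ?thesis by simp
  qed
  show ?thesis unfolding ball_avg_def by measurable
qed

lemma ball_avg_mono: "(\<And>z. z \<in> ball x r \<Longrightarrow> f z \<le> g z) \<Longrightarrow> ball_avg f x r \<le> ball_avg g x r"
  unfolding ball_avg_def by (rule mult_left_mono[OF nn_integral_mono]) (auto simp: indicator_def)

lemma ball_avg_cmult:
  assumes [measurable]: "f \<in> borel_measurable borel"
  shows "ball_avg (\<lambda>z. c * f z) x r = c * ball_avg f x r"
proof -
  have "(\<integral>\<^sup>+ z. indicator (ball x r) z * (c * f z) \<partial>lborel) = c * (\<integral>\<^sup>+ z. indicator (ball x r) z * f z \<partial>lborel)"
    by (subst nn_integral_cmult[symmetric]) (auto simp: mult.left_commute)
  then show ?thesis unfolding ball_avg_def by (simp add: mult.left_commute)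
qed

lemma ball_avg_add:
  assumes [measurable]: "f \<in> borel_measurable borel" "g \<in> borel_measurable borel"
  shows "ball_avg (\<lambda>z. f z + g z) x r = ball_avg f x r + ball_avg g x r"
  unfolding ball_avg_def distrib_left by (subst nn_integral_add) (auto simp: distrib_left)

lemma ball_avg_const:
  assumes "0 < r"
  shows "ball_avg (\<lambda>_. c) (x::'a::euclidean_space) r = c"
proof -
  have p: "0 < unit_ball_vol (real DIM('a)) * r ^ DIM('a)" using assms by simp
  have "ball_avg (\<lambda>_. c) x r = ennreal (inverse (unit_ball_vol (real DIM('a)) * r ^ DIM('a))) * ennreal (unit_ball_vol (real DIM('a)) * r ^ DIM('a)) * c"
    unfolding ball_avg_def using assms by (subst nn_integral_multc) (auto simp: emeasure_ball mult.assoc)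
  also have "ennreal (inverse (unit_ball_vol (real DIM('a)) * r ^ DIM('a))) * ennreal (unit_ball_vol (real DIM('a)) * r ^ DIM('a)) = 1"
    by (metis ennreal_1 ennreal_mult' inverse_nonnegative_iff_nonnegative left_inverse less_imp_le order_less_irrefl p)
  finally show ?thesis by simp
qed

lemma ball_avg_subset:
  assumes "ball x r \<subseteq> ball y R" "0 < r"
  shows "ball_avg f x r \<le> ennreal ((R / r) ^ DIM('a)) * ball_avg f (y::'a::euclidean_space) R"
proof -
  have R: "0 < R" using assms by (metis ball_eq_empty leI subset_empty not_le)
  have p: "0 < unit_ball_vol (real DIM('a))" by simp
  have "ball_avg f x r \<le> ennreal (inverse (unit_ball_vol (real DIM('a)) * r ^ DIM('a))) *
     (\<integral>\<^sup>+ z. indicator (ball y R) z * f z \<partial>lborel)"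
    unfolding ball_avg_def using assms
    by (intro mult_left_mono nn_integral_mono mult_right_mono) (auto simp: indicator_def)
  also have "inverse (unit_ball_vol (real DIM('a)) * r ^ DIM('a)) =
    (R / r) ^ DIM('a) * inverse (unit_ball_vol (real DIM('a)) * R ^ DIM('a))"
    using p assms R by (simp add: field_simps)
  finally show ?thesis unfolding ball_avg_def using assms R
    by (simp add: ennreal_mult mult.assoc)
qed

lemma ball_avg_jensen:
  fixes x :: "'a::euclidean_space"
  assumes [measurable]: "f \<in> borel_measurable borel" and q: "1 \<le> q"
  shows "ball_avg f x r epowr q \<le> ennreal (2 powr q) * ball_avg (\<lambda>z. f z epowr q) x r"
proof (cases "0 < r")
  case True
  have eq: "ball_avg g x r = (\<integral>\<^sup>+ z. ennreal (inverse (unit_ball_vol (real DIM('a)) * r ^ DIM('a))) * indicator (ball x r) z * g z \<partial>lborel)"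
    if "g \<in> borel_measurable borel" for g
    using that unfolding ball_avg_def mult.assoc by (subst nn_integral_cmult) auto
  have "(\<integral>\<^sup>+ z. ennreal (inverse (unit_ball_vol (real DIM('a)) * r ^ DIM('a))) * indicator (ball x r) z \<partial>lborel) \<le> 1"
    using eq[of "\<lambda>_. 1"] ball_avg_const[OF True, of 1 x] by simp
  then show ?thesis
    unfolding eq[OF assms(1)] eq[OF borel_measurable_epowr[OF assms(1)]]
    by (intro jensen_epowr q) auto
qed (simp add: ball_avg_def ball_empty)

subsection \<open>Integrals of powers of the norm\<close>

lemma cball_in_sets_borel [measurable]: "cball (x::'a::metric_space) r \<in> sets borel"
  by (simp add: borel_closed)

lemma ex_power_of_two_bracket:
  fixes x :: real
  assumes "1 \<le> x"
  shows "\<exists>k::nat. 2 ^ k \<le> x \<and> x < 2 ^ Suc k"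
proof -
  define k where "k = nat \<lfloor>log 2 x\<rfloor>"
  have "0 \<le> log 2 x" using assms by simp
  then have "real k \<le> log 2 x" "log 2 x < real (Suc k)"
    unfolding k_def by linarith+
  then have "2 powr real k \<le> x" "x < 2 powr real (Suc k)"
    using assms by (simp_all add: le_log_iff log_less_iff)
  then show ?thesis by (auto simp only: powr_realpow)
qed

text \<open>Takes the place of polar coordinates: on the shell of radii from \<open>r k\<close> to
  \<open>2 * r k\<close> the weight is at most \<open>r k powr (- a)\<close>, and the shell lies in
  a ball of volume proportional to \<open>r k ^ N\<close>. Growing radii will give the tail,
  shrinking radii a neighbourhood of the origin.\<close>

lemma nn_integral_norm_powr_dyadic:
  fixes S :: "'a::euclidean_space set" and r :: "nat \<Rightarrow> real"
  assumes r: "\<And>k. 0 < r k" and a: "0 \<le> a"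
    and S: "\<And>h. h \<in> S \<Longrightarrow> \<exists>k. r k \<le> norm h \<and> norm h \<le> 2 * r k"
  shows "(\<integral>\<^sup>+ h. indicator S h * ennreal (norm h powr (- a)) \<partial>lborel) \<le>
    ennreal (unit_ball_vol (real DIM('a)) * 2 ^ DIM('a)) * (\<Sum>k. ennreal (r k powr (real DIM('a) - a)))"
proof -
  have "(\<integral>\<^sup>+ h. indicator S h * ennreal (norm h powr (- a)) \<partial>lborel) \<le>
    (\<integral>\<^sup>+ h. (\<Sum>k. ennreal (r k powr (- a)) * indicator (cball 0 (2 * r k)) h) \<partial>(lborel :: 'a measure))"
  proof (rule nn_integral_mono)
    fix h :: 'a
    show "indicator S h * ennreal (norm h powr (- a)) \<le> (\<Sum>k. ennreal (r k powr (- a)) * indicator (cball 0 (2 * r k)) h)"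
    proof (cases "h \<in> S")
      case True
      from S[OF this] obtain k where k: "r k \<le> norm h" "norm h \<le> 2 * r k" by blast
      have "norm h powr (- a) \<le> r k powr (- a)"
        using k r[of k] a by (intro powr_mono2') auto
      then have "indicator S h * ennreal (norm h powr (- a)) \<le> ennreal (r k powr (- a)) * indicator (cball 0 (2 * r k)) h"
        using True k by (simp add: ennreal_leI)
      also have "\<dots> \<le> (\<Sum>k. ennreal (r k powr (- a)) * indicator (cball 0 (2 * r k)) h)"
        using sum_le_suminf[OF summableI, of "{k}"] by simp
      finally show ?thesis .
    qed simp
  qed
  also have "\<dots> = (\<Sum>k. ennreal (r k powr (- a)) * ennreal (unit_ball_vol (real DIM('a)) * (2 * r k) ^ DIM('a)))"
  proof -
    have "(\<integral>\<^sup>+ h. ennreal (r k powr (- a)) * indicator (cball 0 (2 * r k)) h \<partial>(lborel :: 'a measure)) =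
      ennreal (r k powr (- a)) * ennreal (unit_ball_vol (real DIM('a)) * (2 * r k) ^ DIM('a))" for k
      using emeasure_cball[of "2 * r k" "0::'a"] r[of k] by (simp add: nn_integral_cmult_indicator)
    moreover have "(\<integral>\<^sup>+ h. (\<Sum>k. ennreal (r k powr (- a)) * indicator (cball 0 (2 * r k)) h) \<partial>(lborel :: 'a measure)) =
      (\<Sum>k. \<integral>\<^sup>+ h. ennreal (r k powr (- a)) * indicator (cball 0 (2 * r k)) h \<partial>(lborel :: 'a measure))"
      by (rule nn_integral_suminf) measurable
    ultimately show ?thesis by simp
  qed
  also have "\<dots> = (\<Sum>k. ennreal (unit_ball_vol (real DIM('a)) * 2 ^ DIM('a)) * ennreal (r k powr (real DIM('a) - a)))"
  proof (intro suminf_cong)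
    fix k
    have "r k powr (- a) * (unit_ball_vol (real DIM('a)) * (2 * r k) ^ DIM('a)) =
      unit_ball_vol (real DIM('a)) * 2 ^ DIM('a) * r k powr (real DIM('a) - a)"
      using r[of k] by (simp add: power_mult_distrib powr_diff powr_minus powr_realpow field_simps)
    then show "ennreal (r k powr (- a)) * ennreal (unit_ball_vol (real DIM('a)) * (2 * r k) ^ DIM('a)) =
      ennreal (unit_ball_vol (real DIM('a)) * 2 ^ DIM('a)) * ennreal (r k powr (real DIM('a) - a))"
      using r[of k] by (subst (1 2) ennreal_mult[symmetric]) auto
  qed
  finally show ?thesis by simp
qed

text \<open>The first two factors are the volume of a ball of radius \<open>2\<close>; the last is
  the geometric series with ratio \<open>2 powr (N - a)\<close>, one term for each dyadic
  shell.\<close>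

definition tail_const :: "real \<Rightarrow> real \<Rightarrow> real" where
  "tail_const N a = unit_ball_vol N * 2 powr N * (1 / (1 - 2 powr (N - a)))"

lemma tail_const_pos: "0 \<le> N \<Longrightarrow> N < a \<Longrightarrow> 0 < tail_const N a"
  unfolding tail_const_def by (simp add: powr_less_one)

lemma nn_integral_norm_powr_tail:
  assumes \<rho>: "0 < \<rho>" and a: "real DIM('a::euclidean_space) < a"
  shows "(\<integral>\<^sup>+ h. indicator {h. \<rho> \<le> norm h} h * ennreal (norm (h::'a) powr (- a)) \<partial>lborel) \<le>
    ennreal (tail_const (real DIM('a)) a * \<rho> powr (real DIM('a) - a))"
proof -
  let ?N = "real DIM('a)"
  define t where "t = 2 powr (?N - a)"
  have t: "0 < t" "t < 1" using a by (auto simp: t_def powr_less_one)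
  have "(\<integral>\<^sup>+ h. indicator {h. \<rho> \<le> norm h} h * ennreal (norm (h::'a) powr (- a)) \<partial>lborel) \<le>
    ennreal (unit_ball_vol ?N * 2 ^ DIM('a)) * (\<Sum>k. ennreal ((2 ^ k * \<rho>) powr (?N - a)))"
  proof (rule nn_integral_norm_powr_dyadic)
    fix h :: 'a assume "h \<in> {h. \<rho> \<le> norm h}"
    then have "1 \<le> norm h / \<rho>" using \<rho> by simp
    from ex_power_of_two_bracket[OF this] show "\<exists>k. 2 ^ k * \<rho> \<le> norm h \<and> norm h \<le> 2 * (2 ^ k * \<rho>)"
      using \<rho> by (auto simp: field_simps intro: less_imp_le)
  qed (use \<rho> a in \<open>auto intro: order_trans[of _ ?N]\<close>)
  also have "(\<lambda>k. (2 ^ k * \<rho>) powr (?N - a)) = (\<lambda>k. \<rho> powr (?N - a) * t ^ k)"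
    using \<rho> by (auto simp: t_def powr_mult powr_realpow[symmetric] powr_powr mult_ac)
  also have "(\<Sum>k. ennreal (\<rho> powr (?N - a) * t ^ k)) = ennreal (\<rho> powr (?N - a) * (1 / (1 - t)))"
    using t suminf_geometric[of t] by (subst suminf_ennreal2) (auto simp: suminf_mult summable_geometric)
  also have "ennreal (unit_ball_vol ?N * 2 ^ DIM('a)) * \<dots> = ennreal (tail_const ?N a * \<rho> powr (?N - a))"
    using t \<rho> by (subst ennreal_mult[symmetric]) (auto simp: tail_const_def t_def powr_realpow mult_ac)
  finally show ?thesis .
qed

lemma nn_integral_norm_powr_unit_ball:
  assumes a: "0 \<le> a" "a < real DIM('a::euclidean_space)"
  shows "(\<integral>\<^sup>+ h. indicator (ball 0 1) h * ennreal (norm (h::'a) powr (- a)) \<partial>lborel) < top"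
proof -
  let ?N = "real DIM('a)"
  define t where "t = 2 powr (a - ?N)"
  have t: "0 < t" "t < 1" using a by (auto simp: t_def powr_less_one)
  \<comment> \<open>The origin lies in no shell. Dropping it loses nothing, since
    \<open>0 powr (- a) = 0\<close>.\<close>
  have "(\<integral>\<^sup>+ h. indicator (ball 0 1) h * ennreal (norm (h::'a) powr (- a)) \<partial>lborel) \<le>
    (\<integral>\<^sup>+ h. indicator (ball 0 1 - {0}) h * ennreal (norm (h::'a) powr (- a)) \<partial>lborel)"
    by (intro nn_integral_mono) (auto simp: indicator_def)
  also have "\<dots> \<le> ennreal (unit_ball_vol ?N * 2 ^ DIM('a)) * (\<Sum>k. ennreal ((1 / 2 ^ Suc k) powr (?N - a)))"
  proof (rule nn_integral_norm_powr_dyadic)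
    fix h :: 'a assume "h \<in> ball 0 1 - {0}"
    then have h: "0 < norm h" "1 \<le> 1 / norm h" by auto
    from ex_power_of_two_bracket[OF h(2)] obtain k where "2 ^ k \<le> 1 / norm h" "1 / norm h < 2 ^ Suc k" by blast
    then have "1 / 2 ^ Suc k \<le> norm h \<and> norm h \<le> 2 * (1 / 2 ^ Suc k)"
      using h(1) by (auto simp: field_simps)
    then show "\<exists>k. 1 / 2 ^ Suc k \<le> norm h \<and> norm h \<le> 2 * (1 / 2 ^ Suc k)" ..
  qed (use a in auto)
  also have "(\<lambda>k. (1 / 2 ^ Suc k) powr (?N - a)) = (\<lambda>k. t * t ^ k)"
  proof
    fix k
    have "(1 / 2 ^ Suc k) powr (?N - a) = (2 powr (- real (Suc k))) powr (?N - a)"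
      by (simp add: powr_minus_divide powr_realpow del: of_nat_Suc power_Suc)
    also have "\<dots> = t powr real (Suc k)"
      by (simp only: t_def powr_powr) (simp add: algebra_simps)
    also have "\<dots> = t * t ^ k" using t by (simp add: powr_realpow del: of_nat_Suc)
    finally show "(1 / 2 ^ Suc k) powr (?N - a) = t * t ^ k" .
  qed
  also have "(\<Sum>k. ennreal (t * t ^ k)) = ennreal (t * (1 / (1 - t)))"
    using t suminf_geometric[of t] by (subst suminf_ennreal2) (auto simp: suminf_mult summable_geometric)
  also have "ennreal (unit_ball_vol ?N * 2 ^ DIM('a)) * \<dots> < top"
    by (simp add: ennreal_mult_less_top)
  finally show ?thesis .
qed

text \<open>Moves the two points \<open>z\<close>, \<open>w\<close> of a ball outermost, so that in
  the oscillation energy the centre \<open>x\<close> and then the scale \<open>h\<close> can be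
  integrated out.\<close>

lemma nn_integral_swap_pairs:
  fixes f :: "'a::euclidean_space \<times> 'b::euclidean_space \<times> 'c::euclidean_space \<times> 'd::euclidean_space \<Rightarrow> ennreal"
  assumes [measurable]: "f \<in> borel_measurable borel"
  shows "(\<integral>\<^sup>+ x. \<integral>\<^sup>+ h. \<integral>\<^sup>+ z. \<integral>\<^sup>+ w. f (x, h, z, w) \<partial>lborel \<partial>lborel \<partial>lborel \<partial>lborel) =
    (\<integral>\<^sup>+ z. \<integral>\<^sup>+ w. \<integral>\<^sup>+ h. \<integral>\<^sup>+ x. f (x, h, z, w) \<partial>lborel \<partial>lborel \<partial>lborel \<partial>lborel)"
proof -
  have "(\<integral>\<^sup>+ x. \<integral>\<^sup>+ h. \<integral>\<^sup>+ z. \<integral>\<^sup>+ w. f (x, h, z, w) \<partial>lborel \<partial>lborel \<partial>lborel \<partial>lborel) =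
    (\<integral>\<^sup>+ x. \<integral>\<^sup>+ z. \<integral>\<^sup>+ h. \<integral>\<^sup>+ w. f (x, h, z, w) \<partial>lborel \<partial>lborel \<partial>lborel \<partial>lborel)"
    by (intro nn_integral_cong lborel_pair.Fubini'[symmetric]) measurable
  also have "\<dots> = (\<integral>\<^sup>+ z. \<integral>\<^sup>+ x. \<integral>\<^sup>+ h. \<integral>\<^sup>+ w. f (x, h, z, w) \<partial>lborel \<partial>lborel \<partial>lborel \<partial>lborel)"
    by (intro lborel_pair.Fubini'[symmetric]) measurable
  also have "\<dots> = (\<integral>\<^sup>+ z. \<integral>\<^sup>+ x. \<integral>\<^sup>+ w. \<integral>\<^sup>+ h. f (x, h, z, w) \<partial>lborel \<partial>lborel \<partial>lborel \<partial>lborel)"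
    by (intro nn_integral_cong lborel_pair.Fubini'[symmetric]) measurable
  also have "\<dots> = (\<integral>\<^sup>+ z. \<integral>\<^sup>+ w. \<integral>\<^sup>+ x. \<integral>\<^sup>+ h. f (x, h, z, w) \<partial>lborel \<partial>lborel \<partial>lborel \<partial>lborel)"
    by (intro nn_integral_cong lborel_pair.Fubini'[symmetric]) measurable
  also have "\<dots> = (\<integral>\<^sup>+ z. \<integral>\<^sup>+ w. \<integral>\<^sup>+ h. \<integral>\<^sup>+ x. f (x, h, z, w) \<partial>lborel \<partial>lborel \<partial>lborel \<partial>lborel)"
    by (intro nn_integral_cong lborel_pair.Fubini'[symmetric]) measurable
  finally show ?thesis .
qed

subsection \<open>Mean oscillation and the Gagliardo energy\<close>

lemma nn_integral_cmult_iterated: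
  assumes [measurable]: "(\<lambda>(z, w). f z w) \<in> borel_measurable (lborel \<Otimes>\<^sub>M lborel)"
  shows "(\<integral>\<^sup>+ z. \<integral>\<^sup>+ w. c * f z w \<partial>lborel \<partial>lborel) = c * (\<integral>\<^sup>+ z. \<integral>\<^sup>+ w. f z w \<partial>lborel \<partial>lborel)"
proof -
  have "(\<integral>\<^sup>+ z. \<integral>\<^sup>+ w. c * f z w \<partial>lborel \<partial>lborel) = (\<integral>\<^sup>+ z. c * (\<integral>\<^sup>+ w. f z w \<partial>lborel) \<partial>lborel)"
    by (intro nn_integral_cong nn_integral_cmult) measurable
  also have "\<dots> = c * (\<integral>\<^sup>+ z. \<integral>\<^sup>+ w. f z w \<partial>lborel \<partial>lborel)"
    by (rule nn_integral_cmult) measurable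
  finally show ?thesis .
qed

text \<open>Oscillation as a double average rather than as distance from the mean: this is the
  functional inside the BMO seminorm, and it is meaningful in \<open>ennreal\<close> for every
  measurable \<open>v\<close>.\<close>

definition osc :: "('a::euclidean_space \<Rightarrow> real) \<Rightarrow> 'a \<Rightarrow> real \<Rightarrow> ennreal" where
  "osc v x r = ball_avg (\<lambda>z. ball_avg (\<lambda>w. ennreal \<bar>v z - v w\<bar>) x r) x r"

text \<open>The scale is \<open>norm h\<close> with \<open>h\<close> ranging over the whole space,
  in place of a radial variable, so that the dilations of Lebesgue measure act on scales and the
  weight is literally that of the Gagliardo integral.\<close>

definition osc_energy :: "real \<Rightarrow> ('a::euclidean_space \<Rightarrow> real) \<Rightarrow> ennreal" where
  "osc_energy q v = (\<integral>\<^sup>+ x. \<integral>\<^sup>+ h. osc v x (norm (h :: 'a)) epowr q *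
     ennreal (norm h powr (- 2 * real DIM('a))) \<partial>lborel \<partial>lborel)"

definition gag_energy :: "real \<Rightarrow> ('a::euclidean_space \<Rightarrow> real) \<Rightarrow> ennreal" where
  "gag_energy q v = (\<integral>\<^sup>+ z. \<integral>\<^sup>+ w. ennreal (\<bar>v z - v w\<bar> powr q) *
     ennreal (norm (z - w) powr (- 2 * real DIM('a))) \<partial>lborel \<partial>lborel)"

lemma borel_measurable_osc [measurable (raw)]:
  fixes a :: "'b \<Rightarrow> 'a::euclidean_space"
  assumes [measurable]: "v \<in> borel_measurable borel" "a \<in> borel_measurable M" "r \<in> borel_measurable M"
  shows "(\<lambda>y. osc v (a y) (r y)) \<in> borel_measurable M"
  unfolding osc_def by measurable

lemma gag_energy_shift:
  assumes [measurable]: "v \<in> borel_measurable borel"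
  shows "gag_energy q v = (\<integral>\<^sup>+ z. \<integral>\<^sup>+ h. ennreal (\<bar>v z - v (z + h)\<bar> powr q) *
     ennreal (norm h powr (- 2 * real DIM('a::euclidean_space))) \<partial>lborel \<partial>(lborel :: 'a measure))"
  unfolding gag_energy_def
proof (rule nn_integral_cong)
  fix z :: 'a
  show "(\<integral>\<^sup>+ w. ennreal (\<bar>v z - v w\<bar> powr q) * ennreal (norm (z - w) powr (- 2 * real DIM('a))) \<partial>lborel) =
    (\<integral>\<^sup>+ h. ennreal (\<bar>v z - v (z + h)\<bar> powr q) * ennreal (norm h powr (- 2 * real DIM('a))) \<partial>lborel)"
    using nn_integral_lborel_shift[of "\<lambda>w. ennreal (\<bar>v z - v w\<bar> powr q) * ennreal (norm (z - w) powr (- 2 * real DIM('a)))" z]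
    by simp
qed

text \<open>Jensen once for each average, whence \<open>4 powr q\<close>. The constraints and the
  normalisation are put inside the integrand so that all variables range over the whole space and
  can be exchanged, also once \<open>r\<close> becomes \<open>norm h\<close>.\<close>

lemma osc_epowr_le:
  fixes v :: "'a::euclidean_space \<Rightarrow> real"
  assumes [measurable]: "v \<in> borel_measurable borel" and q: "1 \<le> q"
  shows "osc v x r epowr q \<le> ennreal (4 powr q) *
    (\<integral>\<^sup>+ z. \<integral>\<^sup>+ w. (if dist x z < r \<and> dist x w < r
      then ennreal ((inverse (unit_ball_vol (real DIM('a)) * r ^ DIM('a)))\<^sup>2 * \<bar>v z - v w\<bar> powr q) else 0) \<partial>lborel \<partial>lborel)"
proof -
  let ?c = "inverse (unit_ball_vol (real DIM('a)) * r ^ DIM('a))"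
  have "osc v x r epowr q \<le> ennreal (2 powr q) * ball_avg (\<lambda>z. ball_avg (\<lambda>w. ennreal \<bar>v z - v w\<bar>) x r epowr q) x r"
    unfolding osc_def by (rule ball_avg_jensen) (use q in auto)
  also have "\<dots> \<le> ennreal (2 powr q) * ball_avg (\<lambda>z. ennreal (2 powr q) * ball_avg (\<lambda>w. ennreal \<bar>v z - v w\<bar> epowr q) x r) x r"
    by (intro mult_left_mono ball_avg_mono ball_avg_jensen) (use q in auto)
  also have "\<dots> = ennreal (2 powr q) * (ennreal (2 powr q) * ball_avg (\<lambda>z. ball_avg (\<lambda>w. ennreal (\<bar>v z - v w\<bar> powr q)) x r) x r)"
    by (subst ball_avg_cmult) (auto simp: epowr_ennreal)
  also have "\<dots> = ennreal (4 powr q) * ball_avg (\<lambda>z. ball_avg (\<lambda>w. ennreal (\<bar>v z - v w\<bar> powr q)) x r) x r"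
    using powr_mult[of 2 2 q] by (simp add: ennreal_mult mult.assoc)
  also have "ball_avg (\<lambda>z. ball_avg (\<lambda>w. ennreal (\<bar>v z - v w\<bar> powr q)) x r) x r =
    (\<integral>\<^sup>+ z. \<integral>\<^sup>+ w. (if dist x z < r \<and> dist x w < r then ennreal (?c\<^sup>2 * \<bar>v z - v w\<bar> powr q) else 0) \<partial>lborel \<partial>lborel)"
  proof (cases "0 < r")
    case True
    have "ball_avg (\<lambda>z. ball_avg (\<lambda>w. ennreal (\<bar>v z - v w\<bar> powr q)) x r) x r =
      (\<integral>\<^sup>+ z. \<integral>\<^sup>+ w. ennreal ?c * (indicator (ball x r) z * (ennreal ?c * (indicator (ball x r) w * ennreal (\<bar>v z - v w\<bar> powr q)))) \<partial>lborel \<partial>lborel)"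
    proof -
      have "indicator (ball x r) z * (ennreal ?c * (\<integral>\<^sup>+ w. indicator (ball x r) w * ennreal (\<bar>v z - v w\<bar> powr q) \<partial>lborel)) =
        (\<integral>\<^sup>+ w. indicator (ball x r) z * (ennreal ?c * (indicator (ball x r) w * ennreal (\<bar>v z - v w\<bar> powr q))) \<partial>lborel)" for z
        by (simp only: mult.assoc[symmetric]) (subst nn_integral_cmult[symmetric], auto simp: mult_ac)
      then show ?thesis
        unfolding ball_avg_def by (subst nn_integral_cmult_iterated) (simp_all only:, measurable)
    qed
    also have "\<dots> = (\<integral>\<^sup>+ z. \<integral>\<^sup>+ w. (if dist x z < r \<and> dist x w < r then ennreal (?c\<^sup>2 * \<bar>v z - v w\<bar> powr q) else 0) \<partial>lborel \<partial>lborel)"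
    proof (intro nn_integral_cong)
      fix z w
      have "0 \<le> ?c" using True by simp
      then have "ennreal ?c * (ennreal ?c * ennreal (\<bar>v z - v w\<bar> powr q)) = ennreal (?c\<^sup>2 * \<bar>v z - v w\<bar> powr q)"
        by (subst ennreal_mult[symmetric], simp, simp)+ (simp only: power2_eq_square mult.assoc)
      then show "ennreal ?c * (indicator (ball x r) z * (ennreal ?c * (indicator (ball x r) w * ennreal (\<bar>v z - v w\<bar> powr q)))) =
        (if dist x z < r \<and> dist x w < r then ennreal (?c\<^sup>2 * \<bar>v z - v w\<bar> powr q) else 0)"
        by (auto simp: indicator_def simp del: inverse_mult_distrib)
    qed
    finally show ?thesis .
  next
    case False
    then have "\<not> dist x z < r" for z
      by (meson dist_not_less_zero order_less_trans not_less order_less_le_trans)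
    then show ?thesis using False by (simp add: ball_avg_def ball_empty)
  qed
  finally show ?thesis .
qed

text \<open>Two points of a ball of radius \<open>r\<close> are at distance at most
  \<open>2 r\<close>, so the normalisation \<open>r powr (- 2N)\<close> of the double average is
  bounded by the Gagliardo kernel at these points. No radius survives, which is what a BMO bound
  requires.\<close>

lemma osc_le_gag_energy:
  fixes v :: "'a::euclidean_space \<Rightarrow> real"
  assumes v [measurable]: "v \<in> borel_measurable borel" and q: "1 \<le> q"
  shows "osc v x r epowr q \<le> ennreal (4 powr q * (inverse (unit_ball_vol (real DIM('a))))\<^sup>2 * 2 powr (2 * real DIM('a))) * gag_energy q v"
proof -
  let ?N = "real DIM('a)" and ?\<omega> = "unit_ball_vol (real DIM('a))"
  let ?k = "(inverse ?\<omega>)\<^sup>2 * 2 powr (2 * ?N)"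
  have "(if dist x z < r \<and> dist x w < r then ennreal ((inverse (?\<omega> * r ^ DIM('a)))\<^sup>2 * \<bar>v z - v w\<bar> powr q) else 0)
    \<le> ennreal ?k * (ennreal (\<bar>v z - v w\<bar> powr q) * ennreal (norm (z - w) powr (- 2 * ?N)))" for z w
  proof (cases "dist x z < r \<and> dist x w < r \<and> z \<noteq> w")
    case True
    then have d: "norm (z - w) \<le> 2 * r" "0 < norm (z - w)"
      using dist_triangle3[of z w x] by (auto simp: dist_norm norm_minus_commute)
    then have r: "0 < r" by linarith
    have "(inverse (?\<omega> * r ^ DIM('a)))\<^sup>2 = ?k * (2 * r) powr (- 2 * ?N)"
      using r by (simp add: powr_mult powr_minus powr_realpow[symmetric] field_simps power2_eq_square mult_2 flip: powr_add)
    also have "\<dots> \<le> ?k * norm (z - w) powr (- 2 * ?N)"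
      using d by (intro mult_left_mono powr_mono2') auto
    finally have "(inverse (?\<omega> * r ^ DIM('a)))\<^sup>2 * \<bar>v z - v w\<bar> powr q \<le> ?k * (norm (z - w) powr (- 2 * ?N)) * \<bar>v z - v w\<bar> powr q"
      by (rule mult_right_mono) simp
    also have "\<dots> = ?k * (\<bar>v z - v w\<bar> powr q * norm (z - w) powr (- 2 * ?N))"
      by simp
    finally have "ennreal ((inverse (?\<omega> * r ^ DIM('a)))\<^sup>2 * \<bar>v z - v w\<bar> powr q) \<le>
      ennreal (?k * (\<bar>v z - v w\<bar> powr q * norm (z - w) powr (- 2 * ?N)))"
      by (rule ennreal_leI)
    then show ?thesis using True
      by (simp add: ennreal_mult del: inverse_mult_distrib)
  qed (use q in auto)
  then have "(\<integral>\<^sup>+ z. \<integral>\<^sup>+ w. (if dist x z < r \<and> dist x w < r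
      then ennreal ((inverse (?\<omega> * r ^ DIM('a)))\<^sup>2 * \<bar>v z - v w\<bar> powr q) else 0) \<partial>lborel \<partial>lborel) \<le>
     (\<integral>\<^sup>+ z. \<integral>\<^sup>+ w. ennreal ?k * (ennreal (\<bar>v z - v w\<bar> powr q) * ennreal (norm (z - w) powr (- 2 * ?N))) \<partial>lborel \<partial>lborel)"
    by (intro nn_integral_mono)
  also have "\<dots> = ennreal ?k * gag_energy q v"
    unfolding gag_energy_def by (rule nn_integral_cmult_iterated) measurable
  finally have "osc v x r epowr q \<le> ennreal (4 powr q) * (ennreal ?k * gag_energy q v)"
    by (intro order_trans[OF osc_epowr_le[OF v q]] mult_left_mono) auto
  then show ?thesis by (simp add: ennreal_mult mult.assoc)
qed

text \<open>For fixed \<open>z\<close> and \<open>w\<close> the centre \<open>x\<close> lies in a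
  ball of volume proportional to \<open>norm h ^ N\<close> about \<open>z\<close>, and a ball
  containing both points has \<open>norm h\<close> at least half of \<open>norm (z - w)\<close>. The
  normalisation and the weight contribute \<open>norm h powr (- 4N)\<close>, so the tail integral of
  \<open>norm h powr (- 3N)\<close> remains, and it reproduces
  \<open>norm (z - w) powr (- 2N)\<close>.\<close>

lemma osc_energy_le_gag_energy:
  fixes v :: "'a::euclidean_space \<Rightarrow> real"
  assumes v [measurable]: "v \<in> borel_measurable borel" and q: "1 \<le> q"
  shows "osc_energy q v \<le> ennreal (4 powr q * (inverse (unit_ball_vol (real DIM('a))) *
    tail_const (real DIM('a)) (3 * real DIM('a)) * 2 powr (2 * real DIM('a)))) * gag_energy q v"
proof -
  let ?N = "real DIM('a)" and ?\<omega> = "unit_ball_vol (real DIM('a))"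
  define f where "f = (\<lambda>(x::'a, h::'a, z, w). if dist x z < norm h \<and> dist x w < norm h
      then ennreal ((inverse (?\<omega> * norm h ^ DIM('a)))\<^sup>2 * \<bar>v z - v w\<bar> powr q * norm h powr (- 2 * ?N)) else 0)"
  have [measurable]: "f \<in> borel_measurable borel"
    unfolding f_def borel_prod[symmetric] by measurable
  have "osc_energy q v \<le> (\<integral>\<^sup>+ x. \<integral>\<^sup>+ h. ennreal (4 powr q) * (\<integral>\<^sup>+ z. \<integral>\<^sup>+ w. f (x, h, z, w) \<partial>lborel \<partial>lborel) \<partial>lborel \<partial>lborel)"
    unfolding osc_energy_def
  proof (intro nn_integral_mono)
    fix x h :: 'a
    let ?g = "\<lambda>z w. (if dist x z < norm h \<and> dist x w < norm h
      then ennreal ((inverse (?\<omega> * norm h ^ DIM('a)))\<^sup>2 * \<bar>v z - v w\<bar> powr q) else 0)"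
    have "osc v x (norm h) epowr q * ennreal (norm h powr (- 2 * ?N)) \<le>
      ennreal (4 powr q) * (\<integral>\<^sup>+ z. \<integral>\<^sup>+ w. ?g z w \<partial>lborel \<partial>lborel) * ennreal (norm h powr (- 2 * ?N))"
      by (rule mult_right_mono[OF osc_epowr_le[OF v q]]) simp
    also have "\<dots> = ennreal (4 powr q) * (\<integral>\<^sup>+ z. \<integral>\<^sup>+ w. ?g z w * ennreal (norm h powr (- 2 * ?N)) \<partial>lborel \<partial>lborel)"
      unfolding mult.commute[of _ "ennreal (norm h powr (- 2 * ?N))"]
      by (subst nn_integral_cmult_iterated) (measurable, simp add: mult_ac)
    also have "(\<lambda>z w. ?g z w * ennreal (norm h powr (- 2 * ?N))) = (\<lambda>z w. f (x, h, z, w))"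
      by (auto simp: f_def fun_eq_iff ennreal_mult simp del: inverse_mult_distrib)
    finally show "osc v x (norm h) epowr q * ennreal (norm h powr (- 2 * ?N)) \<le>
       ennreal (4 powr q) * (\<integral>\<^sup>+ z. \<integral>\<^sup>+ w. f (x, h, z, w) \<partial>lborel \<partial>lborel)" .
  qed
  also have "\<dots> = ennreal (4 powr q) * (\<integral>\<^sup>+ x. \<integral>\<^sup>+ h. \<integral>\<^sup>+ z. \<integral>\<^sup>+ w. f (x, h, z, w) \<partial>lborel \<partial>lborel \<partial>lborel \<partial>lborel)"
    by (rule nn_integral_cmult_iterated) measurable
  also have "(\<integral>\<^sup>+ x. \<integral>\<^sup>+ h. \<integral>\<^sup>+ z. \<integral>\<^sup>+ w. f (x, h, z, w) \<partial>lborel \<partial>lborel \<partial>lborel \<partial>lborel) =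
    (\<integral>\<^sup>+ z. \<integral>\<^sup>+ w. \<integral>\<^sup>+ h. \<integral>\<^sup>+ x. f (x, h, z, w) \<partial>lborel \<partial>lborel \<partial>lborel \<partial>lborel)"
    by (rule nn_integral_swap_pairs) measurable
  also have "\<dots> \<le> (\<integral>\<^sup>+ z. \<integral>\<^sup>+ w. ennreal (inverse ?\<omega> * tail_const ?N (3 * ?N) * 2 powr (2 * ?N)) *
    (ennreal (\<bar>v z - v w\<bar> powr q) * ennreal (norm (z - w) powr (- 2 * ?N))) \<partial>lborel \<partial>lborel)"
  proof (intro nn_integral_mono)
    fix z w :: 'a
    let ?D = "\<bar>v z - v w\<bar> powr q"
    show "(\<integral>\<^sup>+ h. \<integral>\<^sup>+ x. f (x, h, z, w) \<partial>lborel \<partial>lborel) \<le> ennreal (inverse ?\<omega> * tail_const ?N (3 * ?N) * 2 powr (2 * ?N)) *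
      (ennreal ?D * ennreal (norm (z - w) powr (- 2 * ?N)))"
    proof (cases "z = w")
      case True
      then have "f (x, h, z, w) = 0" for x h using q by (simp add: f_def)
      then show ?thesis by simp
    next
      case False
      let ?\<rho> = "norm (z - w) / 2"
      have \<rho>: "0 < ?\<rho>" using False by simp
      have "(\<integral>\<^sup>+ x. f (x, h, z, w) \<partial>lborel) \<le> ennreal (inverse ?\<omega> * ?D) * (indicator {h. ?\<rho> \<le> norm h} h * ennreal (norm h powr (- (3 * ?N))))" for h
      proof (cases "?\<rho> \<le> norm h")
        case True
        then have h: "0 < norm h" using \<rho> by linarith
        let ?e = "(inverse (?\<omega> * norm h ^ DIM('a)))\<^sup>2 * ?D * norm h powr (- 2 * ?N)"
        have "(\<integral>\<^sup>+ x. f (x, h, z, w) \<partial>lborel) \<le> (\<integral>\<^sup>+ x. ennreal ?e * indicator (ball z (norm h)) x \<partial>lborel)"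
          by (intro nn_integral_mono) (auto simp: f_def indicator_def dist_commute simp del: inverse_mult_distrib)
        also have "\<dots> = ennreal ?e * ennreal (?\<omega> * norm h ^ DIM('a))"
          using emeasure_ball[of "norm h" z] by (simp add: nn_integral_cmult_indicator)
        also have "\<dots> = ennreal (?e * (?\<omega> * norm h ^ DIM('a)))"
          by (subst ennreal_mult[symmetric]) auto
        also have "?e * (?\<omega> * norm h ^ DIM('a)) = inverse ?\<omega> * ?D * norm h powr (- (3 * ?N))"
        proof -
          have "?\<omega> \<noteq> 0" using unit_ball_vol_pos[of ?N] by linarith
          then have "(inverse (?\<omega> * norm h ^ DIM('a)))\<^sup>2 * (?\<omega> * norm h ^ DIM('a)) = inverse ?\<omega> * norm h powr (- ?N)"
            using h by (simp add: powr_minus powr_realpow field_simps power2_eq_square)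
          moreover have "norm h powr (- (3 * ?N)) = norm h powr (- ?N) * norm h powr (- 2 * ?N)"
            by (simp flip: powr_add)
          moreover have "a * D * e * b = i * D * f" if "a * b = i * m" "f = m * e" for a b D e i f m :: real
          proof -
            have "a * D * e * b = (a * b) * (D * e)" by simp
            then show ?thesis using that by simp
          qed
          ultimately show ?thesis by blast
        qed
        finally show ?thesis using True by (simp add: ennreal_mult)
      next
        case F: False
        have "\<not> (dist x z < norm h \<and> dist x w < norm h)" for x
          using dist_triangle3[of z w x] F by (auto simp: dist_norm[symmetric])
        then have "f (x, h, z, w) = 0" for x by (auto simp: f_def)
        then show ?thesis by simp
      qed
      then have "(\<integral>\<^sup>+ h. \<integral>\<^sup>+ x. f (x, h, z, w) \<partial>lborel \<partial>lborel) \<le>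
        (\<integral>\<^sup>+ h. ennreal (inverse ?\<omega> * ?D) * (indicator {h. ?\<rho> \<le> norm h} h * ennreal (norm h powr (- (3 * ?N)))) \<partial>(lborel :: 'a measure))"
        by (intro nn_integral_mono)
      also have "\<dots> = ennreal (inverse ?\<omega> * ?D) * (\<integral>\<^sup>+ h. indicator {h. ?\<rho> \<le> norm h} h * ennreal (norm h powr (- (3 * ?N))) \<partial>(lborel :: 'a measure))"
        by (rule nn_integral_cmult) measurable
      also have "\<dots> \<le> ennreal (inverse ?\<omega> * ?D) * ennreal (tail_const ?N (3 * ?N) * ?\<rho> powr (?N - 3 * ?N))"
        using \<rho> by (intro mult_left_mono nn_integral_norm_powr_tail) auto
      also have "?\<rho> powr (?N - 3 * ?N) = 2 powr (2 * ?N) * norm (z - w) powr (- 2 * ?N)"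
        by (simp add: powr_divide powr_minus field_simps)
      also have "ennreal (inverse ?\<omega> * ?D) * ennreal (tail_const ?N (3 * ?N) * (2 powr (2 * ?N) * norm (z - w) powr (- 2 * ?N))) =
        ennreal (inverse ?\<omega> * tail_const ?N (3 * ?N) * 2 powr (2 * ?N)) * (ennreal ?D * ennreal (norm (z - w) powr (- 2 * ?N)))"
        using tail_const_pos[of ?N "3 * ?N"]
        by (simp add: ennreal_mult mult_ac less_imp_le)
      finally show ?thesis .
    qed
  qed
  also have "\<dots> = ennreal (inverse ?\<omega> * tail_const ?N (3 * ?N) * 2 powr (2 * ?N)) * gag_energy q v"
    unfolding gag_energy_def by (rule nn_integral_cmult_iterated) measurable
  finally have "osc_energy q v \<le> ennreal (4 powr q) *
     (ennreal (inverse ?\<omega> * tail_const ?N (3 * ?N) * 2 powr (2 * ?N)) * gag_energy q v)"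
    by (simp add: mult_left_mono)
  then show ?thesis
    using tail_const_pos[of ?N "3 * ?N"] by (simp add: ennreal_mult mult.assoc)
qed

subsection \<open>Telescoping averages\<close>

text \<open>Measured from the value at the centre itself, so that convergence to \<open>0\<close>
  for small radii says that \<open>x\<close> is a Lebesgue point.\<close>

definition mean_dev :: "('a::euclidean_space \<Rightarrow> real) \<Rightarrow> 'a \<Rightarrow> real \<Rightarrow> ennreal" where
  "mean_dev v x r = ball_avg (\<lambda>z. ennreal \<bar>v x - v z\<bar>) x r"

lemma borel_measurable_mean_dev [measurable (raw)]:
  fixes a :: "'b \<Rightarrow> 'a::euclidean_space"
  assumes [measurable]: "v \<in> borel_measurable borel" "a \<in> borel_measurable M" "r \<in> borel_measurable M"
  shows "(\<lambda>y. mean_dev v (a y) (r y)) \<in> borel_measurable M"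
  unfolding mean_dev_def by measurable

lemma ennreal_abs_triangle: "ennreal \<bar>a - b\<bar> \<le> ennreal \<bar>a - c\<bar> + ennreal \<bar>b - c\<bar>"
  by (simp flip: ennreal_plus)

text \<open>A point \<open>w\<close> of the smaller ball is inserted between \<open>x\<close> and
  \<open>z\<close> and averaged out; replacing the average over the smaller ball by that over the
  larger one costs the ratio \<open>2 ^ N\<close> of the volumes.\<close>

lemma mean_dev_double:
  fixes v :: "'a::euclidean_space \<Rightarrow> real"
  assumes [measurable]: "v \<in> borel_measurable borel" and r: "0 < r"
  shows "mean_dev v x (2 * r) \<le> mean_dev v x r + ennreal (2 ^ DIM('a)) * osc v x (2 * r)"
proof -
  have "mean_dev v x (2 * r) \<le> ball_avg (\<lambda>z. mean_dev v x r + ennreal (2 ^ DIM('a)) * ball_avg (\<lambda>w. ennreal \<bar>v z - v w\<bar>) x (2 * r)) x (2 * r)"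
    unfolding mean_dev_def[of v x "2 * r"]
  proof (rule ball_avg_mono)
    fix z
    have "ennreal \<bar>v x - v z\<bar> = ball_avg (\<lambda>w. ennreal \<bar>v x - v z\<bar>) x r"
      by (rule ball_avg_const[OF r, symmetric])
    also have "\<dots> \<le> ball_avg (\<lambda>w. ennreal \<bar>v x - v w\<bar> + ennreal \<bar>v z - v w\<bar>) x r"
      by (intro ball_avg_mono ennreal_abs_triangle)
    also have "\<dots> = mean_dev v x r + ball_avg (\<lambda>w. ennreal \<bar>v z - v w\<bar>) x r"
      unfolding mean_dev_def by (rule ball_avg_add) measurable
    also have "ball_avg (\<lambda>w. ennreal \<bar>v z - v w\<bar>) x r \<le> ennreal ((2 * r / r) ^ DIM('a)) * ball_avg (\<lambda>w. ennreal \<bar>v z - v w\<bar>) x (2 * r)"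
      using r by (intro ball_avg_subset) auto
    finally show "ennreal \<bar>v x - v z\<bar> \<le> mean_dev v x r + ennreal (2 ^ DIM('a)) * ball_avg (\<lambda>w. ennreal \<bar>v z - v w\<bar>) x (2 * r)"
      using r by (simp add: add_left_mono)
  qed
  also have "\<dots> = mean_dev v x r + ennreal (2 ^ DIM('a)) * osc v x (2 * r)"
    using r unfolding osc_def by (simp add: ball_avg_add ball_avg_cmult ball_avg_const)
  finally show ?thesis .
qed

lemma mean_dev_telescope:
  fixes v :: "'a::euclidean_space \<Rightarrow> real"
  assumes v: "v \<in> borel_measurable borel" and r: "0 < r"
  shows "mean_dev v x r \<le> mean_dev v x (r / 2 ^ K) + ennreal (2 ^ DIM('a)) * (\<Sum>k<K. osc v x (r / 2 ^ k))"
proof (induction K)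
  case (Suc K)
  have "2 * (r / 2 ^ Suc K) = r / 2 ^ K" by simp
  then have "mean_dev v x (r / 2 ^ K) \<le> mean_dev v x (r / 2 ^ Suc K) + ennreal (2 ^ DIM('a)) * osc v x (r / 2 ^ K)"
    using mean_dev_double[OF v, of "r / 2 ^ Suc K" x] r by simp
  then have "mean_dev v x r \<le> mean_dev v x (r / 2 ^ Suc K) + ennreal (2 ^ DIM('a)) * osc v x (r / 2 ^ K)
    + ennreal (2 ^ DIM('a)) * (\<Sum>k<K. osc v x (r / 2 ^ k))"
    using Suc by (meson add_right_mono order_trans)
  then show ?case by (simp add: distrib_left add_ac)
qed simp

text \<open>The path from \<open>x\<close> to \<open>y\<close> goes through a point of the ball
  about \<open>x\<close> and a point of the ball about \<open>y\<close>, both averaged out. Both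
  balls lie in the ball of radius \<open>2 * d\<close> about \<open>x\<close>, and the two
  enlargements cost \<open>2 ^ N\<close> each.\<close>

lemma abs_diff_le_mean_dev:
  fixes v :: "'a::euclidean_space \<Rightarrow> real"
  assumes [measurable]: "v \<in> borel_measurable borel" and d: "0 < d" "d = norm (x - y)"
  shows "ennreal \<bar>v x - v y\<bar> \<le> mean_dev v x d + mean_dev v y d + ennreal (4 ^ DIM('a)) * osc v x (2 * d)"
proof -
  have sub: "ball y d \<subseteq> ball x (2 * d)" "ball x d \<subseteq> ball x (2 * d)"
  proof -
    show "ball y d \<subseteq> ball x (2 * d)"
    proof
      fix z assume "z \<in> ball y d"
      then show "z \<in> ball x (2 * d)"
        using dist_triangle[of x z y] d by (auto simp: dist_norm)
    qed
    show "ball x d \<subseteq> ball x (2 * d)" using d(1) by (intro subset_ball) auto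
  qed
  have four: "ennreal (4 ^ DIM('a)) = ennreal (2 ^ DIM('a)) * ennreal (2 ^ DIM('a))"
    by (simp flip: ennreal_mult power_mult_distrib)
  have "ennreal \<bar>v x - v y\<bar> \<le> mean_dev v y d + (ennreal \<bar>v x - v z\<bar> + ennreal (2 ^ DIM('a)) * ball_avg (\<lambda>w. ennreal \<bar>v z - v w\<bar>) x (2 * d))" for z
  proof -
    have "ennreal \<bar>v x - v y\<bar> = ball_avg (\<lambda>w. ennreal \<bar>v x - v y\<bar>) y d"
      by (rule ball_avg_const[OF d(1), symmetric])
    also have "\<dots> \<le> ball_avg (\<lambda>w. ennreal \<bar>v y - v w\<bar> + (ennreal \<bar>v x - v z\<bar> + ennreal \<bar>v z - v w\<bar>)) y d"
      by (intro ball_avg_mono) (simp flip: ennreal_plus)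
    also have "\<dots> = mean_dev v y d + (ennreal \<bar>v x - v z\<bar> + ball_avg (\<lambda>w. ennreal \<bar>v z - v w\<bar>) y d)"
      using d(1) by (simp add: mean_dev_def ball_avg_add ball_avg_const)
    also have "ball_avg (\<lambda>w. ennreal \<bar>v z - v w\<bar>) y d \<le> ennreal ((2 * d / d) ^ DIM('a)) * ball_avg (\<lambda>w. ennreal \<bar>v z - v w\<bar>) x (2 * d)"
      by (intro ball_avg_subset sub d)
    finally show ?thesis using d(1) by (simp add: add_left_mono)
  qed
  then have "ball_avg (\<lambda>z. ennreal \<bar>v x - v y\<bar>) x d \<le>
    ball_avg (\<lambda>z. mean_dev v y d + (ennreal \<bar>v x - v z\<bar> + ennreal (2 ^ DIM('a)) * ball_avg (\<lambda>w. ennreal \<bar>v z - v w\<bar>) x (2 * d))) x d"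
    by (intro ball_avg_mono)
  then have "ennreal \<bar>v x - v y\<bar> \<le> mean_dev v y d + (mean_dev v x d + ennreal (2 ^ DIM('a)) * ball_avg (\<lambda>z. ball_avg (\<lambda>w. ennreal \<bar>v z - v w\<bar>) x (2 * d)) x d)"
    using d(1) by (simp add: mean_dev_def ball_avg_add ball_avg_const ball_avg_cmult)
  also have "ball_avg (\<lambda>z. ball_avg (\<lambda>w. ennreal \<bar>v z - v w\<bar>) x (2 * d)) x d \<le> ennreal ((2 * d / d) ^ DIM('a)) * osc v x (2 * d)"
    unfolding osc_def by (intro ball_avg_subset sub d)
  finally show ?thesis
    using d(1) by (simp add: four mult.assoc add_ac add_left_mono mult_left_mono)
qed

text \<open>Inside the ball of radius \<open>\<delta>\<close> the weight is at least
  \<open>\<delta> powr (- 3N/2)\<close>. Against the normalisation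
  \<open>\<delta> powr (- N)\<close> this leaves \<open>\<delta> powr (N/2)\<close> as a bound for
  the \<open>p\<close>-th power, up to a constant, and hence decay to \<open>0\<close>.\<close>

lemma mean_dev_tendsto_0:
  fixes v :: "'a::euclidean_space \<Rightarrow> real"
  assumes [measurable]: "v \<in> borel_measurable borel" and p: "1 \<le> p"
    and fin: "(\<integral>\<^sup>+ h. indicator (ball 0 1) h * (ennreal (\<bar>v x - v (x + h)\<bar> powr p) *
      ennreal (norm h powr (- (3 / 2 * real DIM('a))))) \<partial>lborel) < top"
    and r: "0 < r"
  shows "(\<lambda>K. mean_dev v x (r / 2 ^ K)) \<longlonglongrightarrow> 0"
proof -
  let ?N = "real DIM('a)" and ?\<omega> = "unit_ball_vol (real DIM('a))"
  define I where "I = (\<integral>\<^sup>+ h. indicator (ball 0 1) h * (ennreal (\<bar>v x - v (x + h)\<bar> powr p) *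
      ennreal (norm h powr (- (3 / 2 * ?N)))) \<partial>lborel)"
  obtain G where G: "I = ennreal G" "0 \<le> G"
    using fin unfolding I_def[symmetric] by (cases I) auto
  define c where "c = (2 powr p * inverse ?\<omega> * G) powr (1 / p)"
  have bound: "mean_dev v x \<delta> \<le> ennreal (c * \<delta> powr (?N / (2 * p)))" if \<delta>: "0 < \<delta>" "\<delta> \<le> 1" for \<delta>
  proof -
    have "ball_avg (\<lambda>z. ennreal \<bar>v x - v z\<bar> epowr p) x \<delta> =
      ennreal (inverse (?\<omega> * \<delta> ^ DIM('a))) * (\<integral>\<^sup>+ h. indicator (ball x \<delta>) (x + h) * ennreal (\<bar>v x - v (x + h)\<bar> powr p) \<partial>lborel)"
      unfolding ball_avg_def by (subst nn_integral_lborel_shift) (auto simp: epowr_ennreal)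
    also have "(\<integral>\<^sup>+ h. indicator (ball x \<delta>) (x + h) * ennreal (\<bar>v x - v (x + h)\<bar> powr p) \<partial>lborel) \<le>
      (\<integral>\<^sup>+ h. ennreal (\<delta> powr (3 / 2 * ?N)) * (indicator (ball 0 1) h * (ennreal (\<bar>v x - v (x + h)\<bar> powr p) *
      ennreal (norm h powr (- (3 / 2 * ?N))))) \<partial>lborel)"
    proof (rule nn_integral_mono)
      fix h :: 'a
      show "indicator (ball x \<delta>) (x + h) * ennreal (\<bar>v x - v (x + h)\<bar> powr p) \<le> ennreal (\<delta> powr (3 / 2 * ?N)) * (indicator (ball 0 1) h * (ennreal (\<bar>v x - v (x + h)\<bar> powr p) *
      ennreal (norm h powr (- (3 / 2 * ?N)))))"
      proof (cases "norm h < \<delta> \<and> h \<noteq> 0")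
        case True
        then have "norm h powr (3 / 2 * ?N) \<le> \<delta> powr (3 / 2 * ?N)"
          by (intro powr_mono2) auto
        then have "1 \<le> \<delta> powr (3 / 2 * ?N) * norm h powr (- (3 / 2 * ?N))"
          using True by (simp add: powr_minus field_simps)
        then have "1 * \<bar>v x - v (x + h)\<bar> powr p \<le> \<delta> powr (3 / 2 * ?N) * norm h powr (- (3 / 2 * ?N)) * \<bar>v x - v (x + h)\<bar> powr p"
          by (rule mult_right_mono) simp
        then have "ennreal (\<bar>v x - v (x + h)\<bar> powr p) \<le> ennreal (\<delta> powr (3 / 2 * ?N) * norm h powr (- (3 / 2 * ?N)) * \<bar>v x - v (x + h)\<bar> powr p)"
          by (intro ennreal_leI) simp
        then show ?thesis using True \<delta> by (simp add: ennreal_mult mult_ac indicator_def)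
      qed (use p in \<open>auto simp: indicator_def dist_norm\<close>)
    qed
    also have "\<dots> = ennreal (\<delta> powr (3 / 2 * ?N)) * ennreal G"
      unfolding G(1)[symmetric] I_def by (rule nn_integral_cmult) measurable
    finally have "ball_avg (\<lambda>z. ennreal \<bar>v x - v z\<bar> epowr p) x \<delta> \<le>
      ennreal (inverse (?\<omega> * \<delta> ^ DIM('a))) * (ennreal (\<delta> powr (3 / 2 * ?N)) * ennreal G)"
      by (simp add: mult_left_mono)
    then have "mean_dev v x \<delta> epowr p \<le> ennreal (2 powr p) * (ennreal (inverse (?\<omega> * \<delta> ^ DIM('a))) * (ennreal (\<delta> powr (3 / 2 * ?N)) * ennreal G))"
      unfolding mean_dev_def by (intro order_trans[OF ball_avg_jensen mult_left_mono]) (use p in auto)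
    also have "\<dots> = ennreal (2 powr p * (inverse (?\<omega> * \<delta> ^ DIM('a)) * (\<delta> powr (3 / 2 * ?N) * G)))"
      using \<delta> G by (simp add: ennreal_mult)
    also have "2 powr p * (inverse (?\<omega> * \<delta> ^ DIM('a)) * (\<delta> powr (3 / 2 * ?N) * G)) = 2 powr p * inverse ?\<omega> * G * \<delta> powr (?N / 2)"
    proof -
      have "\<delta> powr (3 / 2 * ?N) = \<delta> ^ DIM('a) * \<delta> powr (?N / 2)"
        using \<delta> by (simp add: powr_realpow[symmetric] flip: powr_add)
      then show ?thesis using \<delta> by simp
    qed
    finally have "(mean_dev v x \<delta> epowr p) epowr (1 / p) \<le> ennreal (2 powr p * inverse ?\<omega> * G * \<delta> powr (?N / 2)) epowr (1 / p)"
      using p by (intro epowr_mono) auto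
    also have "\<dots> = ennreal (c * \<delta> powr (?N / (2 * p)))"
      unfolding c_def using G \<delta> p
      by (subst epowr_ennreal) (auto simp: powr_mult powr_powr)
    finally show ?thesis using p by (simp add: epowr_cancel)
  qed
  have lim: "(\<lambda>K. r / 2 ^ K) \<longlonglongrightarrow> 0"
    using tendsto_mult[OF tendsto_const[of r] LIMSEQ_power_zero[of "1 / 2 :: real"]]
    by (simp add: power_divide)
  show ?thesis
  proof (rule tendsto_sandwich[of "\<lambda>_. 0"])
    have "eventually (\<lambda>K. r / 2 ^ K < 1) sequentially"
      using order_tendstoD(2)[OF lim, of 1] by simp
    then show "eventually (\<lambda>K. mean_dev v x (r / 2 ^ K) \<le> ennreal (c * (r / 2 ^ K) powr (?N / (2 * p)))) sequentially"
      by eventually_elim (rule bound, use r in auto)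
    have "(\<lambda>K. (r / 2 ^ K) powr (?N / (2 * p))) \<longlonglongrightarrow> 0"
      using r p by (intro tendsto_zero_powrI[OF lim tendsto_const]) auto
    then have "(\<lambda>K. c * (r / 2 ^ K) powr (?N / (2 * p))) \<longlonglongrightarrow> c * 0"
      by (intro tendsto_mult tendsto_const)
    then show "(\<lambda>K. ennreal (c * (r / 2 ^ K) powr (?N / (2 * p)))) \<longlonglongrightarrow> 0"
      using tendsto_ennrealI by fastforce
  qed auto
qed

lemma mean_dev_le_suminf_osc:
  fixes v :: "'a::euclidean_space \<Rightarrow> real"
  assumes v: "v \<in> borel_measurable borel" and r: "0 < r"
    and lim: "(\<lambda>K. mean_dev v x (r / 2 ^ K)) \<longlonglongrightarrow> 0"
  shows "mean_dev v x r \<le> ennreal (2 ^ DIM('a)) * (\<Sum>k. osc v x (r / 2 ^ k))"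
proof -
  let ?S = "ennreal (2 ^ DIM('a)) * (\<Sum>k. osc v x (r / 2 ^ k))"
  have "mean_dev v x r \<le> mean_dev v x (r / 2 ^ K) + ?S" for K
    by (rule order_trans[OF mean_dev_telescope[OF v r, of x K]])
       (intro add_left_mono mult_left_mono sum_le_suminf, auto)
  moreover have "(\<lambda>K. mean_dev v x (r / 2 ^ K) + ?S) \<longlonglongrightarrow> 0 + ?S"
    by (intro tendsto_add lim tendsto_const)
  ultimately show ?thesis
    by (intro LIMSEQ_le_const[of _ ?S]) auto
qed

text \<open>The Jacobian \<open>c powr (- N)\<close> and the weight's factor
  \<open>c powr (2N)\<close> combine to \<open>c ^ N\<close>. For \<open>c = 1 / 2 ^ k\<close> this
  is the decay that makes the dyadic sums converge; \<open>c = 2\<close> absorbs the doubled radius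
  in the pointwise estimate.\<close>

lemma nn_integral_radial_scale:
  fixes \<phi> :: "real \<Rightarrow> ennreal"
  assumes [measurable]: "\<phi> \<in> borel_measurable borel" and c: "0 < c"
  shows "(\<integral>\<^sup>+ h. \<phi> (c * norm (h::'a::euclidean_space)) * ennreal (norm h powr (- 2 * real DIM('a))) \<partial>lborel) =
    ennreal (c ^ DIM('a)) * (\<integral>\<^sup>+ h. \<phi> (norm (h::'a)) * ennreal (norm h powr (- 2 * real DIM('a))) \<partial>lborel)"
proof -
  let ?N = "real DIM('a)"
  have "(\<integral>\<^sup>+ h. \<phi> (c * norm (h::'a)) * ennreal (norm h powr (- 2 * ?N)) \<partial>lborel) =
    (\<integral>\<^sup>+ h. ennreal (c powr (2 * ?N)) * (\<phi> (norm (0 + c *\<^sub>R h :: 'a)) * ennreal (norm (0 + c *\<^sub>R h) powr (- 2 * ?N))) \<partial>lborel)"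
  proof (rule nn_integral_cong)
    fix h :: 'a
    have "norm h powr (- 2 * ?N) = c powr (2 * ?N) * norm (c *\<^sub>R h) powr (- 2 * ?N)"
      using c by (simp add: powr_mult powr_minus)
    then show "\<phi> (c * norm h) * ennreal (norm h powr (- 2 * ?N)) =
      ennreal (c powr (2 * ?N)) * (\<phi> (norm (0 + c *\<^sub>R h)) * ennreal (norm (0 + c *\<^sub>R h) powr (- 2 * ?N)))"
      using c by (simp add: ennreal_mult mult_ac)
  qed
  also have "\<dots> = ennreal (c powr (2 * ?N)) * (ennreal (\<bar>1 / c\<bar> ^ DIM('a)) *
    (\<integral>\<^sup>+ h. \<phi> (norm (h::'a)) * ennreal (norm h powr (- 2 * ?N)) \<partial>lborel))"
    using c by (subst nn_integral_cmult) (measurable, subst nn_integral_lborel_affine, auto)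
  also have "\<dots> = ennreal (c ^ DIM('a)) * (\<integral>\<^sup>+ h. \<phi> (norm (h::'a)) * ennreal (norm h powr (- 2 * ?N)) \<partial>lborel)"
  proof -
    have "c powr (2 * ?N) * \<bar>1 / c\<bar> ^ DIM('a) = c ^ DIM('a)"
      using c by (simp add: powr_realpow[symmetric] field_simps flip: powr_add)
    then show ?thesis using c by (simp add: mult.assoc[symmetric] flip: ennreal_mult)
  qed
  finally show ?thesis .
qed

text \<open>The surplus power \<open>q - p\<close> of the oscillation is bounded uniformly; this is
  where \<open>p \<le> q\<close> enters.\<close>

lemma osc_energy_interpolation:
  fixes v :: "'a::euclidean_space \<Rightarrow> real"
  assumes [measurable]: "v \<in> borel_measurable borel" and A: "\<And>x r. osc v x r \<le> A" and pq: "p \<le> q"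
  shows "osc_energy q v \<le> A epowr (q - p) * osc_energy p v"
proof -
  have "osc_energy q v \<le> (\<integral>\<^sup>+ x. \<integral>\<^sup>+ h. A epowr (q - p) * (osc v x (norm (h::'a)) epowr p *
     ennreal (norm h powr (- 2 * real DIM('a)))) \<partial>lborel \<partial>lborel)"
    unfolding osc_energy_def
  proof (intro nn_integral_mono)
    fix x h :: 'a
    have "osc v x (norm h) epowr q = osc v x (norm h) epowr (q - p) * osc v x (norm h) epowr p"
      by (simp flip: epowr_add)
    also have "\<dots> \<le> A epowr (q - p) * osc v x (norm h) epowr p"
      using pq by (intro mult_right_mono epowr_mono A) auto
    finally show "osc v x (norm h) epowr q * ennreal (norm h powr (- 2 * real DIM('a))) \<le>
      A epowr (q - p) * (osc v x (norm h) epowr p * ennreal (norm h powr (- 2 * real DIM('a))))"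
      by (simp add: mult_right_mono flip: mult.assoc)
  qed
  also have "\<dots> = A epowr (q - p) * osc_energy p v"
    unfolding osc_energy_def by (rule nn_integral_cmult_iterated) measurable
  finally show ?thesis .
qed

subsection \<open>Embeddings of fractional energies\<close>

lemma mean_dev_energy_le_osc_energy:
  assumes q: "1 \<le> q"
  shows "\<exists>C\<ge>0. \<forall>v :: 'a::euclidean_space \<Rightarrow> real. v \<in> borel_measurable borel \<longrightarrow>
    (AE x in lborel. \<forall>r>0. (\<lambda>K. mean_dev v x (r / 2 ^ K)) \<longlonglongrightarrow> 0) \<longrightarrow>
    (\<integral>\<^sup>+ x. \<integral>\<^sup>+ h. mean_dev v x (norm (h::'a)) epowr q * ennreal (norm h powr (- 2 * real DIM('a))) \<partial>lborel \<partial>lborel)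
      \<le> ennreal C * osc_energy q v"
proof -
  let ?N = "real DIM('a)"
  \<comment> \<open>Here \<open>\<epsilon> = N/2\<close> in \<open>epowr_suminf_le\<close>: the loss
    \<open>2 powr (N k / 2)\<close> stays below the gain \<open>2 powr (- N k)\<close> from
    rescaling, and \<open>t\<close> is the ratio of the resulting geometric series.\<close>
  define c1 where "c1 = (1 / (1 - 2 powr (- (?N / 2) / q))) powr q"
  define t where "t = (2::real) powr (- (?N / 2))"
  define c2 where "c2 = 1 / (1 - t)"
  have t: "0 < t" "t < 1" by (auto simp: t_def powr_less_one)
  have c: "0 \<le> c1" "0 \<le> c2" using t by (auto simp: c1_def c2_def)
  define C where "C = (2 ^ DIM('a)) powr q * c1 * c2"
  have "(\<integral>\<^sup>+ x. \<integral>\<^sup>+ h. mean_dev v x (norm (h::'a)) epowr q * ennreal (norm h powr (- 2 * ?N)) \<partial>lborel \<partial>lborel)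
      \<le> ennreal C * osc_energy q v"
    if v [measurable]: "v \<in> borel_measurable borel"
      and lim: "AE x in lborel. \<forall>r>0. (\<lambda>K. mean_dev v x (r / 2 ^ K)) \<longlonglongrightarrow> 0" for v :: "'a \<Rightarrow> real"
  proof -
    have "(\<integral>\<^sup>+ h. mean_dev v x (norm (h::'a)) epowr q * ennreal (norm h powr (- 2 * ?N)) \<partial>lborel) \<le>
      ennreal C * (\<integral>\<^sup>+ h. osc v x (norm (h::'a)) epowr q * ennreal (norm h powr (- 2 * ?N)) \<partial>lborel)"
      if l: "\<forall>r>0. (\<lambda>K. mean_dev v x (r / 2 ^ K)) \<longlonglongrightarrow> 0" for x
    proof -
      let ?w = "\<lambda>h::'a. ennreal (norm h powr (- 2 * ?N))"
      let ?E = "\<integral>\<^sup>+ h. osc v x (norm (h::'a)) epowr q * ?w h \<partial>lborel"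
      let ?b = "ennreal ((2 ^ DIM('a)) powr q * c1)"
      have "(\<integral>\<^sup>+ h. mean_dev v x (norm (h::'a)) epowr q * ?w h \<partial>lborel) \<le>
        (\<integral>\<^sup>+ h. ?b * (\<Sum>k. ennreal (2 powr (?N / 2 * real k)) * (osc v x (1 / 2 ^ k * norm (h::'a)) epowr q * ?w h)) \<partial>lborel)"
      proof (rule nn_integral_mono)
        fix h :: 'a
        show "mean_dev v x (norm h) epowr q * ?w h \<le>
          ?b * (\<Sum>k. ennreal (2 powr (?N / 2 * real k)) * (osc v x (1 / 2 ^ k * norm h) epowr q * ?w h))"
        proof (cases "h = 0")
          case False
          then have "mean_dev v x (norm h) \<le> ennreal (2 ^ DIM('a)) * (\<Sum>k. osc v x (norm h / 2 ^ k))"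
            using l by (intro mean_dev_le_suminf_osc v) auto
          then have "mean_dev v x (norm h) epowr q \<le> (ennreal (2 ^ DIM('a)) * (\<Sum>k. osc v x (norm h / 2 ^ k))) epowr q"
            using q by (intro epowr_mono) auto
          also have "\<dots> = ennreal ((2 ^ DIM('a)) powr q) * (\<Sum>k. osc v x (norm h / 2 ^ k)) epowr q"
            by (simp add: epowr_mult epowr_ennreal)
          also have "\<dots> \<le> ennreal ((2 ^ DIM('a)) powr q) * (ennreal c1 * (\<Sum>k. ennreal (2 powr (?N / 2 * real k)) * osc v x (norm h / 2 ^ k) epowr q))"
            unfolding c1_def using q by (intro mult_left_mono epowr_suminf_le) auto
          also have "\<dots> = ?b * (\<Sum>k. ennreal (2 powr (?N / 2 * real k)) * osc v x (norm h / 2 ^ k) epowr q)"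
            using c by (simp add: ennreal_mult mult.assoc)
          finally have "mean_dev v x (norm h) epowr q * ?w h \<le> ?b * (\<Sum>k. ennreal (2 powr (?N / 2 * real k)) * osc v x (norm h / 2 ^ k) epowr q) * ?w h"
            by (rule mult_right_mono) simp
          then show ?thesis
            by (simp add: mult.assoc flip: ennreal_suminf_multc)
        qed simp
      qed
      also have "\<dots> = ?b * (\<Sum>k. ennreal (2 powr (?N / 2 * real k)) * (\<integral>\<^sup>+ h. osc v x (1 / 2 ^ k * norm (h::'a)) epowr q * ?w h \<partial>lborel))"
        by (simp add: nn_integral_cmult nn_integral_suminf del: times_divide_eq_left)
      also have "\<dots> = ?b * (\<Sum>k. ennreal (t ^ k) * ?E)"
      proof -
        have "ennreal (2 powr (?N / 2 * real k)) * (\<integral>\<^sup>+ h. osc v x (1 / 2 ^ k * norm (h::'a)) epowr q * ?w h \<partial>lborel) =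
          ennreal (t ^ k) * ?E" for k
        proof -
          have "(\<integral>\<^sup>+ h. osc v x (1 / 2 ^ k * norm (h::'a)) epowr q * ?w h \<partial>lborel) = ennreal ((1 / 2 ^ k) ^ DIM('a)) * ?E"
            by (rule nn_integral_radial_scale) auto
          moreover have "2 powr (?N / 2 * real k) * (1 / 2 ^ k) ^ DIM('a) = t ^ k"
          proof -
            have "(1 / 2 ^ k) ^ DIM('a) = (2::real) powr (- (real k * ?N))"
              by (simp add: power_one_over powr_minus_divide powr_realpow flip: power_mult of_nat_mult)
            moreover have "t ^ k = 2 powr (- (?N / 2) * real k)"
              unfolding t_def by (simp add: powr_realpow[symmetric] powr_powr)
            ultimately show ?thesis
              by (simp only: powr_add[symmetric]) (simp add: field_simps)
          qed
          ultimately show ?thesis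
            by (simp add: mult.assoc[symmetric] flip: ennreal_mult)
        qed
        then show ?thesis by simp
      qed
      also have "\<dots> = ?b * (ennreal c2 * ?E)"
        using t suminf_geometric[of t]
        by (simp add: suminf_ennreal2 summable_geometric c2_def)
      also have "\<dots> = ennreal C * ?E"
        using c by (simp add: C_def ennreal_mult mult.assoc)
      finally show ?thesis .
    qed
    then have "(\<integral>\<^sup>+ x. \<integral>\<^sup>+ h. mean_dev v x (norm (h::'a)) epowr q * ennreal (norm h powr (- 2 * ?N)) \<partial>lborel \<partial>lborel) \<le>
      (\<integral>\<^sup>+ x. ennreal C * (\<integral>\<^sup>+ h. osc v x (norm (h::'a)) epowr q * ennreal (norm h powr (- 2 * ?N)) \<partial>lborel) \<partial>lborel)"
      using lim by (intro nn_integral_mono_AE) auto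
    also have "\<dots> = ennreal C * osc_energy q v"
      unfolding osc_energy_def by (rule nn_integral_cmult) measurable
    finally show ?thesis .
  qed
  moreover have "0 \<le> C" using c by (simp add: C_def)
  ultimately show ?thesis by blast
qed

lemma nn_integral_norm_diff:
  assumes [measurable]: "\<phi> \<in> borel_measurable borel"
  shows "(\<integral>\<^sup>+ w. \<phi> (norm (z - w :: 'a)) \<partial>lborel) = (\<integral>\<^sup>+ h. \<phi> (norm (h::'a::euclidean_space)) \<partial>lborel)"
  using nn_integral_lborel_shift[of "\<lambda>w. \<phi> (norm (z - w))" z] by simp

text \<open>The Lebesgue point property stays a hypothesis, because the fractional and the gradient
  case supply it in different ways. The constant is fixed before the function.\<close>

theorem gag_energy_le_osc_energy:
  assumes q: "1 \<le> q"
  shows "\<exists>C\<ge>0. \<forall>v :: 'a::euclidean_space \<Rightarrow> real. v \<in> borel_measurable borel \<longrightarrow>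
    (AE x in lborel. \<forall>r>0. (\<lambda>K. mean_dev v x (r / 2 ^ K)) \<longlonglongrightarrow> 0) \<longrightarrow>
    gag_energy q v \<le> ennreal C * osc_energy q v"
proof -
  let ?N = "real DIM('a)"
  obtain C where C: "0 \<le> C" and main: "\<And>v :: 'a \<Rightarrow> real. v \<in> borel_measurable borel \<Longrightarrow>
    AE x in lborel. \<forall>r>0. (\<lambda>K. mean_dev v x (r / 2 ^ K)) \<longlonglongrightarrow> 0 \<Longrightarrow>
    (\<integral>\<^sup>+ x. \<integral>\<^sup>+ h. mean_dev v x (norm (h::'a)) epowr q * ennreal (norm h powr (- 2 * ?N)) \<partial>lborel \<partial>lborel)
      \<le> ennreal C * osc_energy q v"
    using mean_dev_energy_le_osc_energy[OF q, where 'a='a] by blast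
  define C' where "C' = 4 powr q * (C + C + (4 ^ DIM('a)) powr q * 2 ^ DIM('a))"
  have "gag_energy q v \<le> ennreal C' * osc_energy q v"
    if v [measurable]: "v \<in> borel_measurable borel"
      and lim: "AE x in lborel. \<forall>r>0. (\<lambda>K. mean_dev v x (r / 2 ^ K)) \<longlonglongrightarrow> 0" for v :: "'a \<Rightarrow> real"
  proof -
    let ?w = "\<lambda>h::'a. ennreal (norm h powr (- 2 * ?N))"
    let ?e = "ennreal ((4 ^ DIM('a)) powr q)"
    let ?A = "\<lambda>z w. mean_dev v z (norm (z - w)) epowr q * ?w (z - w)"
    let ?B = "\<lambda>z w. mean_dev v w (norm (z - w)) epowr q * ?w (z - w)"
    let ?O = "\<lambda>z w. osc v z (2 * norm (z - w)) epowr q * ?w (z - w)"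
    have "gag_energy q v \<le> (\<integral>\<^sup>+ z. \<integral>\<^sup>+ w. ennreal (4 powr q) * (?A z w + ?B z w + ?e * ?O z w) \<partial>lborel \<partial>lborel)"
      unfolding gag_energy_def
    proof (intro nn_integral_mono)
      fix z w :: 'a
      show "ennreal (\<bar>v z - v w\<bar> powr q) * ?w (z - w) \<le> ennreal (4 powr q) * (?A z w + ?B z w + ?e * ?O z w)"
      proof (cases "z = w")
        case False
        have "ennreal (\<bar>v z - v w\<bar> powr q) = ennreal \<bar>v z - v w\<bar> epowr q"
          by (simp add: epowr_ennreal)
        also have "\<dots> \<le> (mean_dev v z (norm (z - w)) + mean_dev v w (norm (z - w)) + ennreal (4 ^ DIM('a)) * osc v z (2 * norm (z - w))) epowr q"
          using False q by (intro epowr_mono abs_diff_le_mean_dev) auto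
        also have "\<dots> \<le> ennreal (4 powr q) * (mean_dev v z (norm (z - w)) epowr q + mean_dev v w (norm (z - w)) epowr q
          + (ennreal (4 ^ DIM('a)) * osc v z (2 * norm (z - w))) epowr q)"
          using q by (intro epowr_sum3_le) simp
        finally have "ennreal (\<bar>v z - v w\<bar> powr q) * ?w (z - w) \<le> ennreal (4 powr q) * (mean_dev v z (norm (z - w)) epowr q + mean_dev v w (norm (z - w)) epowr q
          + (ennreal (4 ^ DIM('a)) * osc v z (2 * norm (z - w))) epowr q) * ?w (z - w)"
          by (rule mult_right_mono) simp
        then show ?thesis by (simp add: epowr_mult epowr_ennreal distrib_right mult.assoc)
      qed (use q in simp)
    qed
    also have "\<dots> = ennreal (4 powr q) * ((\<integral>\<^sup>+ z. \<integral>\<^sup>+ w. ?A z w \<partial>lborel \<partial>lborel) + (\<integral>\<^sup>+ z. \<integral>\<^sup>+ w. ?B z w \<partial>lborel \<partial>lborel) +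
      ?e * (\<integral>\<^sup>+ z. \<integral>\<^sup>+ w. ?O z w \<partial>lborel \<partial>lborel))"
      by (simp add: nn_integral_cmult nn_integral_add)
    also have "(\<integral>\<^sup>+ z. \<integral>\<^sup>+ w. ?B z w \<partial>lborel \<partial>lborel) = (\<integral>\<^sup>+ z. \<integral>\<^sup>+ w. ?A z w \<partial>lborel \<partial>lborel)"
      by (subst lborel_pair.Fubini') (measurable, simp add: norm_minus_commute)
    also have "(\<integral>\<^sup>+ z. \<integral>\<^sup>+ w. ?A z w \<partial>lborel \<partial>lborel) =
      (\<integral>\<^sup>+ x. \<integral>\<^sup>+ h. mean_dev v x (norm (h::'a)) epowr q * ?w h \<partial>lborel \<partial>lborel)"
      by (intro nn_integral_cong nn_integral_norm_diff) measurable
    also have "(\<integral>\<^sup>+ z. \<integral>\<^sup>+ w. ?O z w \<partial>lborel \<partial>lborel) =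
      (\<integral>\<^sup>+ x. \<integral>\<^sup>+ h. osc v x (2 * norm (h::'a)) epowr q * ?w h \<partial>lborel \<partial>lborel)"
      by (intro nn_integral_cong nn_integral_norm_diff) measurable
    also have "\<dots> = (\<integral>\<^sup>+ x. ennreal (2 ^ DIM('a)) * (\<integral>\<^sup>+ h. osc v x (norm (h::'a)) epowr q * ?w h \<partial>lborel) \<partial>lborel)"
      by (intro nn_integral_cong nn_integral_radial_scale) auto
    also have "\<dots> = ennreal (2 ^ DIM('a)) * osc_energy q v"
      unfolding osc_energy_def by (rule nn_integral_cmult) measurable
    also have "ennreal (4 powr q) * ((\<integral>\<^sup>+ x. \<integral>\<^sup>+ h. mean_dev v x (norm (h::'a)) epowr q * ?w h \<partial>lborel \<partial>lborel) +
       (\<integral>\<^sup>+ x. \<integral>\<^sup>+ h. mean_dev v x (norm (h::'a)) epowr q * ?w h \<partial>lborel \<partial>lborel) + ?e * (ennreal (2 ^ DIM('a)) * osc_energy q v)) \<le>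
       ennreal (4 powr q) * (ennreal C * osc_energy q v + ennreal C * osc_energy q v + ?e * (ennreal (2 ^ DIM('a)) * osc_energy q v))"
      by (intro mult_left_mono add_mono main v lim) auto
    also have "\<dots> = ennreal C' * osc_energy q v"
    proof -
      have "ennreal C' = ennreal (4 powr q) * (ennreal C + ennreal C + ?e * ennreal (2 ^ DIM('a)))"
        unfolding C'_def using C
        by (simp only: ennreal_mult ennreal_plus add_nonneg_nonneg mult_nonneg_nonneg powr_ge_zero zero_le_power zero_le_numeral)
      then show ?thesis
        by (simp only: distrib_left distrib_right mult.assoc)
    qed
    finally show ?thesis .
  qed
  moreover have "0 \<le> C'" using C by (simp add: C'_def)
  ultimately show ?thesis by blast
qed

lemma AE_mean_dev_tendsto_0:
  fixes v :: "'a::euclidean_space \<Rightarrow> real"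
  assumes v: "v \<in> borel_measurable borel" and p: "1 \<le> p"
    and fin: "AE x in lborel. (\<integral>\<^sup>+ h. indicator (ball 0 1) h * (ennreal (\<bar>v x - v (x + h)\<bar> powr p) *
      ennreal (norm h powr (- (3 / 2 * real DIM('a))))) \<partial>lborel) < top"
  shows "AE x in lborel. \<forall>r>0. (\<lambda>K. mean_dev v x (r / 2 ^ K)) \<longlonglongrightarrow> 0"
  using fin by eventually_elim (use mean_dev_tendsto_0[OF v p] in blast)

text \<open>A finite energy has finite inner integrals almost everywhere, and for
  \<open>norm h < 1\<close> the weight \<open>norm h powr (- 3N/2)\<close> is dominated by
  \<open>norm h powr (- 2N)\<close>.\<close>

lemma AE_mean_dev_tendsto_0_gag:
  fixes v :: "'a::euclidean_space \<Rightarrow> real"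
  assumes v [measurable]: "v \<in> borel_measurable borel" and p: "1 \<le> p" and fin: "gag_energy p v < top"
  shows "AE x in lborel. \<forall>r>0. (\<lambda>K. mean_dev v x (r / 2 ^ K)) \<longlonglongrightarrow> 0"
proof (rule AE_mean_dev_tendsto_0[OF v p])
  let ?N = "real DIM('a)"
  have "AE x in lborel. (\<integral>\<^sup>+ h. ennreal (\<bar>v x - v (x + h)\<bar> powr p) * ennreal (norm h powr (- 2 * ?N)) \<partial>lborel) \<noteq> \<infinity>"
    using fin unfolding gag_energy_shift[OF v] by (intro nn_integral_PInf_AE) auto
  then show "AE x in lborel. (\<integral>\<^sup>+ h. indicator (ball 0 1) h * (ennreal (\<bar>v x - v (x + h)\<bar> powr p) *
      ennreal (norm h powr (- (3 / 2 * ?N)))) \<partial>lborel) < top"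
  proof eventually_elim
    case (elim x)
    have "(\<integral>\<^sup>+ h. indicator (ball 0 1) h * (ennreal (\<bar>v x - v (x + h)\<bar> powr p) *
      ennreal (norm h powr (- (3 / 2 * ?N)))) \<partial>lborel) \<le>
      (\<integral>\<^sup>+ h. ennreal (\<bar>v x - v (x + h)\<bar> powr p) * ennreal (norm h powr (- 2 * ?N)) \<partial>lborel)"
    proof (rule nn_integral_mono)
      fix h :: 'a
      show "indicator (ball 0 1) h * (ennreal (\<bar>v x - v (x + h)\<bar> powr p) * ennreal (norm h powr (- (3 / 2 * ?N)))) \<le>
        ennreal (\<bar>v x - v (x + h)\<bar> powr p) * ennreal (norm h powr (- 2 * ?N))"
        by (cases "h = 0") (auto simp: indicator_def intro!: mult_left_mono ennreal_leI powr_mono')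
    qed
    then show ?case using elim by (auto simp: less_top top_unique)
  qed
qed

theorem gag_energy_embedding:
  assumes p: "1 \<le> p" and pq: "p \<le> q"
  shows "\<exists>C\<ge>0. \<forall>v :: 'a::euclidean_space \<Rightarrow> real. v \<in> borel_measurable borel \<longrightarrow>
    gag_energy p v < top \<longrightarrow> gag_energy q v \<le> ennreal C * gag_energy p v epowr (q / p)"
proof -
  obtain C where C: "0 \<le> C" and main: "\<And>v :: 'a \<Rightarrow> real. v \<in> borel_measurable borel \<Longrightarrow>
    AE x in lborel. \<forall>r>0. (\<lambda>K. mean_dev v x (r / 2 ^ K)) \<longlonglongrightarrow> 0 \<Longrightarrow>
    gag_energy q v \<le> ennreal C * osc_energy q v"
    using gag_energy_le_osc_energy[of q, where 'a='a] p pq by auto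
  define c1 where "c1 = 4 powr p * (inverse (unit_ball_vol (real DIM('a))))\<^sup>2 * 2 powr (2 * real DIM('a))"
  define c2 where "c2 = 4 powr p * (inverse (unit_ball_vol (real DIM('a))) *
    tail_const (real DIM('a)) (3 * real DIM('a)) * 2 powr (2 * real DIM('a)))"
  have c: "0 \<le> c1" "0 \<le> c2"
    using tail_const_pos[of "real DIM('a)" "3 * real DIM('a)"] by (auto simp: c1_def c2_def)
  have "gag_energy q v \<le> ennreal (C * (c1 powr ((q - p) / p) * c2)) * gag_energy p v epowr (q / p)"
    if v: "v \<in> borel_measurable borel" and fin: "gag_energy p v < top" for v :: "'a \<Rightarrow> real"
  proof -
    let ?G = "gag_energy p v"
    \<comment> \<open>This uniform bound supplies the power \<open>(q - p) / p\<close> of the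
      energy; the oscillation energy with exponent \<open>p\<close> supplies one more, in total
      \<open>q / p\<close>.\<close>
    have osc: "osc v x r \<le> (ennreal c1 * ?G) epowr (1 / p)" for x r
    proof -
      have "(osc v x r epowr p) epowr (1 / p) \<le> (ennreal c1 * ?G) epowr (1 / p)"
        unfolding c1_def using p by (intro epowr_mono osc_le_gag_energy v) auto
      then show ?thesis using p by (simp add: epowr_cancel)
    qed
    have "gag_energy q v \<le> ennreal C * osc_energy q v"
      by (intro main v AE_mean_dev_tendsto_0_gag[OF v p fin])
    also have "\<dots> \<le> ennreal C * (((ennreal c1 * ?G) epowr (1 / p)) epowr (q - p) * (ennreal c2 * ?G))"
      unfolding c2_def
      by (intro mult_left_mono order_trans[OF osc_energy_interpolation[OF v osc pq]] osc_energy_le_gag_energy v p) auto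
    also have "\<dots> = ennreal (C * (c1 powr ((q - p) / p) * c2)) * (?G epowr ((q - p) / p) * ?G)"
      using C c by (simp add: epowr_epowr epowr_mult epowr_ennreal ennreal_mult powr_powr mult_ac)
    also have "?G epowr ((q - p) / p) * ?G = ?G epowr (q / p)"
      using epowr_add[of ?G "(q - p) / p" 1] p by (simp add: field_simps)
    finally show ?thesis .
  qed
  moreover have "0 \<le> C * (c1 powr ((q - p) / p) * c2)" using C c by simp
  ultimately show ?thesis by blast
qed

section \<open>From \<open>p\<close>-th to \<open>q\<close>-th powers of the function itself\<close>

lemma nn_integral_ball_avg:
  fixes f :: "'a::euclidean_space \<Rightarrow> ennreal"
  assumes [measurable]: "f \<in> borel_measurable borel" and r: "0 < r"
  shows "(\<integral>\<^sup>+ x. ball_avg f x r \<partial>lborel) = (\<integral>\<^sup>+ x. f x \<partial>lborel)"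
proof -
  let ?c = "ennreal (inverse (unit_ball_vol (real DIM('a)) * r ^ DIM('a)))"
  have "ball_avg f x r = (\<integral>\<^sup>+ h. ?c * (indicator (ball 0 r) h * f (x + h)) \<partial>lborel)" for x
  proof -
    have "ball_avg f x r = ?c * (\<integral>\<^sup>+ h. indicator (ball x r) (x + h) * f (x + h) \<partial>lborel)"
      unfolding ball_avg_def by (subst nn_integral_lborel_shift) auto
    also have "(\<lambda>h. indicator (ball x r) (x + h) :: ennreal) = indicator (ball 0 r)"
      by (auto simp: indicator_def dist_norm)
    finally show ?thesis by (simp add: nn_integral_cmult)
  qed
  then have "(\<integral>\<^sup>+ x. ball_avg f x r \<partial>lborel) = (\<integral>\<^sup>+ x. \<integral>\<^sup>+ h. ?c * (indicator (ball 0 r) h * f (x + h)) \<partial>lborel \<partial>lborel)"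
    by simp
  also have "\<dots> = (\<integral>\<^sup>+ h. \<integral>\<^sup>+ x. ?c * (indicator (ball 0 r) h * f (x + h)) \<partial>lborel \<partial>lborel)"
    by (rule lborel_pair.Fubini'[symmetric]) measurable
  also have "\<dots> = (\<integral>\<^sup>+ h. ?c * (indicator (ball 0 r) (h::'a) * (\<integral>\<^sup>+ x. f x \<partial>lborel)) \<partial>lborel)"
  proof (rule nn_integral_cong)
    fix h :: 'a
    have "(\<integral>\<^sup>+ x. f (x + h) \<partial>lborel) = (\<integral>\<^sup>+ x. f x \<partial>lborel)"
      using nn_integral_lborel_shift[of f h] by (simp add: add.commute)
    then show "(\<integral>\<^sup>+ x. ?c * (indicator (ball 0 r) h * f (x + h)) \<partial>lborel) = ?c * (indicator (ball 0 r) h * (\<integral>\<^sup>+ x. f x \<partial>lborel))"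
      by (simp add: nn_integral_cmult)
  qed
  also have "\<dots> = ball_avg (\<lambda>_. (\<integral>\<^sup>+ x. f x \<partial>lborel)) (0::'a) r"
    unfolding ball_avg_def by (simp add: nn_integral_cmult)
  also have "\<dots> = (\<integral>\<^sup>+ x. f x \<partial>lborel)" by (rule ball_avg_const[OF r])
  finally show ?thesis .
qed

lemma ball_avg_le_nn_integral:
  "ball_avg f (x::'a::euclidean_space) r \<le> ennreal (inverse (unit_ball_vol (real DIM('a)) * r ^ DIM('a))) * (\<integral>\<^sup>+ z. f z \<partial>lborel)"
  unfolding ball_avg_def by (intro mult_left_mono nn_integral_mono) (auto simp: indicator_def)

text \<open>The value \<open>\<bar>v x\<bar>\<close> is at most the mean deviation at radius
  \<open>1\<close> plus the mean of \<open>\<bar>v\<bar>\<close> over the unit ball. At distances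
  below \<open>1\<close> the Gagliardo weight is at least \<open>1\<close>, so the energy controls
  the first part. The second is bounded pointwise by the \<open>p\<close>-th power integral, and its
  own \<open>p\<close>-th power is integrable with the same bound, so interpolation gives its
  \<open>q\<close>-th power.\<close>

theorem nn_integral_powr_embedding:
  assumes p: "1 \<le> p" and pq: "p \<le> q"
  shows "\<exists>C\<ge>0. \<forall>v :: 'a::euclidean_space \<Rightarrow> real. v \<in> borel_measurable borel \<longrightarrow>
    (\<integral>\<^sup>+ x. ennreal (\<bar>v x\<bar> powr q) \<partial>lborel) \<le>
      ennreal C * (gag_energy q v + (\<integral>\<^sup>+ x. ennreal (\<bar>v x\<bar> powr p) \<partial>lborel) epowr (q / p))"
proof -
  let ?i = "inverse (unit_ball_vol (real DIM('a)))"
  define c where "c = 2 powr p * ?i"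
  have c: "0 \<le> c" by (simp add: c_def)
  define C where "C = 2 powr q * max (2 powr q * ?i) (c powr ((q - p) / p) * 2 powr p)"
  have "(\<integral>\<^sup>+ x. ennreal (\<bar>v x\<bar> powr q) \<partial>lborel) \<le>
      ennreal C * (gag_energy q v + (\<integral>\<^sup>+ x. ennreal (\<bar>v x\<bar> powr p) \<partial>lborel) epowr (q / p))"
    if v [measurable]: "v \<in> borel_measurable borel" for v :: "'a \<Rightarrow> real"
  proof -
    define P where "P = (\<integral>\<^sup>+ x. ennreal (\<bar>v x\<bar> powr p) \<partial>lborel)"
    let ?a = "\<lambda>x. ball_avg (\<lambda>z. ennreal \<bar>v z\<bar>) x 1"
    have jp: "?a x epowr p \<le> ennreal (2 powr p) * ball_avg (\<lambda>z. ennreal (\<bar>v z\<bar> powr p)) x 1" for x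
      using ball_avg_jensen[of "\<lambda>z. ennreal \<bar>v z\<bar>" p x 1] p by (simp add: epowr_ennreal)
    have avg_q: "?a x epowr q \<le> (ennreal c * P) epowr ((q - p) / p) * (ennreal (2 powr p) * ball_avg (\<lambda>z. ennreal (\<bar>v z\<bar> powr p)) x 1)" for x
    proof -
      have "?a x epowr p \<le> ennreal (2 powr p) * (ennreal ?i * P)"
        using ball_avg_le_nn_integral[of "\<lambda>z. ennreal (\<bar>v z\<bar> powr p)" x 1] unfolding P_def
        by (intro order_trans[OF jp] mult_left_mono) auto
      then have 1: "?a x epowr p \<le> ennreal c * P"
        by (simp add: c_def ennreal_mult mult.assoc)
      have "?a x epowr q = (?a x epowr p) epowr ((q - p) / p) * ?a x epowr p"
        using p by (simp add: epowr_epowr flip: epowr_add)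
      also have "\<dots> \<le> (ennreal c * P) epowr ((q - p) / p) * (ennreal (2 powr p) * ball_avg (\<lambda>z. ennreal (\<bar>v z\<bar> powr p)) x 1)"
        using p pq by (intro mult_mono epowr_mono 1 jp) auto
      finally show ?thesis .
    qed
    have dev_q: "mean_dev v x 1 epowr q \<le> ennreal (2 powr q * ?i) *
      (\<integral>\<^sup>+ w. ennreal (\<bar>v x - v w\<bar> powr q) * ennreal (norm (x - w) powr (- 2 * real DIM('a))) \<partial>lborel)" for x
    proof -
      have "mean_dev v x 1 epowr q \<le> ennreal (2 powr q) * ball_avg (\<lambda>z. ennreal (\<bar>v x - v z\<bar> powr q)) x 1"
        using ball_avg_jensen[of "\<lambda>z. ennreal \<bar>v x - v z\<bar>" q x 1] p pq by (simp add: epowr_ennreal mean_dev_def)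
      also have "ball_avg (\<lambda>z. ennreal (\<bar>v x - v z\<bar> powr q)) x 1 \<le>
        ball_avg (\<lambda>w. ennreal (\<bar>v x - v w\<bar> powr q) * ennreal (norm (x - w) powr (- 2 * real DIM('a)))) x 1"
      proof (rule ball_avg_mono)
        fix z assume z: "z \<in> ball x 1"
        show "ennreal (\<bar>v x - v z\<bar> powr q) \<le> ennreal (\<bar>v x - v z\<bar> powr q) * ennreal (norm (x - z) powr (- 2 * real DIM('a)))"
        proof (cases "x = z")
          case False
          then have "1 \<le> norm (x - z) powr (- 2 * real DIM('a))"
            using z powr_mono2'[of "- 2 * real DIM('a)" "norm (x - z)" 1] by (simp add: dist_norm)
          then have "ennreal (\<bar>v x - v z\<bar> powr q) * 1 \<le> ennreal (\<bar>v x - v z\<bar> powr q) * ennreal (norm (x - z) powr (- 2 * real DIM('a)))"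
            by (intro mult_left_mono) auto
          then show ?thesis by simp
        qed simp
      qed
      also have "\<dots> \<le> ennreal ?i * (\<integral>\<^sup>+ w. ennreal (\<bar>v x - v w\<bar> powr q) * ennreal (norm (x - w) powr (- 2 * real DIM('a))) \<partial>lborel)"
        using ball_avg_le_nn_integral[of _ x 1] by simp
      finally show ?thesis by (simp add: ennreal_mult mult.assoc mult_left_mono)
    qed
    have "(\<integral>\<^sup>+ x. ennreal (\<bar>v x\<bar> powr q) \<partial>lborel) \<le> (\<integral>\<^sup>+ x. ennreal (2 powr q) * (mean_dev v x 1 epowr q + ?a x epowr q) \<partial>lborel)"
    proof (rule nn_integral_mono)
      fix x :: 'a
      have "ennreal \<bar>v x\<bar> = ball_avg (\<lambda>z. ennreal \<bar>v x\<bar>) x 1"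
        by (rule ball_avg_const[symmetric]) simp
      also have "\<dots> \<le> ball_avg (\<lambda>z. ennreal \<bar>v x - v z\<bar> + ennreal \<bar>v z\<bar>) x 1"
        by (intro ball_avg_mono) (simp flip: ennreal_plus)
      also have "\<dots> = mean_dev v x 1 + ?a x"
        unfolding mean_dev_def by (rule ball_avg_add) measurable
      finally have "ennreal \<bar>v x\<bar> epowr q \<le> (mean_dev v x 1 + ?a x) epowr q"
        using p pq by (intro epowr_mono) auto
      also have "\<dots> \<le> ennreal (2 powr q) * (mean_dev v x 1 epowr q + ?a x epowr q)"
        using p pq by (intro epowr_sum_le) auto
      finally show "ennreal (\<bar>v x\<bar> powr q) \<le> ennreal (2 powr q) * (mean_dev v x 1 epowr q + ?a x epowr q)"
        by (simp add: epowr_ennreal)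
    qed
    also have "\<dots> = ennreal (2 powr q) * ((\<integral>\<^sup>+ x. mean_dev v x 1 epowr q \<partial>lborel) + (\<integral>\<^sup>+ x. ?a x epowr q \<partial>lborel))"
      by (simp add: nn_integral_cmult nn_integral_add)
    also have "(\<integral>\<^sup>+ x. mean_dev v x 1 epowr q \<partial>lborel) \<le> ennreal (2 powr q * ?i) * gag_energy q v"
    proof -
      have "(\<integral>\<^sup>+ x. mean_dev v x 1 epowr q \<partial>lborel) \<le> (\<integral>\<^sup>+ x. ennreal (2 powr q * ?i) *
        (\<integral>\<^sup>+ w. ennreal (\<bar>v x - v w\<bar> powr q) * ennreal (norm (x - w) powr (- 2 * real DIM('a))) \<partial>lborel) \<partial>lborel)"
        by (intro nn_integral_mono dev_q)
      also have "\<dots> = ennreal (2 powr q * ?i) * gag_energy q v"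
        unfolding gag_energy_def by (rule nn_integral_cmult) measurable
      finally show ?thesis .
    qed
    also have "(\<integral>\<^sup>+ x. ?a x epowr q \<partial>lborel) \<le> ennreal (c powr ((q - p) / p) * 2 powr p) * P epowr (q / p)"
    proof -
      have "(\<integral>\<^sup>+ x. ?a x epowr q \<partial>lborel) \<le> (\<integral>\<^sup>+ x. (ennreal c * P) epowr ((q - p) / p) * (ennreal (2 powr p) * ball_avg (\<lambda>z. ennreal (\<bar>v z\<bar> powr p)) x 1) \<partial>lborel)"
        by (intro nn_integral_mono avg_q)
      also have "\<dots> = (ennreal c * P) epowr ((q - p) / p) * (ennreal (2 powr p) * (\<integral>\<^sup>+ x. ball_avg (\<lambda>z. ennreal (\<bar>v z\<bar> powr p)) x 1 \<partial>lborel))"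
        by (simp add: nn_integral_cmult)
      also have "(\<integral>\<^sup>+ x. ball_avg (\<lambda>z. ennreal (\<bar>v z\<bar> powr p)) x 1 \<partial>lborel) = P"
        unfolding P_def by (rule nn_integral_ball_avg) auto
      also have "(ennreal c * P) epowr ((q - p) / p) * (ennreal (2 powr p) * P) =
        ennreal (c powr ((q - p) / p) * 2 powr p) * (P epowr ((q - p) / p) * P)"
        using c by (simp add: epowr_mult epowr_ennreal ennreal_mult mult_ac)
      also have "P epowr ((q - p) / p) * P = P epowr (q / p)"
        using epowr_add[of P "(q - p) / p" 1] p by (simp add: field_simps)
      finally show ?thesis .
    qed
    also have "ennreal (2 powr q) * (ennreal (2 powr q * ?i) * gag_energy q v + ennreal (c powr ((q - p) / p) * 2 powr p) * P epowr (q / p)) \<le>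
      ennreal (2 powr q) * (ennreal (max (2 powr q * ?i) (c powr ((q - p) / p) * 2 powr p)) * (gag_energy q v + P epowr (q / p)))"
      unfolding distrib_left by (intro mult_left_mono add_mono mult_right_mono ennreal_leI) auto
    also have "\<dots> = ennreal C * (gag_energy q v + P epowr (q / p))"
      unfolding C_def by (simp add: ennreal_mult mult.assoc le_max_iff_disj)
    finally show ?thesis by (simp add: P_def add_left_mono mult_left_mono)
  qed
  moreover have "0 \<le> C" by (simp add: C_def le_max_iff_disj)
  ultimately show ?thesis by blast
qed

subsection \<open>The gradient energy controls the mean oscillation\<close>

text \<open>An upper gradient in almost-everywhere form, the only property of a weak gradient that
  the estimates use. The null set may depend on \<open>h\<close>; this suffices because
  \<open>z\<close> is always integrated out with \<open>h\<close> fixed.\<close>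

definition gradient_bound :: "('a::euclidean_space \<Rightarrow> real) \<Rightarrow> ('a \<Rightarrow> real) \<Rightarrow> bool" where
  "gradient_bound v g \<longleftrightarrow> v \<in> borel_measurable borel \<and> g \<in> borel_measurable borel \<and> (\<forall>x. 0 \<le> g x) \<and>
    (\<forall>h. AE z in lborel. ennreal \<bar>v z - v (z + h)\<bar> \<le>
      ennreal (norm h) * (\<integral>\<^sup>+ t. indicator {0..1} t * ennreal (g (z + t *\<^sub>R h)) \<partial>lborel))"

lemma gradient_boundD:
  assumes "gradient_bound v g"
  shows "v \<in> borel_measurable borel" "g \<in> borel_measurable borel" "0 \<le> g x"
    "AE z in lborel. ennreal \<bar>v z - v (z + h)\<bar> \<le>
      ennreal (norm h) * (\<integral>\<^sup>+ t. indicator {0..1} t * ennreal (g (z + t *\<^sub>R h)) \<partial>lborel)"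
  using assms unfolding gradient_bound_def by auto

lemma nn_integral_shift_right:
  fixes f :: "'a::euclidean_space \<Rightarrow> ennreal"
  assumes "f \<in> borel_measurable borel"
  shows "(\<integral>\<^sup>+ x. f (x + t) \<partial>lborel) = (\<integral>\<^sup>+ x. f x \<partial>lborel)"
  using nn_integral_lborel_shift[OF assms, of t] by (simp add: add.commute)

text \<open>A Poincare inequality in mean. For fixed \<open>h\<close> and \<open>t\<close> the
  translation by \<open>t *\<^sub>R h\<close> preserves measure, and by convexity the segment stays
  in the ball, so the integral over \<open>z\<close> is at most that of \<open>g\<close> over the
  ball. Differences \<open>h\<close> of points of the ball fill at most a ball of radius
  \<open>2 * r\<close>, whence \<open>2 * r\<close> times \<open>2 ^ N\<close>.\<close>

lemma osc_le_ball_avg_gradient: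
  fixes v :: "'a::euclidean_space \<Rightarrow> real"
  assumes vg: "gradient_bound v g" and r: "0 < r"
  shows "osc v x r \<le> ennreal (2 ^ (DIM('a) + 1) * r) * ball_avg (\<lambda>z. ennreal (g z)) x r"
proof -
  note [measurable] = gradient_boundD(1,2)[OF vg]
  let ?\<kappa> = "ennreal (inverse (unit_ball_vol (real DIM('a)) * r ^ DIM('a)))"
  let ?B = "indicator (ball x r) :: 'a \<Rightarrow> ennreal"
  let ?g = "\<lambda>z. ennreal (g z)"
  have "(\<integral>\<^sup>+ z. ?B z * ball_avg (\<lambda>w. ennreal \<bar>v z - v w\<bar>) x r \<partial>lborel) =
    (\<integral>\<^sup>+ z. \<integral>\<^sup>+ h. ?\<kappa> * (?B z * (?B (z + h) * ennreal \<bar>v z - v (z + h)\<bar>)) \<partial>lborel \<partial>lborel)"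
  proof (rule nn_integral_cong)
    fix z
    have "?B z * ball_avg (\<lambda>w. ennreal \<bar>v z - v w\<bar>) x r =
      ?B z * (?\<kappa> * (\<integral>\<^sup>+ h. ?B (z + h) * ennreal \<bar>v z - v (z + h)\<bar> \<partial>lborel))"
      unfolding ball_avg_def by (subst nn_integral_lborel_shift) auto
    moreover have "(\<integral>\<^sup>+ h. ?\<kappa> * (?B z * (?B (z + h) * ennreal \<bar>v z - v (z + h)\<bar>)) \<partial>lborel) =
      ?\<kappa> * (?B z * (\<integral>\<^sup>+ h. ?B (z + h) * ennreal \<bar>v z - v (z + h)\<bar> \<partial>lborel))"
      by (simp add: nn_integral_cmult)
    ultimately show "?B z * ball_avg (\<lambda>w. ennreal \<bar>v z - v w\<bar>) x r =
      (\<integral>\<^sup>+ h. ?\<kappa> * (?B z * (?B (z + h) * ennreal \<bar>v z - v (z + h)\<bar>)) \<partial>lborel)"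
      by (simp only: mult.left_commute)
  qed
  also have "\<dots> = (\<integral>\<^sup>+ h. \<integral>\<^sup>+ z. ?\<kappa> * (?B z * (?B (z + h) * ennreal \<bar>v z - v (z + h)\<bar>)) \<partial>lborel \<partial>lborel)"
    by (rule lborel_pair.Fubini'[symmetric]) measurable
  also have "\<dots> \<le> (\<integral>\<^sup>+ h. ?\<kappa> * ennreal (2 * r) * (\<integral>\<^sup>+ y. ?B y * ?g y \<partial>lborel) * indicator (ball 0 (2 * r)) (h :: 'a) \<partial>lborel)"
  proof (rule nn_integral_mono)
    fix h :: 'a
    have "(\<integral>\<^sup>+ z. ?\<kappa> * (?B z * (?B (z + h) * ennreal \<bar>v z - v (z + h)\<bar>)) \<partial>lborel) \<le>
      (\<integral>\<^sup>+ z. \<integral>\<^sup>+ t. ?\<kappa> * ennreal (2 * r) * indicator (ball 0 (2 * r)) h * (indicator {0..1} t * (?B (z + t *\<^sub>R h) * ?g (z + t *\<^sub>R h))) \<partial>lborel \<partial>lborel)"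
      using gradient_boundD(4)[OF vg, of h]
    proof (intro nn_integral_mono_AE, eventually_elim)
      case (elim z)
      show ?case
      proof (cases "z \<in> ball x r \<and> z + h \<in> ball x r")
        case True
        have h: "norm h < 2 * r"
          using True dist_triangle3[of z "z + h" x] by (auto simp: dist_norm)
        have conv: "z + t *\<^sub>R h \<in> ball x r" if "t \<in> {0..1}" for t
        proof -
          have "(1 - t) *\<^sub>R z + t *\<^sub>R (z + h) \<in> ball x r"
            using True that convexD_alt[OF convex_ball[of x r], of z "z + h" t] by auto
          then show ?thesis by (simp add: algebra_simps)
        qed
        have "?\<kappa> * (?B z * (?B (z + h) * ennreal \<bar>v z - v (z + h)\<bar>)) \<le>
          ?\<kappa> * (ennreal (2 * r) * (\<integral>\<^sup>+ t. indicator {0..1} t * ?g (z + t *\<^sub>R h) \<partial>lborel))"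
          using True elim h by (auto intro!: mult_left_mono order_trans[OF elim(2)] mult_right_mono ennreal_leI)
        also have "(\<integral>\<^sup>+ t. indicator {0..1} t * ?g (z + t *\<^sub>R h) \<partial>lborel) =
           (\<integral>\<^sup>+ t. indicator {0..1} t * (?B (z + t *\<^sub>R h) * ?g (z + t *\<^sub>R h)) \<partial>lborel)"
          using conv by (intro nn_integral_cong) (auto simp: indicator_def)
        finally show ?thesis using h
          by (subst nn_integral_cmult) (auto simp: mult.assoc)
      qed auto
    qed
    also have "\<dots> = (\<integral>\<^sup>+ t. \<integral>\<^sup>+ z. ?\<kappa> * ennreal (2 * r) * indicator (ball 0 (2 * r)) h * (indicator {0..1} t * (?B (z + t *\<^sub>R h) * ?g (z + t *\<^sub>R h))) \<partial>lborel \<partial>lborel)"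
      by (rule lborel_pair.Fubini'[symmetric]) measurable
    also have "\<dots> = (\<integral>\<^sup>+ t. ?\<kappa> * ennreal (2 * r) * indicator (ball 0 (2 * r)) h * (\<integral>\<^sup>+ y. ?B y * ?g y \<partial>lborel) * indicator {0..1} (t::real) \<partial>lborel)"
    proof (rule nn_integral_cong)
      fix t :: real
      have "(\<integral>\<^sup>+ z. ?B (z + t *\<^sub>R h) * ?g (z + t *\<^sub>R h) \<partial>lborel) = (\<integral>\<^sup>+ y. ?B y * ?g y \<partial>lborel)"
        by (rule nn_integral_shift_right) measurable
      moreover have "(\<integral>\<^sup>+ z. ?\<kappa> * ennreal (2 * r) * indicator (ball 0 (2 * r)) h * (indicator {0..1} t * (?B (z + t *\<^sub>R h) * ?g (z + t *\<^sub>R h))) \<partial>lborel) =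
        ?\<kappa> * ennreal (2 * r) * indicator (ball 0 (2 * r)) h * (indicator {0..1} t * (\<integral>\<^sup>+ z. ?B (z + t *\<^sub>R h) * ?g (z + t *\<^sub>R h) \<partial>lborel))"
        by (simp add: nn_integral_cmult)
      ultimately show "(\<integral>\<^sup>+ z. ?\<kappa> * ennreal (2 * r) * indicator (ball 0 (2 * r)) h * (indicator {0..1} t * (?B (z + t *\<^sub>R h) * ?g (z + t *\<^sub>R h))) \<partial>lborel) =
        ?\<kappa> * ennreal (2 * r) * indicator (ball 0 (2 * r)) h * (\<integral>\<^sup>+ y. ?B y * ?g y \<partial>lborel) * indicator {0..1} t"
        by (simp only: mult_ac)
    qed
    also have "\<dots> = ?\<kappa> * ennreal (2 * r) * (\<integral>\<^sup>+ y. ?B y * ?g y \<partial>lborel) * indicator (ball 0 (2 * r)) h"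
      by (subst nn_integral_cmult_indicator) (auto simp: mult_ac)
    finally show "(\<integral>\<^sup>+ z. ?\<kappa> * (?B z * (?B (z + h) * ennreal \<bar>v z - v (z + h)\<bar>)) \<partial>lborel) \<le> \<dots>" .
  qed
  also have "\<dots> = ?\<kappa> * ennreal (2 * r) * (\<integral>\<^sup>+ y. ?B y * ?g y \<partial>lborel) * ennreal (unit_ball_vol (real DIM('a)) * (2 * r) ^ DIM('a))"
    using r emeasure_ball[of "2 * r" "0::'a"] by (simp add: nn_integral_cmult_indicator)
  also have "\<dots> = (ennreal (2 * r) * ennreal (unit_ball_vol (real DIM('a)) * (2 * r) ^ DIM('a))) * ball_avg ?g x r"
    unfolding ball_avg_def by (simp add: mult_ac)
  finally have "osc v x r \<le> ?\<kappa> * ((ennreal (2 * r) * ennreal (unit_ball_vol (real DIM('a)) * (2 * r) ^ DIM('a))) * ball_avg ?g x r)"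
    unfolding osc_def by (subst ball_avg_def) (rule mult_left_mono, auto)
  also have "\<dots> = ennreal (inverse (unit_ball_vol (real DIM('a)) * r ^ DIM('a)) * ((2 * r) * (unit_ball_vol (real DIM('a)) * (2 * r) ^ DIM('a)))) * ball_avg ?g x r"
    using r by (simp add: ennreal_mult mult.assoc)
  also have "inverse (unit_ball_vol (real DIM('a)) * r ^ DIM('a)) * ((2 * r) * (unit_ball_vol (real DIM('a)) * (2 * r) ^ DIM('a))) = 2 ^ (DIM('a) + 1) * r"
  proof -
    have "unit_ball_vol (real DIM('a)) \<noteq> 0" using unit_ball_vol_pos[of "real DIM('a)"] by linarith
    then show ?thesis using r by (simp add: field_simps power_mult_distrib)
  qed
  finally show ?thesis .
qed

text \<open>For the exponent \<open>N\<close> the factor \<open>r powr N\<close> from the Poincare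
  inequality cancels the normalisation of the average exactly, so the bound is uniform in the
  radius.\<close>

theorem osc_le_gradient_energy:
  "\<exists>C\<ge>0. \<forall>v g. gradient_bound v g \<longrightarrow> (\<forall>(x::'a::euclidean_space) r. osc v x r epowr real DIM('a) \<le>
    ennreal C * (\<integral>\<^sup>+ x. ennreal (g x powr real DIM('a)) \<partial>lborel))"
proof -
  let ?N = "real DIM('a)"
  let ?i = "inverse (unit_ball_vol ?N)"
  define C where "C = (2 ^ (DIM('a) + 1)) powr ?N * (2 powr ?N * ?i)"
  have "osc v x r epowr ?N \<le> ennreal C * (\<integral>\<^sup>+ x. ennreal (g x powr ?N) \<partial>lborel)"
    if vg: "gradient_bound v g" for v g and x :: 'a and r
  proof (cases "0 < r")
    case r: True
    note [measurable] = gradient_boundD(1,2)[OF vg]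
    note g = gradient_boundD(3)[OF vg]
    have N: "1 \<le> ?N" using DIM_positive[where 'a='a] by linarith
    let ?M = "\<integral>\<^sup>+ x. ennreal (g x powr ?N) \<partial>lborel"
    have "osc v x r epowr ?N \<le> (ennreal (2 ^ (DIM('a) + 1) * r) * ball_avg (\<lambda>z. ennreal (g z)) x r) epowr ?N"
      by (intro epowr_mono osc_le_ball_avg_gradient vg r) simp
    also have "\<dots> = ennreal ((2 ^ (DIM('a) + 1) * r) powr ?N) * ball_avg (\<lambda>z. ennreal (g z)) x r epowr ?N"
      using r by (simp add: epowr_mult epowr_ennreal)
    also have "\<dots> \<le> ennreal ((2 ^ (DIM('a) + 1) * r) powr ?N) * (ennreal (2 powr ?N) * ball_avg (\<lambda>z. ennreal (g z) epowr ?N) x r)"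
      by (intro mult_left_mono ball_avg_jensen N) auto
    also have "\<dots> \<le> ennreal ((2 ^ (DIM('a) + 1) * r) powr ?N) * (ennreal (2 powr ?N) * (ennreal (inverse (unit_ball_vol ?N * r ^ DIM('a))) * (\<integral>\<^sup>+ z. ennreal (g z) epowr ?N \<partial>lborel)))"
      by (intro mult_left_mono ball_avg_le_nn_integral) auto
    also have "\<dots> = ennreal ((2 ^ (DIM('a) + 1) * r) powr ?N * (2 powr ?N * inverse (unit_ball_vol ?N * r ^ DIM('a)))) * ?M"
      using r g by (simp add: ennreal_mult epowr_ennreal mult.assoc)
    also have "(2 ^ (DIM('a) + 1) * r) powr ?N * (2 powr ?N * inverse (unit_ball_vol ?N * r ^ DIM('a))) = C"
      using r by (simp add: C_def powr_mult powr_realpow)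
    finally show ?thesis .
  qed (simp add: osc_def ball_avg_def ball_empty)
  moreover have "0 \<le> C" by (simp add: C_def)
  ultimately show ?thesis by blast
qed

text \<open>Jensen along the segment and translation invariance bound the integral of the
  \<open>N\<close>-th power of \<open>v x - v (x + h)\<close> by a multiple of
  \<open>norm h powr N\<close>. Against the weight \<open>norm h powr (- 3N/2)\<close> this leaves
  \<open>norm h powr (- N/2)\<close>, which is integrable near the origin.\<close>

lemma AE_mean_dev_tendsto_0_gradient:
  fixes v :: "'a::euclidean_space \<Rightarrow> real"
  assumes vg: "gradient_bound v g" and fin: "(\<integral>\<^sup>+ x. ennreal (g x powr real DIM('a)) \<partial>lborel) < top"
  shows "AE x in lborel. \<forall>r>0. (\<lambda>K. mean_dev v x (r / 2 ^ K)) \<longlonglongrightarrow> 0"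
proof -
  let ?N = "real DIM('a)"
  note v [measurable] = gradient_boundD(1)[OF vg]
  note [measurable] = gradient_boundD(2)[OF vg]
  note g = gradient_boundD(3)[OF vg]
  have N: "1 \<le> ?N" using DIM_positive[where 'a='a] by linarith
  let ?M = "\<integral>\<^sup>+ x. ennreal (g x powr ?N) \<partial>lborel"
  have diff: "(\<integral>\<^sup>+ x. ennreal (\<bar>v x - v (x + h)\<bar> powr ?N) \<partial>lborel) \<le> ennreal (norm h powr ?N) * (ennreal (2 powr ?N) * ?M)" for h
  proof -
    have "(\<integral>\<^sup>+ x. ennreal (\<bar>v x - v (x + h)\<bar> powr ?N) \<partial>lborel) \<le>
      (\<integral>\<^sup>+ x. ennreal (norm h powr ?N) * (ennreal (2 powr ?N) * (\<integral>\<^sup>+ t. indicator {0..1} t * ennreal (g (x + t *\<^sub>R h) powr ?N) \<partial>lborel)) \<partial>lborel)"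
      using gradient_boundD(4)[OF vg, of h]
    proof (intro nn_integral_mono_AE, eventually_elim)
      case (elim x)
      have "ennreal (\<bar>v x - v (x + h)\<bar> powr ?N) = ennreal \<bar>v x - v (x + h)\<bar> epowr ?N"
        by (simp add: epowr_ennreal)
      also have "\<dots> \<le> (ennreal (norm h) * (\<integral>\<^sup>+ t. indicator {0..1} t * ennreal (g (x + t *\<^sub>R h)) \<partial>lborel)) epowr ?N"
        by (intro epowr_mono elim) simp
      also have "\<dots> = ennreal (norm h powr ?N) * (\<integral>\<^sup>+ t. indicator {0..1} t * ennreal (g (x + t *\<^sub>R h)) \<partial>lborel) epowr ?N"
        by (simp add: epowr_mult epowr_ennreal)
      also have "\<dots> \<le> ennreal (norm h powr ?N) * (ennreal (2 powr ?N) * (\<integral>\<^sup>+ t. indicator {0..1} t * ennreal (g (x + t *\<^sub>R h)) epowr ?N \<partial>lborel))"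
        by (intro mult_left_mono jensen_epowr N) auto
      finally show ?case using g by (simp add: epowr_ennreal)
    qed
    also have "\<dots> = ennreal (norm h powr ?N) * (ennreal (2 powr ?N) * (\<integral>\<^sup>+ x. \<integral>\<^sup>+ t. indicator {0..1} t * ennreal (g (x + t *\<^sub>R h) powr ?N) \<partial>lborel \<partial>lborel))"
      by (simp add: nn_integral_cmult)
    also have "(\<integral>\<^sup>+ x. \<integral>\<^sup>+ t. indicator {0..1} t * ennreal (g (x + t *\<^sub>R h) powr ?N) \<partial>lborel \<partial>lborel) =
      (\<integral>\<^sup>+ t. \<integral>\<^sup>+ x. indicator {0..1} t * ennreal (g (x + t *\<^sub>R h) powr ?N) \<partial>lborel \<partial>lborel)"
      by (rule lborel_pair.Fubini'[symmetric]) measurable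
    also have "\<dots> = (\<integral>\<^sup>+ t. ?M * indicator {0..1} (t::real) \<partial>lborel)"
    proof (rule nn_integral_cong)
      fix t :: real
      have "(\<integral>\<^sup>+ x. ennreal (g (x + t *\<^sub>R h) powr ?N) \<partial>lborel) = ?M"
        by (rule nn_integral_shift_right) measurable
      then show "(\<integral>\<^sup>+ x. indicator {0..1} t * ennreal (g (x + t *\<^sub>R h) powr ?N) \<partial>lborel) = ?M * indicator {0..1} t"
        by (simp add: nn_integral_cmult mult.commute)
    qed
    also have "\<dots> = ?M" by (simp add: nn_integral_cmult_indicator)
    finally show ?thesis .
  qed
  have "(\<integral>\<^sup>+ x. \<integral>\<^sup>+ h. indicator (ball 0 1) h * (ennreal (\<bar>v x - v (x + h)\<bar> powr ?N) *
      ennreal (norm h powr (- (3 / 2 * ?N)))) \<partial>lborel \<partial>lborel) =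
    (\<integral>\<^sup>+ h. \<integral>\<^sup>+ x. indicator (ball 0 1) h * (ennreal (\<bar>v x - v (x + h)\<bar> powr ?N) *
      ennreal (norm h powr (- (3 / 2 * ?N)))) \<partial>lborel \<partial>lborel)"
    by (rule lborel_pair.Fubini'[symmetric]) measurable
  also have "\<dots> \<le> (\<integral>\<^sup>+ h. ennreal (2 powr ?N) * ?M * (indicator (ball 0 1) (h::'a) * ennreal (norm h powr (- (?N / 2)))) \<partial>lborel)"
  proof (rule nn_integral_mono)
    fix h :: 'a
    have "(\<integral>\<^sup>+ x. indicator (ball 0 1) h * (ennreal (\<bar>v x - v (x + h)\<bar> powr ?N) * ennreal (norm h powr (- (3 / 2 * ?N)))) \<partial>lborel) =
      indicator (ball 0 1) h * ennreal (norm h powr (- (3 / 2 * ?N))) * (\<integral>\<^sup>+ x. ennreal (\<bar>v x - v (x + h)\<bar> powr ?N) \<partial>lborel)"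
      by (subst nn_integral_cmult[symmetric]) (auto simp: mult_ac)
    also have "\<dots> \<le> indicator (ball 0 1) h * ennreal (norm h powr (- (3 / 2 * ?N))) * (ennreal (norm h powr ?N) * (ennreal (2 powr ?N) * ?M))"
      by (intro mult_left_mono diff) simp
    also have "\<dots> = ennreal (2 powr ?N) * ?M * (indicator (ball 0 1) h * (ennreal (norm h powr (- (3 / 2 * ?N))) * ennreal (norm h powr ?N)))"
      by (simp add: mult_ac)
    also have "ennreal (norm h powr (- (3 / 2 * ?N))) * ennreal (norm h powr ?N) = ennreal (norm h powr (- (?N / 2)))"
      by (simp flip: ennreal_mult powr_add)
    finally show "(\<integral>\<^sup>+ x. indicator (ball 0 1) h * (ennreal (\<bar>v x - v (x + h)\<bar> powr ?N) * ennreal (norm h powr (- (3 / 2 * ?N)))) \<partial>lborel) \<le>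
      ennreal (2 powr ?N) * ?M * (indicator (ball 0 1) h * ennreal (norm h powr (- (?N / 2))))" .
  qed
  also have "\<dots> = ennreal (2 powr ?N) * ?M * (\<integral>\<^sup>+ h. indicator (ball 0 1) (h::'a) * ennreal (norm h powr (- (?N / 2))) \<partial>lborel)"
    by (rule nn_integral_cmult) measurable
  also have "\<dots> < top"
    using fin N by (intro ennreal_mult_less_top[THEN iffD2] disjI2 conjI nn_integral_norm_powr_unit_ball) auto
  finally have "AE x in lborel. (\<integral>\<^sup>+ h. indicator (ball 0 1) h * (ennreal (\<bar>v x - v (x + h)\<bar> powr ?N) *
      ennreal (norm h powr (- (3 / 2 * ?N)))) \<partial>lborel) \<noteq> \<infinity>"
    by (intro nn_integral_PInf_AE) auto
  then show ?thesis
    by (intro AE_mean_dev_tendsto_0[OF v N]) (auto simp: less_top)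
qed

section \<open>The layer cake argument at the critical exponent\<close>

lemma nn_integral_powr_from_0:
  fixes a c :: real
  assumes "- 1 < a" "0 \<le> c"
  shows "(\<integral>\<^sup>+ t. indicator {0..c} t * ennreal (t powr a) \<partial>lborel) = ennreal (c powr (a + 1) / (a + 1))"
proof -
  have "(\<integral>\<^sup>+ t. ennreal (indicator {0..c} t * t powr a) \<partial>lborel) = ennreal (c powr (a + 1) / (a + 1))"
    by (rule nn_integral_has_integral_lebesgue[OF _ has_integral_powr_from_0[OF assms]]) auto
  then show ?thesis
    by (simp add: ennreal_mult' ennreal_indicator)
qed

text \<open>It suffices to integrate over \<open>b / 4 < t < b / 2\<close>.\<close>

lemma epowr_le_layer_cake:
  assumes f: "f \<le> ennreal A" and q: "2 \<le> q"
  shows "f epowr q \<le> ennreal (4 powr q) * (\<integral>\<^sup>+ t. indicator {0..A} t * (ennreal (t powr (q - 2)) * (f - ennreal t)) \<partial>lborel)"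
proof -
  obtain b where b: "f = ennreal b" "0 \<le> b"
    using f by (cases f) (auto simp: top_unique)
  show ?thesis
  proof (cases "b = 0")
    case False
    then have b0: "0 < b" using b by simp
    then have A: "b \<le> A" using f b by (metis ennreal_le_iff2 not_le)
    have "ennreal ((b / 4) powr q) = ennreal ((b / 4) powr (q - 2) * (b / 4)) * ennreal (b / 4)"
      using b0 by (simp add: powr_diff power2_eq_square flip: ennreal_mult)
    also have "\<dots> = (\<integral>\<^sup>+ t. ennreal ((b / 4) powr (q - 2) * (b / 4)) * indicator {b / 4..b / 2} t \<partial>lborel)"
      using b0 by (simp add: nn_integral_cmult_indicator)
    also have "\<dots> \<le> (\<integral>\<^sup>+ t. indicator {0..A} t * (ennreal (t powr (q - 2)) * (f - ennreal t)) \<partial>lborel)"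
    proof (rule nn_integral_mono)
      fix t :: real
      show "ennreal ((b / 4) powr (q - 2) * (b / 4)) * indicator {b / 4..b / 2} t \<le> indicator {0..A} t * (ennreal (t powr (q - 2)) * (f - ennreal t))"
      proof (cases "t \<in> {b / 4..b / 2}")
        case True
        then have "(b / 4) powr (q - 2) * (b / 4) \<le> t powr (q - 2) * (b - t)"
          using b0 q by (intro mult_mono powr_mono2) auto
        then have "ennreal ((b / 4) powr (q - 2) * (b / 4)) \<le> ennreal (t powr (q - 2)) * ennreal (b - t)"
          using True by (simp add: ennreal_leI flip: ennreal_mult)
        then show ?thesis using True A b b0 by (simp add: ennreal_minus)
      qed simp
    qed
    finally have "ennreal (4 powr q) * ennreal ((b / 4) powr q) \<le> ennreal (4 powr q) * \<dots>"
      by (rule mult_left_mono) simp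
    then show ?thesis
      using b b0 by (simp add: epowr_ennreal powr_divide flip: ennreal_mult)
  qed (use b in simp)
qed

lemma nn_integral_rotate3:
  fixes f :: "'a::euclidean_space \<times> 'b::euclidean_space \<times> 'c::euclidean_space \<Rightarrow> ennreal"
  assumes [measurable]: "f \<in> borel_measurable borel"
  shows "(\<integral>\<^sup>+ x. \<integral>\<^sup>+ h. \<integral>\<^sup>+ t. f (x, h, t) \<partial>lborel \<partial>lborel \<partial>lborel) =
    (\<integral>\<^sup>+ t. \<integral>\<^sup>+ h. \<integral>\<^sup>+ x. f (x, h, t) \<partial>lborel \<partial>lborel \<partial>lborel)"
proof -
  have "(\<integral>\<^sup>+ x. \<integral>\<^sup>+ h. \<integral>\<^sup>+ t. f (x, h, t) \<partial>lborel \<partial>lborel \<partial>lborel) =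
    (\<integral>\<^sup>+ x. \<integral>\<^sup>+ t. \<integral>\<^sup>+ h. f (x, h, t) \<partial>lborel \<partial>lborel \<partial>lborel)"
    by (intro nn_integral_cong lborel_pair.Fubini'[symmetric]) measurable
  also have "\<dots> = (\<integral>\<^sup>+ t. \<integral>\<^sup>+ x. \<integral>\<^sup>+ h. f (x, h, t) \<partial>lborel \<partial>lborel \<partial>lborel)"
    by (intro lborel_pair.Fubini'[symmetric]) measurable
  also have "\<dots> = (\<integral>\<^sup>+ t. \<integral>\<^sup>+ h. \<integral>\<^sup>+ x. f (x, h, t) \<partial>lborel \<partial>lborel \<partial>lborel)"
    by (intro nn_integral_cong lborel_pair.Fubini'[symmetric]) measurable
  finally show ?thesis .
qed

text \<open>The weak type estimate behind the layer cake.\<close>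

lemma nn_integral_truncated_weight:
  assumes N: "2 \<le> DIM('a::euclidean_space)" and t: "0 < t" and b: "0 \<le> b"
  shows "(\<integral>\<^sup>+ h. ennreal (norm (h::'a) powr (- 2 * real DIM('a))) * ennreal (b * norm h - t) \<partial>lborel) \<le>
    ennreal (tail_const (real DIM('a)) (2 * real DIM('a) - 1) * b powr real DIM('a) * t powr (1 - real DIM('a)))"
proof (cases "b = 0")
  case True
  then show ?thesis using t by (simp add: ennreal_neg)
next
  case False
  let ?N = "real DIM('a)"
  let ?T = "tail_const ?N (2 * ?N - 1)"
  have b0: "0 < b" using False b by simp
  have N': "2 \<le> ?N" using N by simp
  have "(\<integral>\<^sup>+ h. ennreal (norm (h::'a) powr (- 2 * ?N)) * ennreal (b * norm h - t) \<partial>lborel) \<le>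
    (\<integral>\<^sup>+ h. ennreal b * (indicator {h. t / b \<le> norm h} h * ennreal (norm (h::'a) powr (- (2 * ?N - 1)))) \<partial>lborel)"
  proof (rule nn_integral_mono)
    fix h :: 'a
    show "ennreal (norm h powr (- 2 * ?N)) * ennreal (b * norm h - t) \<le>
      ennreal b * (indicator {h. t / b \<le> norm h} h * ennreal (norm h powr (- (2 * ?N - 1))))"
    proof (cases "t / b \<le> norm h")
      case True
      have h: "0 < norm h" using True t b0 by (metis divide_pos_pos less_le_trans)
      have "norm h powr (- 2 * ?N) * (b * norm h - t) \<le> norm h powr (- 2 * ?N) * (b * norm h)"
        using t by (intro mult_left_mono) auto
      also have "\<dots> = b * norm h powr (- (2 * ?N - 1))"
        using h powr_add[of "norm h" "- 2 * ?N" 1] by (simp add: add.commute)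
      finally have "ennreal (norm h powr (- 2 * ?N) * (b * norm h - t)) \<le> ennreal (b * norm h powr (- (2 * ?N - 1)))"
        by (rule ennreal_leI)
      then show ?thesis using True b by (simp add: ennreal_mult ennreal_mult')
    next
      case F: False
      then have "b * norm h - t \<le> 0" using b0 by (simp add: field_simps)
      then show ?thesis by (simp add: ennreal_neg)
    qed
  qed
  also have "\<dots> = ennreal b * (\<integral>\<^sup>+ h. indicator {h. t / b \<le> norm h} h * ennreal (norm (h::'a) powr (- (2 * ?N - 1))) \<partial>lborel)"
    by (rule nn_integral_cmult) measurable
  \<comment> \<open>Convergence of this tail requires \<open>2 N - 1 > N\<close>; here dimension one
    drops out.\<close>
  also have "\<dots> \<le> ennreal b * ennreal (?T * (t / b) powr (?N - (2 * ?N - 1)))"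
    using t b0 N' by (intro mult_left_mono nn_integral_norm_powr_tail) auto
  also have "\<dots> = ennreal (b * (?T * (t / b) powr (?N - (2 * ?N - 1))))"
    using b tail_const_pos[of ?N "2 * ?N - 1"] N' by (simp add: ennreal_mult)
  also have "b * (?T * (t / b) powr (?N - (2 * ?N - 1))) = ?T * b powr ?N * t powr (1 - ?N)"
  proof -
    have "(t / b) powr (1 - ?N) = t powr (1 - ?N) * b powr (?N - 1)"
      using t b0 by (simp add: powr_divide powr_diff field_simps)
    moreover have "b * b powr (?N - 1) = b powr ?N"
      using b0 by (simp add: powr_diff)
    ultimately show ?thesis by (simp add: algebra_simps)
  qed
  finally show ?thesis .
qed

text \<open>At a fixed level \<open>t\<close> the truncated weight yields a multiple of
  \<open>t powr (1 - N)\<close> times the gradient energy \<open>M\<close>. Together with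
  \<open>t powr (q - 2)\<close> this is \<open>t powr (q - N - 1)\<close>, integrable at
  \<open>0\<close> because \<open>q > N\<close>. The levels end at the uniform bound
  \<open>A\<close> of the oscillation, a multiple of the \<open>N\<close>-th root of
  \<open>M\<close>, and \<open>A powr (q - N) * M\<close> is a multiple of
  \<open>M powr (q / N)\<close>.\<close>

theorem osc_energy_le_gradient_energy:
  assumes N: "2 \<le> DIM('a::euclidean_space)" and q: "real DIM('a) < q"
  shows "\<exists>C\<ge>0. \<forall>v (g :: 'a \<Rightarrow> real). gradient_bound v g \<longrightarrow>
    (\<integral>\<^sup>+ x. ennreal (g x powr real DIM('a)) \<partial>lborel) < top \<longrightarrow>
    osc_energy q v \<le> ennreal C * (\<integral>\<^sup>+ x. ennreal (g x powr real DIM('a)) \<partial>lborel) epowr (q / real DIM('a))"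
proof -
  let ?N = "real DIM('a)"
  let ?T = "tail_const ?N (2 * ?N - 1)"
  have N': "2 \<le> ?N" using N by simp
  obtain K where K: "0 \<le> K" and osc: "\<And>v g (x::'a) r. gradient_bound v g \<Longrightarrow>
      osc v x r epowr ?N \<le> ennreal K * (\<integral>\<^sup>+ x. ennreal (g x powr ?N) \<partial>lborel)"
    using osc_le_gradient_energy[where 'a='a] by blast
  define c where "c = (2 :: real) ^ (DIM('a) + 1)"
  have T: "0 \<le> ?T" using tail_const_pos[of ?N "2 * ?N - 1"] N' by simp
  \<comment> \<open>The factor \<open>4 powr q\<close> comes from the layer cake,
    \<open>?T * c powr ?N\<close> from the truncated weight, and the rest from integrating
    \<open>t powr (q - N - 1)\<close> up to \<open>A\<close>.\<close>
  define C where "C = 4 powr q * (?T * c powr ?N * (K powr ((q - ?N) / ?N) / (q - ?N)))"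
  have "osc_energy q v \<le> ennreal C * (\<integral>\<^sup>+ x. ennreal (g x powr ?N) \<partial>lborel) epowr (q / ?N)"
    if vg: "gradient_bound v g" and fin: "(\<integral>\<^sup>+ x. ennreal (g x powr ?N) \<partial>lborel) < top" for v and g :: "'a \<Rightarrow> real"
  proof -
    note v [measurable] = gradient_boundD(1)[OF vg]
    note [measurable] = gradient_boundD(2)[OF vg]
    note g = gradient_boundD(3)[OF vg]
    obtain M where M: "(\<integral>\<^sup>+ x. ennreal (g x powr ?N) \<partial>lborel) = ennreal M" "0 \<le> M"
      using fin by (cases "\<integral>\<^sup>+ x. ennreal (g x powr ?N) \<partial>lborel") auto
    define A where "A = (K * M) powr (1 / ?N)"
    have A: "osc v x r \<le> ennreal A" for x r
    proof -
      have "(osc v x r epowr ?N) epowr (1 / ?N) \<le> (ennreal K * ennreal M) epowr (1 / ?N)"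
        using osc[OF vg, of x r] M by (intro epowr_mono) auto
      also have "\<dots> = ennreal A"
        using K M N' by (simp add: A_def epowr_ennreal flip: ennreal_mult)
      finally show ?thesis using N' by (simp add: epowr_cancel)
    qed
    let ?w = "\<lambda>h::'a. ennreal (norm h powr (- 2 * ?N))"
    define f where "f = (\<lambda>(x::'a, h::'a, t::real). ?w h * (indicator {0..A} t * (ennreal (t powr (q - 2)) *
      ball_avg (\<lambda>z. ennreal (c * g z * norm h - t)) x (norm h))))"
    have [measurable]: "f \<in> borel_measurable borel"
      unfolding f_def borel_prod[symmetric] by measurable
    \<comment> \<open>Since \<open>ennreal\<close> sends negative reals to \<open>0\<close>, the
      averaged function is a positive part. The level may be moved inside because the average of a
      constant is that constant.\<close>
    have layer: "osc v x (norm h) - ennreal t \<le> ball_avg (\<lambda>z. ennreal (c * g z * norm h - t)) x (norm h)"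
      if h: "h \<noteq> 0" for x t and h :: 'a
    proof -
      have "osc v x (norm h) \<le> ennreal (c * norm h) * ball_avg (\<lambda>z. ennreal (g z)) x (norm h)"
        unfolding c_def using h by (intro osc_le_ball_avg_gradient vg) simp
      also have "\<dots> = ball_avg (\<lambda>z. ennreal (c * norm h) * ennreal (g z)) x (norm h)"
        by (rule ball_avg_cmult[symmetric]) measurable
      also have "\<dots> \<le> ball_avg (\<lambda>z. ennreal (c * g z * norm h - t) + ennreal t) x (norm h)"
      proof (rule ball_avg_mono)
        fix z
        have "ennreal (c * norm h) * ennreal (g z) = ennreal (c * g z * norm h)"
          using g by (simp add: c_def mult_ac flip: ennreal_mult)
        also have "\<dots> \<le> ennreal (max 0 (c * g z * norm h - t) + max 0 t)"
          by (intro ennreal_leI) linarith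
        also have "\<dots> = ennreal (c * g z * norm h - t) + ennreal t"
          by (simp add: ennreal_plus max_def ennreal_neg)
        finally show "ennreal (c * norm h) * ennreal (g z) \<le> ennreal (c * g z * norm h - t) + ennreal t" .
      qed
      also have "\<dots> = ball_avg (\<lambda>z. ennreal (c * g z * norm h - t)) x (norm h) + ennreal t"
        using h by (subst ball_avg_add) (auto simp: ball_avg_const)
      finally show ?thesis by (simp add: ennreal_minus_le_iff add.commute)
    qed
    have "osc_energy q v \<le> (\<integral>\<^sup>+ x. \<integral>\<^sup>+ h. ennreal (4 powr q) * (\<integral>\<^sup>+ t. f (x, h, t) \<partial>lborel) \<partial>lborel \<partial>lborel)"
      unfolding osc_energy_def
    proof (intro nn_integral_mono)
      fix x h :: 'a
      show "osc v x (norm h) epowr q * ?w h \<le> ennreal (4 powr q) * (\<integral>\<^sup>+ t. f (x, h, t) \<partial>lborel)"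
      proof (cases "h = 0")
        case False
        have "osc v x (norm h) epowr q * ?w h \<le> ennreal (4 powr q) * (\<integral>\<^sup>+ t. indicator {0..A} t * (ennreal (t powr (q - 2)) * (osc v x (norm h) - ennreal t)) \<partial>lborel) * ?w h"
          using q N' by (intro mult_right_mono epowr_le_layer_cake A) auto
        also have "\<dots> = ennreal (4 powr q) * (\<integral>\<^sup>+ t. ?w h * (indicator {0..A} t * (ennreal (t powr (q - 2)) * (osc v x (norm h) - ennreal t))) \<partial>lborel)"
          by (subst nn_integral_cmult) (measurable, simp only: mult_ac)
        also have "\<dots> \<le> ennreal (4 powr q) * (\<integral>\<^sup>+ t. f (x, h, t) \<partial>lborel)"
          unfolding f_def prod.case by (intro mult_left_mono nn_integral_mono layer False) auto
        finally show ?thesis .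
      qed simp
    qed
    also have "\<dots> = ennreal (4 powr q) * (\<integral>\<^sup>+ x. \<integral>\<^sup>+ h. \<integral>\<^sup>+ t. f (x, h, t) \<partial>lborel \<partial>lborel \<partial>lborel)"
      by (rule nn_integral_cmult_iterated) measurable
    also have "(\<integral>\<^sup>+ x. \<integral>\<^sup>+ h. \<integral>\<^sup>+ t. f (x, h, t) \<partial>lborel \<partial>lborel \<partial>lborel) = (\<integral>\<^sup>+ t. \<integral>\<^sup>+ h. \<integral>\<^sup>+ x. f (x, h, t) \<partial>lborel \<partial>lborel \<partial>lborel)"
      by (rule nn_integral_rotate3) measurable
    also have "\<dots> \<le> (\<integral>\<^sup>+ t. ennreal (?T * c powr ?N * M) * (indicator {0..A} t * ennreal (t powr (q - ?N - 1))) \<partial>lborel)"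
    proof (intro nn_integral_mono)
      fix t :: real
      show "(\<integral>\<^sup>+ h. \<integral>\<^sup>+ x. f (x, h, t) \<partial>lborel \<partial>lborel) \<le> ennreal (?T * c powr ?N * M) * (indicator {0..A} t * ennreal (t powr (q - ?N - 1)))"
      proof (cases "0 < t")
        case t: True
        let ?k = "indicator {0..A} t * ennreal (t powr (q - 2))"
        have "(\<integral>\<^sup>+ h. \<integral>\<^sup>+ x. f (x, h, t) \<partial>lborel \<partial>lborel) = (\<integral>\<^sup>+ h. \<integral>\<^sup>+ z. ?k * (?w h * ennreal (c * g z * norm h - t)) \<partial>lborel \<partial>lborel)"
        proof (rule nn_integral_cong)
          fix h :: 'a
          show "(\<integral>\<^sup>+ x. f (x, h, t) \<partial>lborel) = (\<integral>\<^sup>+ z. ?k * (?w h * ennreal (c * g z * norm h - t)) \<partial>lborel)"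
          proof (cases "h = 0")
            case False
            have "(\<integral>\<^sup>+ x. f (x, h, t) \<partial>lborel) = ?k * (?w h * (\<integral>\<^sup>+ x. ball_avg (\<lambda>z. ennreal (c * g z * norm h - t)) x (norm h) \<partial>lborel))"
              unfolding f_def prod.case by (simp add: nn_integral_cmult mult_ac)
            also have "(\<integral>\<^sup>+ x. ball_avg (\<lambda>z. ennreal (c * g z * norm h - t)) x (norm h) \<partial>lborel) = (\<integral>\<^sup>+ z. ennreal (c * g z * norm h - t) \<partial>lborel)"
              using False by (intro nn_integral_ball_avg) auto
            finally show ?thesis by (simp add: nn_integral_cmult)
          qed (simp add: f_def)
        qed
        also have "\<dots> = ?k * (\<integral>\<^sup>+ h. \<integral>\<^sup>+ z. ?w h * ennreal (c * g z * norm h - t) \<partial>lborel \<partial>lborel)"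
          by (rule nn_integral_cmult_iterated) measurable
        finally have swapped: "(\<integral>\<^sup>+ h. \<integral>\<^sup>+ x. f (x, h, t) \<partial>lborel \<partial>lborel) = ?k * (\<integral>\<^sup>+ h. \<integral>\<^sup>+ z. ?w h * ennreal (c * g z * norm h - t) \<partial>lborel \<partial>lborel)" .
        have "(\<integral>\<^sup>+ h. \<integral>\<^sup>+ z. ?w h * ennreal (c * g z * norm h - t) \<partial>lborel \<partial>lborel) = (\<integral>\<^sup>+ z. \<integral>\<^sup>+ h. ?w h * ennreal (c * g z * norm h - t) \<partial>lborel \<partial>lborel)"
          by (rule lborel_pair.Fubini'[symmetric]) measurable
        also have "\<dots> \<le> (\<integral>\<^sup>+ z. ennreal (?T * c powr ?N * t powr (1 - ?N)) * ennreal (g z powr ?N) \<partial>lborel)"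
        proof (rule nn_integral_mono)
          fix z
          have "(\<integral>\<^sup>+ h. ?w h * ennreal (c * g z * norm h - t) \<partial>lborel) \<le> ennreal (?T * (c * g z) powr ?N * t powr (1 - ?N))"
            using g by (intro nn_integral_truncated_weight N t) (auto simp: c_def)
          also have "\<dots> = ennreal (?T * c powr ?N * t powr (1 - ?N)) * ennreal (g z powr ?N)"
            using g T by (subst ennreal_mult[symmetric]) (auto simp: c_def powr_mult mult_ac)
          finally show "(\<integral>\<^sup>+ h. ?w h * ennreal (c * g z * norm h - t) \<partial>lborel) \<le> \<dots>" .
        qed
        also have "\<dots> = ennreal (?T * c powr ?N * t powr (1 - ?N)) * ennreal M"
          by (subst nn_integral_cmult) (measurable, simp only: M(1))
        finally have "(\<integral>\<^sup>+ h. \<integral>\<^sup>+ x. f (x, h, t) \<partial>lborel \<partial>lborel) \<le> ?k * (ennreal (?T * c powr ?N * t powr (1 - ?N)) * ennreal M)"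
          unfolding swapped by (rule mult_left_mono) simp
        also have "\<dots> = ennreal (?T * c powr ?N * M) * (indicator {0..A} t * (ennreal (t powr (q - 2)) * ennreal (t powr (1 - ?N))))"
          using T M by (simp add: ennreal_mult mult_ac)
        also have "ennreal (t powr (q - 2)) * ennreal (t powr (1 - ?N)) = ennreal (t powr (q - ?N - 1))"
          using t by (simp add: algebra_simps flip: ennreal_mult powr_add)
        finally show ?thesis .
      next
        case False
        then have "f (x, h, t) = 0" for x h
          by (cases "t = 0") (simp_all add: f_def)
        then show ?thesis by simp
      qed
    qed
    also have "\<dots> = ennreal (?T * c powr ?N * M) * ennreal (A powr (q - ?N) / (q - ?N))"
      using q nn_integral_powr_from_0[of "q - ?N - 1" A]
      by (subst nn_integral_cmult) (auto simp: A_def)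
    also have "A powr (q - ?N) = K powr ((q - ?N) / ?N) * M powr ((q - ?N) / ?N)"
      using K M by (simp add: A_def powr_powr powr_mult)
    also have "ennreal (?T * c powr ?N * M) * ennreal (K powr ((q - ?N) / ?N) * M powr ((q - ?N) / ?N) / (q - ?N)) =
      ennreal (?T * c powr ?N * (K powr ((q - ?N) / ?N) / (q - ?N)) * (M * M powr ((q - ?N) / ?N)))"
      using T M q by (subst ennreal_mult[symmetric]) (auto simp: c_def mult_ac)
    also have "M * M powr ((q - ?N) / ?N) = M powr (q / ?N)"
      using M powr_add[of M 1 "(q - ?N) / ?N"] N' by (simp add: field_simps)
    finally have "osc_energy q v \<le> ennreal (4 powr q) * ennreal (?T * c powr ?N * (K powr ((q - ?N) / ?N) / (q - ?N)) * M powr (q / ?N))"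
      by (simp add: mult_left_mono)
    also have "\<dots> = ennreal C * ennreal M epowr (q / ?N)"
      using M(2) T q unfolding C_def epowr_ennreal[OF M(2)]
      by (subst (1 2) ennreal_mult[symmetric]) (auto simp: mult.assoc)
    finally show ?thesis using M by simp
  qed
  moreover have "0 \<le> C" using T q by (simp add: C_def)
  ultimately show ?thesis by blast
qed

theorem gag_energy_le_gradient_energy:
  assumes N: "2 \<le> DIM('a::euclidean_space)" and q: "real DIM('a) < q"
  shows "\<exists>C\<ge>0. \<forall>v (g :: 'a \<Rightarrow> real). gradient_bound v g \<longrightarrow>
    (\<integral>\<^sup>+ x. ennreal (g x powr real DIM('a)) \<partial>lborel) < top \<longrightarrow>
    gag_energy q v \<le> ennreal C * (\<integral>\<^sup>+ x. ennreal (g x powr real DIM('a)) \<partial>lborel) epowr (q / real DIM('a))"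
proof -
  obtain C1 where C1: "0 \<le> C1" "\<And>v (g :: 'a \<Rightarrow> real). gradient_bound v g \<Longrightarrow>
    (\<integral>\<^sup>+ x. ennreal (g x powr real DIM('a)) \<partial>lborel) < top \<Longrightarrow>
    osc_energy q v \<le> ennreal C1 * (\<integral>\<^sup>+ x. ennreal (g x powr real DIM('a)) \<partial>lborel) epowr (q / real DIM('a))"
    using osc_energy_le_gradient_energy[OF N q] by blast
  have "1 \<le> q" using N q by linarith
  then obtain C2 where C2: "0 \<le> C2" "\<And>v :: 'a \<Rightarrow> real. v \<in> borel_measurable borel \<Longrightarrow>
    AE x in lborel. \<forall>r>0. (\<lambda>K. mean_dev v x (r / 2 ^ K)) \<longlonglongrightarrow> 0 \<Longrightarrow> gag_energy q v \<le> ennreal C2 * osc_energy q v"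
    using gag_energy_le_osc_energy[where 'a='a] by blast
  have "gag_energy q v \<le> ennreal (C2 * C1) * (\<integral>\<^sup>+ x. ennreal (g x powr real DIM('a)) \<partial>lborel) epowr (q / real DIM('a))"
    if vg: "gradient_bound v g" and fin: "(\<integral>\<^sup>+ x. ennreal (g x powr real DIM('a)) \<partial>lborel) < top" for v and g :: "'a \<Rightarrow> real"
  proof -
    have "gag_energy q v \<le> ennreal C2 * osc_energy q v"
      by (intro C2 gradient_boundD(1)[OF vg] AE_mean_dev_tendsto_0_gradient[OF vg fin])
    also have "\<dots> \<le> ennreal C2 * (ennreal C1 * (\<integral>\<^sup>+ x. ennreal (g x powr real DIM('a)) \<partial>lborel) epowr (q / real DIM('a)))"
      by (intro mult_left_mono C1 vg fin) simp
    finally show ?thesis using C1 C2 by (simp add: ennreal_mult mult.assoc)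
  qed
  then show ?thesis using C1(1) C2(1) by (intro exI[of _ "C2 * C1"]) auto
qed

subsection \<open>Test functions approximating the indicator of a box\<close>

text \<open>For fixed \<open>a < b\<close> and \<open>c > 0\<close> the class of these functions is closed under differentiation,
  because \<open>bump a b c R m = R(t) w\<^bsup>-m\<^esup> exp (- c / w)\<close> with \<open>w = (t - a) (b - t)\<close>
  vanishes to infinite order at \<open>a\<close> and \<open>b\<close>.\<close>

definition bump :: "real \<Rightarrow> real \<Rightarrow> real \<Rightarrow> real poly \<Rightarrow> nat \<Rightarrow> real \<Rightarrow> real" where
  "bump a b c R m t = (if 0 < (t - a) * (b - t)
     then poly R t * exp (- c / ((t - a) * (b - t))) / ((t - a) * (b - t)) ^ m else 0)"

text \<open>The numerator that remains when the three terms of the product rule are brought to the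
  common denominator \<open>w ^ (m + 2)\<close>.\<close>

definition bump_deriv :: "real \<Rightarrow> real \<Rightarrow> real \<Rightarrow> real poly \<Rightarrow> nat \<Rightarrow> real poly" where
  "bump_deriv a b c R m = (let w = [:- a, 1:] * [:b, - 1:] in
     pderiv R * w ^ 2 + smult c (R * pderiv w) - smult (real m) (R * (pderiv w * w)))"

lemma bump_pos_iff: "a < b \<Longrightarrow> 0 < (t - a) * (b - t) \<longleftrightarrow> a < t \<and> t < b" for a b t :: real
  by (auto simp: zero_less_mult_iff)

text \<open>Vanishing to arbitrary order with an explicit constant, from
  \<open>(1 + y / k) ^ k \<le> exp y\<close> at \<open>y = c / w\<close>.\<close>

lemma exp_minus_div_le:
  fixes c w :: real
  assumes "0 < c" "0 < w" "0 < k"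
  shows "exp (- c / w) \<le> (real k / c) ^ k * w ^ k"
proof -
  have "(c / w / real k) ^ k \<le> (1 + c / w / real k) ^ k"
    using assms by (intro power_mono) auto
  also have "\<dots> \<le> exp (c / w)"
  proof (rule exp_ge_one_plus_x_over_n_power_n)
    have "0 \<le> c / w" using assms by simp
    then show "- real k \<le> c / w" by linarith
  qed (rule assms(3))
  finally have "inverse (exp (c / w)) \<le> inverse ((c / w / real k) ^ k)"
    using assms by (intro le_imp_inverse_le) auto
  also have "inverse ((c / w / real k) ^ k) = (real k / c) ^ k * w ^ k"
    using assms by (simp add: power_divide power_mult_distrib field_simps)
  finally show ?thesis by (simp add: exp_minus)
qed

lemma DERIV_zero_if_quadratic:
  fixes f :: "real \<Rightarrow> real"
  assumes "\<And>t. \<bar>f t\<bar> \<le> C * (t - t0)\<^sup>2"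
  shows "(f has_real_derivative 0) (at t0)"
proof -
  have f0: "f t0 = 0" using assms[of t0] by simp
  have "((\<lambda>t. (f t - f t0) / (t - t0)) \<longlongrightarrow> 0) (at t0)"
  proof (rule Lim_null_comparison)
    show "eventually (\<lambda>t. norm ((f t - f t0) / (t - t0)) \<le> C * \<bar>t - t0\<bar>) (at t0)"
      unfolding eventually_at
    proof (intro exI[of _ 1] conjI ballI impI)
      fix t assume "t \<noteq> t0 \<and> dist t t0 < 1"
      then have t: "0 < \<bar>t - t0\<bar>" by simp
      have "\<bar>f t\<bar> \<le> C * (\<bar>t - t0\<bar> * \<bar>t - t0\<bar>)"
        using assms[of t] by (simp add: power2_eq_square)
      then show "norm ((f t - f t0) / (t - t0)) \<le> C * \<bar>t - t0\<bar>"
        using t f0 by (simp add: abs_divide divide_le_eq mult.assoc)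
    qed simp
    have "((\<lambda>t. C * \<bar>t - t0\<bar>) \<longlongrightarrow> C * \<bar>t0 - t0\<bar>) (at t0)"
      by (intro tendsto_intros)
    then show "((\<lambda>t. C * \<bar>t - t0\<bar>) \<longlongrightarrow> 0) (at t0)" by simp
  qed
  then show ?thesis by (simp add: has_field_derivative_iff)
qed

lemma bump_has_derivative:
  assumes ab: "a < b" and c: "0 < c"
  shows "(bump a b c R m has_real_derivative bump a b c (bump_deriv a b c R m) (m + 2) t0) (at t0)"
proof (cases "0 < (t0 - a) * (b - t0)")
  case True
  let ?w = "\<lambda>t. (t - a) * (b - t)"
  let ?f = "\<lambda>t. poly R t * exp (- c / ?w t) / ?w t ^ m"
  have w: "?w t0 \<noteq> 0" using True by linarith
  have dw: "(?w has_real_derivative (a + b - 2 * t0)) (at t0)"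
    by (auto intro!: derivative_eq_intros)
  have "(?f has_real_derivative ((poly (pderiv R) t0 * exp (- c / ?w t0) +
      poly R t0 * (exp (- c / ?w t0) * (c * (a + b - 2 * t0) / (?w t0)\<^sup>2))) * ?w t0 ^ m -
      poly R t0 * exp (- c / ?w t0) * (real m * ?w t0 ^ (m - 1) * (a + b - 2 * t0))) / (?w t0 ^ m * ?w t0 ^ m)) (at t0)"
    using w by (auto intro!: derivative_eq_intros dw poly_DERIV simp: power2_eq_square mult_ac add_ac)
  also have "((poly (pderiv R) t0 * exp (- c / ?w t0) +
      poly R t0 * (exp (- c / ?w t0) * (c * (a + b - 2 * t0) / (?w t0)\<^sup>2))) * ?w t0 ^ m -
      poly R t0 * exp (- c / ?w t0) * (real m * ?w t0 ^ (m - 1) * (a + b - 2 * t0))) / (?w t0 ^ m * ?w t0 ^ m)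
    = bump a b c (bump_deriv a b c R m) (m + 2) t0"
  proof -
    define W where "W = ?w t0"
    define d where "d = a + b - 2 * t0"
    define e where "e = exp (- c / W)"
    define r where "r = poly R t0"
    define r' where "r' = poly (pderiv R) t0"
    have W: "W \<noteq> 0" using w by (simp add: W_def)
    have pw: "poly ([:- a, 1:] * [:b, - 1:]) t0 = W" "poly (pderiv ([:- a, 1:] * [:b, - 1:])) t0 = d"
      by (simp_all add: W_def d_def pderiv_mult pderiv_pCons algebra_simps)
    have "poly (bump_deriv a b c R m) t0 = r' * W\<^sup>2 + c * (r * d) - real m * (r * (d * W))"
      unfolding bump_deriv_def Let_def poly_add poly_diff poly_smult poly_mult poly_power pw[unfolded poly_mult]
      using pw(2) by (simp add: r_def r'_def)
    \<comment> \<open>At \<open>m = 0\<close> the truncated difference \<open>m - 1\<close> is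
      harmless because it comes with the factor \<open>real m\<close>; this is why \<open>m\<close>
      is split into cases.\<close>
    moreover have "((r' * e + r * (e * (c * d / W\<^sup>2))) * W ^ m - r * e * (real m * W ^ (m - 1) * d)) / (W ^ m * W ^ m) =
      (r' * W\<^sup>2 + c * (r * d) - real m * (r * (d * W))) * e / W ^ (m + 2)"
      using W by (cases m) (simp_all add: field_simps power2_eq_square)
    ultimately show ?thesis
      using True by (simp add: bump_def W_def d_def e_def r_def r'_def)
  qed
  finally have "(?f has_real_derivative bump a b c (bump_deriv a b c R m) (m + 2) t0) (at t0)" .
  moreover have "eventually (\<lambda>t. t \<in> {a<..<b}) (nhds t0)"
    using True ab by (intro eventually_nhds_in_open) (auto simp: bump_pos_iff)
  then have "eventually (\<lambda>t. bump a b c R m t = ?f t) (nhds t0)"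
    by eventually_elim (use ab in \<open>simp add: bump_def bump_pos_iff\<close>)
  ultimately show ?thesis
    by (subst DERIV_cong_ev[OF refl _ refl]) auto
next
  case False
  have "compact (poly R ` {a..b})"
    by (intro compact_continuous_image continuous_intros) auto
  then obtain M where "\<forall>y\<in>poly R ` {a..b}. norm y \<le> M"
    using compact_imp_bounded bounded_iff by metis
  then have M: "\<And>t. t \<in> {a..b} \<Longrightarrow> \<bar>poly R t\<bar> \<le> M" by simp
  have M0: "0 \<le> M" using M[of a] ab by force
  \<comment> \<open>Of the \<open>m + 2\<close> powers of \<open>w\<close> won from the exponential,
    \<open>m\<close> cancel the denominator, and the remaining two give the quadratic bound.
    \<open>L\<close> bounds \<open>\<bar>a + b - t - t0\<bar>\<close> for \<open>t\<close> between
    \<open>a\<close> and \<open>b\<close>.\<close>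
  let ?k = "m + 2"
  define L where "L = 2 * \<bar>a\<bar> + 2 * \<bar>b\<bar> + \<bar>t0\<bar>"
  define K where "K = M * (real ?k / c) ^ ?k"
  have K0: "0 \<le> K" using M0 c by (simp add: K_def)
  have "\<bar>bump a b c R m t\<bar> \<le> (K * L\<^sup>2) * (t - t0)\<^sup>2" for t
  proof (cases "0 < (t - a) * (b - t)")
    case True
    let ?W = "(t - a) * (b - t)"
    have t: "a < t" "t < b" using True ab by (auto simp: bump_pos_iff)
    have "\<bar>bump a b c R m t\<bar> = \<bar>poly R t\<bar> * exp (- c / ?W) / ?W ^ m"
      unfolding bump_def if_P[OF True] using True by (simp add: abs_mult abs_divide)
    also have "\<dots> \<le> M * ((real ?k / c) ^ ?k * ?W ^ ?k) / ?W ^ m"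
      using True M[of t] t M0 c by (intro divide_right_mono mult_mono exp_minus_div_le zero_le_power less_imp_le[OF True]) auto
    also have "\<dots> = K * ?W\<^sup>2"
    proof -
      have "M * (A * (y ^ m * B)) / y ^ m = M * A * B" if "y \<noteq> 0" for A B y :: real
        using that by simp
      from this[OF less_imp_neq[OF True, symmetric]] show ?thesis
        unfolding K_def power_add[of ?W m 2] .
    qed
    also have "?W\<^sup>2 \<le> (\<bar>t - t0\<bar> * L)\<^sup>2"
    proof (rule power_mono)
      \<comment> \<open>At \<open>t0\<close> the quadratic is not positive, so its increment from
        \<open>t0\<close> bounds its value at \<open>t\<close>. This treats the endpoints and the
        exterior together.\<close>
      have "?W \<le> ?W - (t0 - a) * (b - t0)" using False by linarith
      also have "\<dots> = (t - t0) * (a + b - t - t0)" by (simp add: algebra_simps)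
      also have "\<dots> \<le> \<bar>t - t0\<bar> * \<bar>a + b - t - t0\<bar>" by (metis abs_ge_self abs_mult)
      also have "\<dots> \<le> \<bar>t - t0\<bar> * L"
        using t by (intro mult_left_mono) (auto simp: L_def)
      finally show "?W \<le> \<bar>t - t0\<bar> * L" .
    qed (use True in linarith)
    finally have "\<bar>bump a b c R m t\<bar> \<le> K * (\<bar>t - t0\<bar> * L)\<^sup>2"
      using mult_left_mono[OF _ K0] by blast
    then show ?thesis by (simp add: power_mult_distrib mult_ac)
  next
    case F: False
    then show ?thesis using K0 by (simp only: bump_def if_False) simp
  qed
  then have "(bump a b c R m has_real_derivative 0) (at t0)"
    by (rule DERIV_zero_if_quadratic)
  then show ?thesis using False by (simp add: bump_def)
qed

text \<open>Each coordinate has its own polynomial and its own exponent because a partial derivative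
  changes those of one coordinate only; \<open>c\<close> is common to all.\<close>

definition bump_prod :: "real ^ 'n \<Rightarrow> real ^ 'n \<Rightarrow> real \<Rightarrow> ('n \<Rightarrow> real poly) \<Rightarrow> ('n \<Rightarrow> nat) \<Rightarrow> real ^ 'n \<Rightarrow> real" where
  "bump_prod a b c R m x = (\<Prod>i\<in>UNIV. bump (a $ i) (b $ i) c (R i) (m i) (x $ i))"

lemma bump_prod_has_derivative:
  assumes ab: "\<And>i. a $ i < b $ i" and c: "0 < c"
  shows "(bump_prod a b c R m has_derivative (\<lambda>y. \<Sum>i\<in>UNIV. y $ i *
    bump (a $ i) (b $ i) c (bump_deriv (a $ i) (b $ i) c (R i) (m i)) (m i + 2) (x $ i) *
    (\<Prod>j\<in>UNIV - {i}. bump (a $ j) (b $ j) c (R j) (m j) (x $ j)))) (at x)"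
  unfolding bump_prod_def
proof (rule has_derivative_prod)
  fix i
  have "(bump (a $ i) (b $ i) c (R i) (m i) has_derivative
     (\<lambda>h. h * bump (a $ i) (b $ i) c (bump_deriv (a $ i) (b $ i) c (R i) (m i)) (m i + 2) (x $ i))) (at (x $ i))"
    using bump_has_derivative[OF ab c, of i "R i" "m i" "x $ i"]
    by (simp add: has_field_derivative_def mult_commute_abs)
  moreover have "((\<lambda>x. x $ i) has_derivative (\<lambda>y. y $ i)) (at x)"
    by (rule bounded_linear_imp_has_derivative[OF bounded_linear_vec_nth])
  ultimately show "((\<lambda>x. bump (a $ i) (b $ i) c (R i) (m i) (x $ i)) has_derivative
     (\<lambda>y. y $ i * bump (a $ i) (b $ i) c (bump_deriv (a $ i) (b $ i) c (R i) (m i)) (m i + 2) (x $ i))) (at x)"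
    using has_derivative_compose by fastforce
qed

lemma partial_deriv_bump_prod:
  assumes ab: "\<And>i. a $ i < b $ i" and c: "0 < c"
  shows "partial_deriv j (bump_prod a b c R m) =
    bump_prod a b c (R(j := bump_deriv (a $ j) (b $ j) c (R j) (m j))) (m(j := m j + 2))"
proof
  fix x
  let ?f = "\<lambda>i. bump (a $ i) (b $ i) c (bump_deriv (a $ i) (b $ i) c (R i) (m i)) (m i + 2) (x $ i)"
  let ?P = "\<lambda>i. \<Prod>j\<in>UNIV - {i}. bump (a $ j) (b $ j) c (R j) (m j) (x $ j)"
  have "partial_deriv j (bump_prod a b c R m) x = (\<Sum>i\<in>UNIV. axis j 1 $ i * ?f i * ?P i)"
    unfolding partial_deriv_def
    by (subst frechet_derivative_at[OF bump_prod_has_derivative[OF ab c], symmetric]) simp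
  also have "\<dots> = (\<Sum>i\<in>{j}. axis j 1 $ i * ?f i * ?P i)"
    by (rule sum.mono_neutral_right) (auto simp: axis_def)
  also have "\<dots> = ?f j * ?P j" by simp
  also have "\<dots> = bump_prod a b c (R(j := bump_deriv (a $ j) (b $ j) c (R j) (m j))) (m(j := m j + 2)) x"
    unfolding bump_prod_def by (subst (2) prod.remove[of _ j]) (auto intro!: prod.cong)
  finally show "partial_deriv j (bump_prod a b c R m) x =
    bump_prod a b c (R(j := bump_deriv (a $ j) (b $ j) c (R j) (m j))) (m(j := m j + 2)) x" .
qed

lemma smooth_bump_prod:
  assumes ab: "\<And>i. a $ i < b $ i" and c: "0 < c"
  shows "smooth (bump_prod a b c R m)"
proof -
  have "\<exists>R' m'. foldr partial_deriv is (bump_prod a b c R m) = bump_prod a b c R' m'" for "is"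
  proof (induction "is")
    case (Cons i "is")
    then obtain R' m' where "foldr partial_deriv is (bump_prod a b c R m) = bump_prod a b c R' m'" by blast
    then show ?case unfolding foldr_Cons comp_def using partial_deriv_bump_prod[OF ab c] by metis
  qed auto
  note iterated = this
  show ?thesis
    unfolding smooth_def
  proof (intro allI)
    fix "is" x
    obtain R' m' where "foldr partial_deriv is (bump_prod a b c R m) = bump_prod a b c R' m'"
      using iterated by blast
    then show "foldr partial_deriv is (bump_prod a b c R m) differentiable (at x)"
      using bump_prod_has_derivative[OF ab c] by (auto simp only: differentiable_def)
  qed
qed

lemma bump_prod_outside_box:
  assumes ab: "\<And>i. a $ i < b $ i" and x: "x \<notin> box a b"
  shows "bump_prod a b c R m x = 0"
proof -
  obtain i where "\<not> (a $ i < x $ i \<and> x $ i < b $ i)"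
    using x by (auto simp: mem_box_cart)
  then have "bump (a $ i) (b $ i) c (R i) (m i) (x $ i) = 0"
    unfolding bump_def using bump_pos_iff[OF ab[of i]] by auto
  then show ?thesis unfolding bump_prod_def by (auto intro!: prod_zero)
qed

lemma test_function_bump_prod:
  assumes ab: "\<And>i. a $ i < b $ i" and c: "0 < c"
  shows "test_function (bump_prod a b c R m)"
proof -
  have "closure {x. bump_prod a b c R m x \<noteq> 0} \<subseteq> cbox a b"
    using bump_prod_outside_box[OF ab] box_subset_cbox[of a b]
    by (intro closure_minimal) blast+
  then have "compact (closure {x. bump_prod a b c R m x \<noteq> 0})"
    by (metis closed_closure compact_Int_closed compact_cbox inf.absorb2)
  then show ?thesis
    unfolding test_function_def using smooth_bump_prod[OF ab c] by auto
qed

text \<open>As \<open>c\<close> tends to \<open>0\<close>, \<open>exp (- c / w)\<close> tends to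
  \<open>1\<close> wherever \<open>w > 0\<close>, so these functions fill the open box from
  below.\<close>

definition box_approx :: "real ^ 'n \<Rightarrow> real ^ 'n \<Rightarrow> nat \<Rightarrow> real ^ 'n \<Rightarrow> real" where
  "box_approx a b k = bump_prod a b (1 / real (Suc k)) (\<lambda>_. 1) (\<lambda>_. 0)"

lemma
  assumes ab: "\<And>i. a $ i < b $ i"
  shows test_function_box_approx: "test_function (box_approx a b k)"
    and box_approx_nonneg: "0 \<le> box_approx a b k x"
    and box_approx_le: "box_approx a b k x \<le> indicator (box a b) x"
    and box_approx_tendsto: "(\<lambda>k. box_approx a b k x) \<longlonglongrightarrow> indicator (box a b) x"
proof -
  let ?w = "\<lambda>i. (x $ i - a $ i) * (b $ i - x $ i)"
  have nn: "0 \<le> bump (a $ i) (b $ i) c 1 0 (x $ i)" for i c by (simp add: bump_def)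
  show "test_function (box_approx a b k)"
    unfolding box_approx_def by (intro test_function_bump_prod ab) simp
  show "0 \<le> box_approx a b k x"
    unfolding box_approx_def bump_prod_def by (intro prod_nonneg nn ballI)
  show "box_approx a b k x \<le> indicator (box a b) x"
  proof (cases "x \<in> box a b")
    case True
    have "bump (a $ i) (b $ i) (1 / real (Suc k)) 1 0 (x $ i) \<le> 1" for i
    proof (cases "0 < ?w i")
      case True
      then show ?thesis by (simp add: bump_def)
    next
      case False
      then show ?thesis by (simp only: bump_def if_False)
    qed
    then show ?thesis
      using True unfolding box_approx_def bump_prod_def by (auto intro!: prod_le_1 nn)
  qed (simp add: box_approx_def bump_prod_outside_box[OF ab])
  show "(\<lambda>k. box_approx a b k x) \<longlonglongrightarrow> indicator (box a b) x"
  proof (cases "x \<in> box a b")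
    case True
    have "(\<lambda>k. bump (a $ i) (b $ i) (1 / real (Suc k)) 1 0 (x $ i)) \<longlonglongrightarrow> 1" for i
    proof -
      have pos: "0 < ?w i" using True ab[of i] by (auto simp: mem_box_cart)
      have "(\<lambda>k. inverse (real (Suc k))) \<longlonglongrightarrow> 0" by (rule LIMSEQ_inverse_real_of_nat)
      then have "(\<lambda>k. exp (- (inverse (real (Suc k))) / ?w i)) \<longlonglongrightarrow> exp (- 0 / ?w i)"
        using pos by (intro tendsto_intros) auto
      then show ?thesis using pos by (simp add: bump_def inverse_eq_divide)
    qed
    then have "(\<lambda>k. box_approx a b k x) \<longlonglongrightarrow> (\<Prod>i\<in>(UNIV :: 'a set). 1)"
      unfolding box_approx_def bump_prod_def by (intro tendsto_prod)
    then show ?thesis using True by simp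
  qed (simp add: box_approx_def bump_prod_outside_box[OF ab])
qed

section \<open>Calculus with test functions\<close>

lemma smooth_differentiable: "smooth \<phi> \<Longrightarrow> foldr partial_deriv is \<phi> differentiable (at x)"
  by (simp add: smooth_def)

lemma test_function_differentiable:
  assumes "test_function \<phi>"
  shows "\<phi> differentiable (at x)" "partial_deriv i \<phi> differentiable (at x)"
  using assms smooth_differentiable[of \<phi> "[]" x] smooth_differentiable[of \<phi> "[i]" x]
  by (simp_all add: test_function_def)

lemma test_function_continuous:
  assumes "test_function \<phi>"
  shows "continuous_on UNIV \<phi>" "continuous_on UNIV (partial_deriv i \<phi>)"
  using test_function_differentiable[OF assms]
  by (auto intro!: differentiable_imp_continuous_on simp: differentiable_on_def intro: differentiable_at_withinI)

lemma partial_deriv_translate: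
  assumes "\<And>x. f differentiable (at x)"
  shows "partial_deriv i (\<lambda>x. f (x - a)) = (\<lambda>x. partial_deriv i f (x - a))"
proof
  fix x
  have "((\<lambda>x. x - a) has_derivative (\<lambda>h. h)) (at x)"
    by (auto intro!: derivative_eq_intros)
  then have "((\<lambda>x. f (x - a)) has_derivative frechet_derivative f (at (x - a))) (at x)"
    using has_derivative_compose[of "\<lambda>x. x - a" "\<lambda>h. h" x UNIV f] assms[of "x - a"] frechet_derivative_works
    by fastforce
  from frechet_derivative_at[OF this, symmetric]
  show "partial_deriv i (\<lambda>x. f (x - a)) x = partial_deriv i f (x - a)"
    by (simp add: partial_deriv_def)
qed

lemma test_function_translate:
  assumes "test_function \<phi>"
  shows "test_function (\<lambda>x. \<phi> (x - a))"
proof -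
  have smooth: "smooth \<phi>" using assms by (simp add: test_function_def)
  have eq: "foldr partial_deriv is (\<lambda>x. \<phi> (x - a)) = (\<lambda>x. foldr partial_deriv is \<phi> (x - a))" for "is"
  proof (induction "is")
    case (Cons i "is")
    show ?case
      unfolding foldr_Cons comp_def Cons.IH
      by (rule partial_deriv_translate) (rule smooth_differentiable[OF smooth])
  qed simp
  have "(\<lambda>x. foldr partial_deriv is \<phi> (x - a)) differentiable (at x)" for "is" x
    by (rule differentiable_compose[of "foldr partial_deriv is \<phi>" "\<lambda>x. x - a"])
       (rule smooth_differentiable[OF smooth], simp)
  moreover have "bounded {x. \<phi> (x - a) \<noteq> 0}"
  proof -
    have "bounded {x. \<phi> x \<noteq> 0}" using assms by (simp add: test_function_def compact_closure)
    then have "bounded ((+) a ` {x. \<phi> x \<noteq> 0})" by (rule bounded_translation)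
    moreover have "{x. \<phi> (x - a) \<noteq> 0} \<subseteq> (+) a ` {x. \<phi> x \<noteq> 0}"
      by (auto intro!: image_eqI[of _ _ "_ - a"])
    ultimately show ?thesis by (rule bounded_subset)
  qed
  ultimately show ?thesis
    by (simp add: test_function_def smooth_def eq compact_closure)
qed

lemma test_function_support:
  fixes \<phi> :: "real ^ 'n \<Rightarrow> real"
  assumes "test_function \<phi>"
  obtains R where "0 < R" "\<And>x. R \<le> norm x \<Longrightarrow> \<phi> x = 0" "\<And>x i. R \<le> norm x \<Longrightarrow> partial_deriv i \<phi> x = 0"
proof -
  have "bounded {x. \<phi> x \<noteq> 0}" using assms by (simp add: test_function_def compact_closure)
  then obtain B where B: "\<And>x. \<phi> x \<noteq> 0 \<Longrightarrow> norm x \<le> B"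
    unfolding bounded_iff by auto
  \<comment> \<open>The extra \<open>1\<close> puts every \<open>x\<close> with
    \<open>R \<le> norm x\<close> into an open set on which \<open>\<phi>\<close> vanishes, so the
    partial derivatives vanish there as well.\<close>
  define R where "R = \<bar>B\<bar> + 1"
  have zero: "\<phi> x = 0" if "\<bar>B\<bar> < norm x" for x using B[of x] that by force
  have "partial_deriv i \<phi> x = 0" if "R \<le> norm x" for x i
  proof -
    have "open {y :: real ^ 'n. \<bar>B\<bar> < norm y}"
      by (intro open_Collect_less continuous_intros)
    moreover have "x \<in> {y. \<bar>B\<bar> < norm y}" using that by (simp add: R_def)
    ultimately have "(\<phi> has_derivative (\<lambda>_. 0)) (at x)"
      using zero by (intro has_derivative_transform_within_open[OF has_derivative_const[of 0]]) auto
    from frechet_derivative_at[OF this] show ?thesis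
      by (metis partial_deriv_def)
  qed
  moreover have "0 < R" "\<And>x. R \<le> norm x \<Longrightarrow> \<phi> x = 0"
    using zero by (auto simp: R_def)
  ultimately show ?thesis using that by blast
qed

lemma continuous_compact_support_bounded:
  fixes f :: "'a::euclidean_space \<Rightarrow> real"
  assumes "continuous_on UNIV f" "\<And>x. R \<le> norm x \<Longrightarrow> f x = 0"
  obtains B where "0 \<le> B" "\<And>x. \<bar>f x\<bar> \<le> B"
proof -
  have "compact (f ` cball 0 R)"
    by (intro compact_continuous_image continuous_on_subset[OF assms(1)]) auto
  then obtain B where B: "\<forall>y\<in>f ` cball 0 R. norm y \<le> B"
    using compact_imp_bounded bounded_iff by metis
  have "\<bar>f x\<bar> \<le> \<bar>B\<bar>" for x
    using B assms(2)[of x] by (cases "norm x \<le> R") force+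
  then show ?thesis using that[of "\<bar>B\<bar>"] by auto
qed

lemma frechet_derivative_partial_deriv:
  assumes "\<phi> differentiable (at x)"
  shows "frechet_derivative \<phi> (at x) h = (\<Sum>i\<in>UNIV. h $ i * partial_deriv i \<phi> x)"
proof -
  have lin: "linear (frechet_derivative \<phi> (at x))"
    by (rule linear_frechet_derivative[OF assms])
  have "h = (\<Sum>i\<in>UNIV. h $ i *\<^sub>R axis i 1)"
    by (subst basis_expansion[of h, symmetric]) (simp add: scalar_mult_eq_scaleR)
  then have "frechet_derivative \<phi> (at x) h = frechet_derivative \<phi> (at x) (\<Sum>i\<in>UNIV. h $ i *\<^sub>R axis i 1)"
    by (rule arg_cong)
  also have "\<dots> = (\<Sum>i\<in>UNIV. h $ i * partial_deriv i \<phi> x)"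
    by (simp add: linear_sum[OF lin] linear_scale[OF lin] partial_deriv_def)
  finally show ?thesis .
qed

text \<open>The segment runs backwards from \<open>x\<close> because the translations will act on
  the test function, opposite to those of \<open>v\<close>.\<close>

lemma test_function_FTC:
  assumes "test_function \<phi>"
  shows "(LINT t|lborel. (\<Sum>i\<in>UNIV. h $ i * partial_deriv i \<phi> (x - t *\<^sub>R h)) * indicator {0..1} t) = \<phi> x - \<phi> (x - h)"
proof -
  let ?f = "\<lambda>t. \<Sum>i\<in>UNIV. h $ i * partial_deriv i \<phi> (x - t *\<^sub>R h)"
  have "(LINT t|lborel. ?f t * indicator {0..1} t) = - \<phi> (x - 1 *\<^sub>R h) - (- \<phi> (x - 0 *\<^sub>R h))"
  proof (rule integral_FTC_Icc_real)
    fix t :: real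
    have d: "\<phi> differentiable (at (x - t *\<^sub>R h))" by (rule test_function_differentiable[OF assms])
    have lin: "linear (frechet_derivative \<phi> (at (x - t *\<^sub>R h)))" by (rule linear_frechet_derivative[OF d])
    have "((\<lambda>t. x - t *\<^sub>R h) has_derivative (\<lambda>s. - (s *\<^sub>R h))) (at t)"
      by (auto intro!: derivative_eq_intros)
    from has_derivative_compose[OF this, of \<phi> "frechet_derivative \<phi> (at (x - t *\<^sub>R h))"]
    have "((\<lambda>t. \<phi> (x - t *\<^sub>R h)) has_derivative (\<lambda>s. frechet_derivative \<phi> (at (x - t *\<^sub>R h)) (- (s *\<^sub>R h)))) (at t)"
      using d frechet_derivative_works by blast
    then have "((\<lambda>t. - \<phi> (x - t *\<^sub>R h)) has_derivative (\<lambda>s. - frechet_derivative \<phi> (at (x - t *\<^sub>R h)) (- (s *\<^sub>R h)))) (at t)"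
      by (rule has_derivative_minus)
    also have "(\<lambda>s. - frechet_derivative \<phi> (at (x - t *\<^sub>R h)) (- (s *\<^sub>R h))) = (*) (?f t)"
      by (auto simp: fun_eq_iff linear_neg[OF lin] linear_scale[OF lin] frechet_derivative_partial_deriv[OF d]
          sum_negf sum_distrib_left sum_distrib_right mult_ac)
    finally show "((\<lambda>t. - \<phi> (x - t *\<^sub>R h)) has_real_derivative ?f t) (at t)"
      by (simp add: has_field_derivative_def)
    show "isCont ?f t"
    proof -
      have "continuous_on UNIV ?f"
        by (intro continuous_intros continuous_on_compose2[OF test_function_continuous(2)[OF assms]]) auto
      then show ?thesis by (simp add: continuous_on_eq_continuous_at)
    qed
  qed simp
  then show ?thesis by simp
qed

section \<open>Functions that annihilate all test functions\<close>

definition borel_loc_integrable :: "('a::euclidean_space \<Rightarrow> real) \<Rightarrow> bool" where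
  "borel_loc_integrable f \<longleftrightarrow> f \<in> borel_measurable borel \<and>
    (\<forall>R. (\<integral>\<^sup>+ x. indicator (ball 0 R) x * ennreal \<bar>f x\<bar> \<partial>lborel) < top)"

lemma borel_loc_integrable_mult:
  fixes f :: "'a::euclidean_space \<Rightarrow> real"
  assumes f: "borel_loc_integrable f" and [measurable]: "g \<in> borel_measurable borel"
    and g: "\<And>x. \<bar>g x\<bar> \<le> B" "\<And>x. R \<le> norm x \<Longrightarrow> g x = 0"
  shows "integrable lborel (\<lambda>x. f x * g x)"
proof (rule integrableI_bounded)
  have [measurable]: "f \<in> borel_measurable borel" using f by (simp add: borel_loc_integrable_def)
  show "(\<lambda>x. f x * g x) \<in> borel_measurable lborel" by measurable
  have B: "0 \<le> B" using g(1)[of 0] by linarith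
  have "(\<integral>\<^sup>+ x. ennreal (norm (f x * g x)) \<partial>lborel) \<le> (\<integral>\<^sup>+ x. ennreal B * (indicator (ball 0 R) x * ennreal \<bar>f x\<bar>) \<partial>lborel)"
  proof (rule nn_integral_mono)
    fix x
    show "ennreal (norm (f x * g x)) \<le> ennreal B * (indicator (ball 0 R) x * ennreal \<bar>f x\<bar>)"
    proof (cases "R \<le> norm x")
      case False
      have "norm (f x * g x) \<le> B * \<bar>f x\<bar>"
        using g(1)[of x] mult_left_mono[of "\<bar>g x\<bar>" B "\<bar>f x\<bar>"] by (simp add: abs_mult mult.commute)
      then have "ennreal (norm (f x * g x)) \<le> ennreal B * ennreal \<bar>f x\<bar>"
        using B by (simp add: ennreal_leI flip: ennreal_mult)
      then show ?thesis using False by simp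
    qed (use g in simp)
  qed
  also have "\<dots> = ennreal B * (\<integral>\<^sup>+ x. indicator (ball 0 R) x * ennreal \<bar>f x\<bar> \<partial>lborel)"
    by (rule nn_integral_cmult) measurable
  also have "\<dots> < top"
    using f by (simp add: borel_loc_integrable_def ennreal_mult_less_top)
  finally show "(\<integral>\<^sup>+ x. ennreal (norm (f x * g x)) \<partial>lborel) < \<infinity>" by simp
qed

lemma borel_loc_integrable_test_function:
  assumes f: "borel_loc_integrable f" and \<phi>: "test_function \<phi>"
  shows "integrable lborel (\<lambda>x. f x * \<phi> x)" "integrable lborel (\<lambda>x. f x * partial_deriv i \<phi> x)"
proof -
  obtain R where R: "\<And>x. R \<le> norm x \<Longrightarrow> \<phi> x = 0" "\<And>x i. R \<le> norm x \<Longrightarrow> partial_deriv i \<phi> x = 0"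
    using test_function_support[OF \<phi>] by metis
  note cont = test_function_continuous[OF \<phi>]
  obtain B where "\<And>x. \<bar>\<phi> x\<bar> \<le> B"
    using continuous_compact_support_bounded[OF cont(1) R(1)] by metis
  then show "integrable lborel (\<lambda>x. f x * \<phi> x)"
    by (intro borel_loc_integrable_mult[OF f borel_measurable_continuous_onI[OF cont(1)] _ R(1)])
  obtain B where "\<And>x. \<bar>partial_deriv i \<phi> x\<bar> \<le> B"
    using continuous_compact_support_bounded[OF cont(2) R(2)] by metis
  then show "integrable lborel (\<lambda>x. f x * partial_deriv i \<phi> x)"
    by (intro borel_loc_integrable_mult[OF f borel_measurable_continuous_onI[OF cont(2)] _ R(2)])
qed

lemma box_norm_bound:
  fixes a b :: "'a::euclidean_space"
  obtains R where "\<And>x. x \<in> box a b \<Longrightarrow> norm x < R"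
proof -
  obtain B where "\<And>x. x \<in> box a b \<Longrightarrow> norm x \<le> B"
    using bounded_box[of a b] unfolding bounded_iff by blast
  then show ?thesis using that[of "B + 1"] by force
qed

text \<open>Dominated convergence along \<open>box_approx\<close>, with the product of
  \<open>f\<close> and the indicator as dominating function, carries the annihilation over from test
  functions to indicators of boxes.\<close>

lemma integral_box_eq_0:
  fixes f :: "real ^ 'n \<Rightarrow> real"
  assumes f: "borel_loc_integrable f" and zero: "\<And>\<phi>. test_function \<phi> \<Longrightarrow> (LINT x|lborel. f x * \<phi> x) = 0"
  shows "integrable lborel (\<lambda>x. f x * indicator (box a b) x)" "(LINT x|lborel. f x * indicator (box a b) x) = 0"
proof -
  have [measurable]: "f \<in> borel_measurable borel" using f by (simp add: borel_loc_integrable_def)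
  have [measurable]: "box a b \<in> sets borel" by (simp add: borel_open)
  obtain R where R: "\<And>x. x \<in> box a b \<Longrightarrow> norm x < R" using box_norm_bound by blast
  show int: "integrable lborel (\<lambda>x. f x * indicator (box a b) x)"
    by (rule borel_loc_integrable_mult[OF f, of _ 1 R]) (use R in \<open>force simp: indicator_def\<close>)+
  show "(LINT x|lborel. f x * indicator (box a b) x) = 0"
  proof (cases "\<forall>i. a $ i < b $ i")
    case True
    then have ab: "\<And>i. a $ i < b $ i" by blast
    have "(\<lambda>k. LINT x|lborel. f x * box_approx a b k x) \<longlonglongrightarrow> (LINT x|lborel. f x * indicator (box a b) x)"
    proof (rule integral_dominated_convergence)
      show "integrable lborel (\<lambda>x. norm (f x * indicator (box a b) x))"
        using int by (rule integrable_norm)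
      show "(\<lambda>x. f x * box_approx a b k x) \<in> borel_measurable lborel" for k
      proof -
        have [measurable]: "box_approx a b k \<in> borel_measurable borel"
          by (intro borel_measurable_continuous_onI test_function_continuous(1) test_function_box_approx ab)
        show ?thesis by measurable
      qed
      show "AE x in lborel. (\<lambda>k. f x * box_approx a b k x) \<longlonglongrightarrow> f x * indicator (box a b) x"
        by (intro AE_I2 tendsto_mult tendsto_const box_approx_tendsto ab)
      show "AE x in lborel. norm (f x * box_approx a b k x) \<le> norm (f x * indicator (box a b) x)" for k
        using box_approx_nonneg[OF ab] box_approx_le[OF ab]
        by (intro AE_I2) (auto simp: abs_mult intro!: mult_left_mono)
    qed measurable
    moreover have "(\<lambda>k. LINT x|lborel. f x * box_approx a b k x) = (\<lambda>k. 0)"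
      using zero test_function_box_approx[OF ab] by auto
    ultimately show ?thesis using LIMSEQ_unique tendsto_const by metis
  next
    case False
    then obtain i where "\<not> a $ i < b $ i" by blast
    then have "box a b = {}" by (auto simp: set_eq_iff mem_box_cart intro!: exI[of _ i])
    then show ?thesis by simp
  qed
qed

text \<open>The positive and the negative part of \<open>f\<close> are densities of two measures
  that agree and are finite on boxes. Boxes are closed under intersection and generate the Borel
  sets, so the measures are equal, and so are their densities almost everywhere.\<close>

lemma AE_eq_0_if_integral_box_eq_0:
  fixes f :: "'a::euclidean_space \<Rightarrow> real"
  assumes [measurable]: "f \<in> borel_measurable borel"
    and int: "\<And>a b. integrable lborel (\<lambda>x. f x * indicator (box a b) x)"
    and zero: "\<And>a b. (LINT x|lborel. f x * indicator (box a b) x) = 0"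
  shows "AE x in lborel. f x = 0"
proof -
  have box_m [measurable]: "box a b \<in> sets borel" for a b :: 'a by (simp add: borel_open)
  let ?p = "\<lambda>x. ennreal (f x)" and ?n = "\<lambda>x. ennreal (- f x)"
  have fin: "(\<integral>\<^sup>+ x. ?p x * indicator (box a b) x \<partial>lborel) < top"
    and eq: "(\<integral>\<^sup>+ x. ?p x * indicator (box a b) x \<partial>lborel) = (\<integral>\<^sup>+ x. ?n x * indicator (box a b) x \<partial>lborel)" for a b
  proof -
    have pn: "(\<integral>\<^sup>+ x. ennreal (f x * indicator (box a b) x) \<partial>lborel) = (\<integral>\<^sup>+ x. ?p x * indicator (box a b) x \<partial>lborel)"
      "(\<integral>\<^sup>+ x. ennreal (- (f x * indicator (box a b) x)) \<partial>lborel) = (\<integral>\<^sup>+ x. ?n x * indicator (box a b) x \<partial>lborel)"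
      by (auto intro!: nn_integral_cong simp: indicator_def)
    have fin': "(\<integral>\<^sup>+ x. ?p x * indicator (box a b) x \<partial>lborel) \<noteq> \<infinity>" "(\<integral>\<^sup>+ x. ?n x * indicator (box a b) x \<partial>lborel) \<noteq> \<infinity>"
      using int[of a b] unfolding real_integrable_def pn by auto
    then show "(\<integral>\<^sup>+ x. ?p x * indicator (box a b) x \<partial>lborel) < top" by (simp add: less_top)
    have "enn2real (\<integral>\<^sup>+ x. ?p x * indicator (box a b) x \<partial>lborel) = enn2real (\<integral>\<^sup>+ x. ?n x * indicator (box a b) x \<partial>lborel)"
      using zero[of a b] unfolding real_lebesgue_integral_def[OF int] pn by simp
    then show "(\<integral>\<^sup>+ x. ?p x * indicator (box a b) x \<partial>lborel) = (\<integral>\<^sup>+ x. ?n x * indicator (box a b) x \<partial>lborel)"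
    proof -
      assume eq: "enn2real (\<integral>\<^sup>+ x. ?p x * indicator (box a b) x \<partial>lborel) = enn2real (\<integral>\<^sup>+ x. ?n x * indicator (box a b) x \<partial>lborel)"
      have finite: "ennreal (enn2real P) = P" if "P \<noteq> \<infinity>" for P
        using that by (simp add: less_top)
      show ?thesis
        by (rule trans[OF finite[OF fin'(1), symmetric] trans[OF arg_cong[OF eq, of ennreal] finite[OF fin'(2)]]])
    qed
  qed
  have "density lborel ?p = density lborel ?n"
  proof (rule measure_eqI_generator_eq[where E = "range (\<lambda>(a, b). box a b)" and \<Omega> = UNIV and A = "\<lambda>k. box (- real k *\<^sub>R One) (real k *\<^sub>R One)"])
    show "Int_stable (range (\<lambda>(a, b). box a b :: 'a set))"
      by (auto simp: Int_stable_def box_Int_box)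
    show "sets (density lborel ?p) = sigma_sets UNIV (range (\<lambda>(a, b). box a b :: 'a set))"
      "sets (density lborel ?n) = sigma_sets UNIV (range (\<lambda>(a, b). box a b :: 'a set))"
      by (simp_all add: borel_eq_box)
    show "emeasure (density lborel ?p) X = emeasure (density lborel ?n) X" if "X \<in> range (\<lambda>(a, b). box a b :: 'a set)" for X
      using that by (auto simp: emeasure_density eq)
    show "(\<Union>k. box (- real k *\<^sub>R One) (real k *\<^sub>R One)) = (UNIV :: 'a set)"
      using UN_box_eq_UNIV by simp
    show "emeasure (density lborel ?p) (box (- real k *\<^sub>R One) (real k *\<^sub>R One)) \<noteq> \<infinity>" for k
      using fin[of "- real k *\<^sub>R One" "real k *\<^sub>R One"] by (simp add: emeasure_density less_top)
  qed auto
  then have "AE x in lborel. ?p x = ?n x"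
    by (rule sigma_finite_measure.density_unique[OF sigma_finite_lborel, rotated 2]) measurable
  then show ?thesis
    by eventually_elim (metis ennreal_eq_0_iff ennreal_neg linorder_linear neg_0_le_iff_le neg_le_0_iff_le order_antisym)
qed

subsection \<open>Weak gradients and difference quotients\<close>

lemma lborel_pair_integrableI:
  fixes F :: "'a::euclidean_space \<times> 'b::euclidean_space \<Rightarrow> real"
  assumes [measurable]: "F \<in> borel_measurable (lborel \<Otimes>\<^sub>M lborel)"
    and fin: "(\<integral>\<^sup>+ t. \<integral>\<^sup>+ x. ennreal \<bar>F (x, t)\<bar> \<partial>lborel \<partial>lborel) < top"
  shows "integrable (lborel \<Otimes>\<^sub>M lborel) F"
proof (rule integrableI_bounded)
  have "(\<integral>\<^sup>+ t. \<integral>\<^sup>+ x. ennreal \<bar>F (x, t)\<bar> \<partial>lborel \<partial>lborel) = (\<integral>\<^sup>+ z. ennreal \<bar>F z\<bar> \<partial>(lborel \<Otimes>\<^sub>M lborel))"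
    by (rule lborel_pair.nn_integral_snd) measurable
  then show "(\<integral>\<^sup>+ z. ennreal (norm (F z)) \<partial>(lborel \<Otimes>\<^sub>M lborel)) < \<infinity>"
    using fin by simp
qed measurable

lemma integral_lborel_shift:
  fixes f :: "'a::euclidean_space \<Rightarrow> real"
  assumes [measurable]: "f \<in> borel_measurable borel"
  shows "(LINT x|lborel. f (x + c)) = (LINT x|lborel. f x)"
proof -
  have "(LINT x|lborel. f x) = (LINT x|distr lborel borel ((+) c). f x)"
    by (simp add: lborel_distr_plus)
  also have "\<dots> = (LINT x|lborel. f (c + x))"
    by (rule integral_distr) measurable
  finally show ?thesis by (simp add: add.commute)
qed

lemma borel_loc_integrableD:
  assumes "borel_loc_integrable f"
  shows "f \<in> borel_measurable borel" "(\<integral>\<^sup>+ x. indicator (ball 0 R) x * ennreal \<bar>f x\<bar> \<partial>lborel) < top"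
  using assms by (simp_all add: borel_loc_integrable_def)

lemma borel_loc_integrable_cmult:
  fixes f :: "'a::euclidean_space \<Rightarrow> real"
  assumes "borel_loc_integrable f"
  shows "borel_loc_integrable (\<lambda>x. c * f x)"
  unfolding borel_loc_integrable_def
proof (intro conjI allI)
  note [measurable] = borel_loc_integrableD(1)[OF assms]
  show "(\<lambda>x. c * f x) \<in> borel_measurable borel" by measurable
  fix R
  have "(\<integral>\<^sup>+ x. indicator (ball 0 R) x * ennreal \<bar>c * f x\<bar> \<partial>lborel) = ennreal \<bar>c\<bar> * (\<integral>\<^sup>+ x. indicator (ball 0 R) x * ennreal \<bar>f x\<bar> \<partial>lborel)"
    by (subst nn_integral_cmult[symmetric]) (auto simp: abs_mult ennreal_mult mult_ac)
  then show "(\<integral>\<^sup>+ x. indicator (ball 0 R) x * ennreal \<bar>c * f x\<bar> \<partial>lborel) < top"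
    using borel_loc_integrableD(2)[OF assms] by (simp add: ennreal_mult_less_top)
qed

lemma borel_loc_integrable_add:
  fixes f :: "'a::euclidean_space \<Rightarrow> real"
  assumes f: "borel_loc_integrable f" and g: "borel_loc_integrable g"
  shows "borel_loc_integrable (\<lambda>x. f x + g x)"
  unfolding borel_loc_integrable_def
proof (intro conjI allI)
  note [measurable] = borel_loc_integrableD(1)[OF f] borel_loc_integrableD(1)[OF g]
  show "(\<lambda>x. f x + g x) \<in> borel_measurable borel" by measurable
  fix R
  have "(\<integral>\<^sup>+ x. indicator (ball 0 R) x * ennreal \<bar>f x + g x\<bar> \<partial>lborel) \<le>
    (\<integral>\<^sup>+ x. indicator (ball 0 R) x * ennreal \<bar>f x\<bar> + indicator (ball 0 R) x * ennreal \<bar>g x\<bar> \<partial>lborel)"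
    by (intro nn_integral_mono) (auto simp: indicator_def intro!: ennreal_leI simp flip: ennreal_plus)
  also have "\<dots> = (\<integral>\<^sup>+ x. indicator (ball 0 R) x * ennreal \<bar>f x\<bar> \<partial>lborel) + (\<integral>\<^sup>+ x. indicator (ball 0 R) x * ennreal \<bar>g x\<bar> \<partial>lborel)"
    by (rule nn_integral_add) measurable
  also have "\<dots> < top"
    using borel_loc_integrableD(2)[OF f] borel_loc_integrableD(2)[OF g] by simp
  finally show "(\<integral>\<^sup>+ x. indicator (ball 0 R) x * ennreal \<bar>f x + g x\<bar> \<partial>lborel) < top" .
qed

lemma borel_loc_integrable_sum:
  fixes f :: "'i \<Rightarrow> 'a::euclidean_space \<Rightarrow> real"
  assumes "finite I" "\<And>i. i \<in> I \<Longrightarrow> borel_loc_integrable (f i)"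
  shows "borel_loc_integrable (\<lambda>x. \<Sum>i\<in>I. f i x)"
  using assms
proof (induction I rule: finite_induct)
  case empty
  then show ?case by (simp add: borel_loc_integrable_def)
next
  case (insert i I)
  then show ?case by (simp add: borel_loc_integrable_add)
qed

lemma nn_integral_ball_translate_le:
  fixes f :: "'a::euclidean_space \<Rightarrow> real"
  assumes [measurable]: "f \<in> borel_measurable borel" and a: "norm a \<le> s"
  shows "(\<integral>\<^sup>+ x. indicator (ball 0 R) x * ennreal \<bar>f (x + a)\<bar> \<partial>lborel) \<le> (\<integral>\<^sup>+ x. indicator (ball 0 (R + s)) x * ennreal \<bar>f x\<bar> \<partial>lborel)"
proof -
  have "(\<integral>\<^sup>+ x. indicator (ball 0 R) x * ennreal \<bar>f (x + a)\<bar> \<partial>lborel) \<le>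
    (\<integral>\<^sup>+ x. indicator (ball 0 (R + s)) (x + a) * ennreal \<bar>f (x + a)\<bar> \<partial>lborel)"
  proof (rule nn_integral_mono)
    fix x
    show "indicator (ball 0 R) x * ennreal \<bar>f (x + a)\<bar> \<le> indicator (ball 0 (R + s)) (x + a) * ennreal \<bar>f (x + a)\<bar>"
      using norm_triangle_ineq[of x a] a by (auto simp: indicator_def)
  qed
  also have "\<dots> = (\<integral>\<^sup>+ x. indicator (ball 0 (R + s)) x * ennreal \<bar>f x\<bar> \<partial>lborel)"
    by (rule nn_integral_shift_right) measurable
  finally show ?thesis .
qed

lemma borel_loc_integrable_translate:
  fixes f :: "'a::euclidean_space \<Rightarrow> real"
  assumes "borel_loc_integrable f"
  shows "borel_loc_integrable (\<lambda>x. f (x + a))"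
  unfolding borel_loc_integrable_def
proof (intro conjI allI)
  note [measurable] = borel_loc_integrableD(1)[OF assms]
  show "(\<lambda>x. f (x + a)) \<in> borel_measurable borel" by measurable
  fix R
  show "(\<integral>\<^sup>+ x. indicator (ball 0 R) x * ennreal \<bar>f (x + a)\<bar> \<partial>lborel) < top"
    by (rule le_less_trans[OF nn_integral_ball_translate_le[OF borel_loc_integrableD(1)[OF assms] order_refl]
      borel_loc_integrableD(2)[OF assms]])
qed

text \<open>On a segment where \<open>k\<close> is not integrable the value is \<open>0\<close> by
  convention, so the bound by the integral of \<open>\<bar>k\<bar>\<close> holds at every
  \<open>x\<close>.\<close>

definition segment_integral :: "'a::euclidean_space \<Rightarrow> ('a \<Rightarrow> real) \<Rightarrow> 'a \<Rightarrow> real" where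
  "segment_integral h k x = (LINT t|lborel. indicator {0..1} t * k (x + t *\<^sub>R h))"

lemma segment_integral_le:
  fixes k :: "'a::euclidean_space \<Rightarrow> real"
  assumes [measurable]: "k \<in> borel_measurable borel"
  shows "ennreal \<bar>segment_integral h k x\<bar> \<le> (\<integral>\<^sup>+ t. indicator {0..1} t * ennreal \<bar>k (x + t *\<^sub>R h)\<bar> \<partial>lborel)"
proof (cases "integrable lborel (\<lambda>t. indicator {0..1} t * k (x + t *\<^sub>R h))")
  case True
  have "ennreal (norm (segment_integral h k x)) \<le> (\<integral>\<^sup>+ t. ennreal (norm (indicator {0..1} t * k (x + t *\<^sub>R h))) \<partial>lborel)"
    unfolding segment_integral_def by (rule integral_norm_bound_ennreal[OF True])
  also have "\<dots> = (\<integral>\<^sup>+ t. indicator {0..1} t * ennreal \<bar>k (x + t *\<^sub>R h)\<bar> \<partial>lborel)"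
    by (intro nn_integral_cong) (auto simp: indicator_def)
  finally show ?thesis by simp
qed (simp add: segment_integral_def not_integrable_integral_eq)

lemma nn_integral_ball_segment_le:
  fixes k :: "'a::euclidean_space \<Rightarrow> real"
  assumes [measurable]: "k \<in> borel_measurable borel"
  shows "(\<integral>\<^sup>+ t. \<integral>\<^sup>+ x. indicator (ball 0 R) x * (indicator {0..1} t * ennreal \<bar>k (x + t *\<^sub>R h)\<bar>) \<partial>lborel \<partial>lborel) \<le>
    (\<integral>\<^sup>+ x. indicator (ball 0 (R + norm h)) x * ennreal \<bar>k x\<bar> \<partial>lborel)"
proof -
  let ?K = "\<integral>\<^sup>+ x. indicator (ball 0 (R + norm h)) x * ennreal \<bar>k x\<bar> \<partial>lborel"
  have "(\<integral>\<^sup>+ t. \<integral>\<^sup>+ x. indicator (ball 0 R) x * (indicator {0..1} t * ennreal \<bar>k (x + t *\<^sub>R h)\<bar>) \<partial>lborel \<partial>lborel) \<le>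
    (\<integral>\<^sup>+ t. ?K * indicator {0..1} (t::real) \<partial>lborel)"
  proof (rule nn_integral_mono)
    fix t :: real
    show "(\<integral>\<^sup>+ x. indicator (ball 0 R) x * (indicator {0..1} t * ennreal \<bar>k (x + t *\<^sub>R h)\<bar>) \<partial>lborel) \<le> ?K * indicator {0..1} t"
    proof (cases "t \<in> {0..1}")
      case True
      then have "norm (t *\<^sub>R h) \<le> norm h" by (simp add: mult_left_le_one_le)
      from nn_integral_ball_translate_le[OF assms this, of R] show ?thesis using True by simp
    qed simp
  qed
  also have "\<dots> = ?K" by (simp add: nn_integral_cmult_indicator)
  finally show ?thesis .
qed

lemma borel_loc_integrable_segment_integral:
  fixes k :: "'a::euclidean_space \<Rightarrow> real"
  assumes k: "borel_loc_integrable k"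
  shows "borel_loc_integrable (segment_integral h k)"
  unfolding borel_loc_integrable_def
proof (intro conjI allI)
  note [measurable] = borel_loc_integrableD(1)[OF k]
  show [measurable]: "segment_integral h k \<in> borel_measurable borel"
  proof -
    have "(\<lambda>x. LINT t|lborel. indicator {0..1} t * k (x + t *\<^sub>R h)) \<in> borel_measurable borel"
      by measurable
    then show ?thesis by (simp add: segment_integral_def[abs_def])
  qed
  fix R
  have "(\<integral>\<^sup>+ x. indicator (ball 0 R) x * ennreal \<bar>segment_integral h k x\<bar> \<partial>lborel) \<le>
    (\<integral>\<^sup>+ x. indicator (ball 0 R) x * (\<integral>\<^sup>+ t. indicator {0..1} t * ennreal \<bar>k (x + t *\<^sub>R h)\<bar> \<partial>lborel) \<partial>lborel)"
    by (intro nn_integral_mono mult_left_mono segment_integral_le) auto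
  also have "\<dots> = (\<integral>\<^sup>+ x. \<integral>\<^sup>+ t. indicator (ball 0 R) x * (indicator {0..1} t * ennreal \<bar>k (x + t *\<^sub>R h)\<bar>) \<partial>lborel \<partial>lborel)"
    by (intro nn_integral_cong nn_integral_cmult[symmetric]) measurable
  also have "\<dots> = (\<integral>\<^sup>+ t. \<integral>\<^sup>+ x. indicator (ball 0 R) x * (indicator {0..1} t * ennreal \<bar>k (x + t *\<^sub>R h)\<bar>) \<partial>lborel \<partial>lborel)"
    by (rule lborel_pair.Fubini'[symmetric]) measurable
  also have "\<dots> < top"
    by (rule le_less_trans[OF nn_integral_ball_segment_le[OF borel_loc_integrableD(1)[OF k]] borel_loc_integrableD(2)[OF k]])
  finally show "(\<integral>\<^sup>+ x. indicator (ball 0 R) x * ennreal \<bar>segment_integral h k x\<bar> \<partial>lborel) < top" .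
qed

text \<open>Fubini applies because segments that start in the support of \<open>\<phi>\<close> stay
  in a ball enlarged by \<open>norm h\<close>, on which \<open>k\<close> is integrable.\<close>

lemma integral_segment_integral:
  fixes k :: "'a::euclidean_space \<Rightarrow> real"
  assumes k: "borel_loc_integrable k" and \<phi> [measurable]: "\<phi> \<in> borel_measurable borel"
    and B: "\<And>x. \<bar>\<phi> x\<bar> \<le> B" and R: "\<And>x. R \<le> norm x \<Longrightarrow> \<phi> x = 0"
  shows "(LINT t|lborel. indicator {0..1} t * (LINT x|lborel. k (x + t *\<^sub>R h) * \<phi> x)) = (LINT x|lborel. segment_integral h k x * \<phi> x)"
proof -
  note [measurable] = borel_loc_integrableD(1)[OF k]
  let ?F = "\<lambda>x t. indicator {0..1} t * k (x + t *\<^sub>R h) * \<phi> x"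
  have B0: "0 \<le> B" using B[of 0] by linarith
  have "integrable (lborel \<Otimes>\<^sub>M lborel) (\<lambda>(x, t). ?F x t)"
  proof (rule lborel_pair_integrableI)
    have "(\<integral>\<^sup>+ t. \<integral>\<^sup>+ x. ennreal \<bar>?F x t\<bar> \<partial>lborel \<partial>lborel) \<le>
      (\<integral>\<^sup>+ t. \<integral>\<^sup>+ x. ennreal B * (indicator (ball 0 R) x * (indicator {0..1} t * ennreal \<bar>k (x + t *\<^sub>R h)\<bar>)) \<partial>lborel \<partial>lborel)"
    proof (intro nn_integral_mono)
      fix t :: real and x :: 'a
      show "ennreal \<bar>?F x t\<bar> \<le> ennreal B * (indicator (ball 0 R) x * (indicator {0..1} t * ennreal \<bar>k (x + t *\<^sub>R h)\<bar>))"
      proof (cases "R \<le> norm x \<or> t \<notin> {0..1}")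
        case False
        have "\<bar>k (x + t *\<^sub>R h) * \<phi> x\<bar> \<le> B * \<bar>k (x + t *\<^sub>R h)\<bar>"
          using B[of x] mult_left_mono[of "\<bar>\<phi> x\<bar>" B "\<bar>k (x + t *\<^sub>R h)\<bar>"] by (simp add: abs_mult mult.commute)
        then have "ennreal \<bar>k (x + t *\<^sub>R h) * \<phi> x\<bar> \<le> ennreal B * ennreal \<bar>k (x + t *\<^sub>R h)\<bar>"
          using B0 by (simp add: ennreal_leI flip: ennreal_mult)
        then show ?thesis using False by simp
      qed (use R in auto)
    qed
    also have "\<dots> = ennreal B * (\<integral>\<^sup>+ t. \<integral>\<^sup>+ x. indicator (ball 0 R) x * (indicator {0..1} t * ennreal \<bar>k (x + t *\<^sub>R h)\<bar>) \<partial>lborel \<partial>lborel)"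
      by (rule nn_integral_cmult_iterated) measurable
    also have "\<dots> < top"
      using le_less_trans[OF nn_integral_ball_segment_le[OF borel_loc_integrableD(1)[OF k], of R h] borel_loc_integrableD(2)[OF k]]
      by (simp add: ennreal_mult_less_top)
    finally show "(\<integral>\<^sup>+ t. \<integral>\<^sup>+ x. ennreal \<bar>(\<lambda>(x, t). ?F x t) (x, t)\<bar> \<partial>lborel \<partial>lborel) < top" by simp
  qed measurable
  from lborel_pair.Fubini_integral[OF this]
  have "(LINT t|lborel. LINT x|lborel. ?F x t) = (LINT x|lborel. LINT t|lborel. ?F x t)" .
  moreover have "(LINT t|lborel. ?F x t) = segment_integral h k x * \<phi> x" for x
    by (simp add: segment_integral_def)
  moreover have "(LINT x|lborel. ?F x t) = indicator {0..1} t * (LINT x|lborel. k (x + t *\<^sub>R h) * \<phi> x)" for t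
    by (simp add: mult.assoc)
  ultimately show ?thesis by (simp only:)
qed

text \<open>The weak equation is tested with every translate of \<open>\<phi>\<close> by
  \<open>t *\<^sub>R h\<close> and integrated over \<open>t\<close>. On the side of \<open>v\<close>
  the fundamental theorem along the segment collapses the integral to a difference of two values of
  \<open>\<phi>\<close>.\<close>

lemma weak_derivative_difference:
  fixes v k :: "real ^ 'n \<Rightarrow> real"
  assumes v: "borel_loc_integrable v" and k: "borel_loc_integrable k"
    and weak: "\<And>\<phi>. test_function \<phi> \<Longrightarrow>
      (LINT x|lborel. v x * (\<Sum>i\<in>UNIV. h $ i * partial_deriv i \<phi> x)) = - (LINT x|lborel. k x * \<phi> x)"
    and \<phi>: "test_function \<phi>"
  shows "(LINT x|lborel. v x * (\<phi> (x - h) - \<phi> x)) = (LINT t|lborel. indicator {0..1} t * (LINT x|lborel. k x * \<phi> (x - t *\<^sub>R h)))"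
proof -
  define d where "d = (\<lambda>x. \<Sum>i\<in>UNIV. h $ i * partial_deriv i \<phi> x)"
  obtain R where R: "\<And>x. R \<le> norm x \<Longrightarrow> \<phi> x = 0" "\<And>x i. R \<le> norm x \<Longrightarrow> partial_deriv i \<phi> x = 0"
    using test_function_support[OF \<phi>] by metis
  have d_cont: "continuous_on UNIV d"
    unfolding d_def by (intro continuous_intros test_function_continuous(2)[OF \<phi>])
  have d0: "d x = 0" if "R \<le> norm x" for x
    using R(2)[OF that] by (simp add: d_def)
  obtain B where B: "0 \<le> B" "\<And>x. \<bar>d x\<bar> \<le> B"
    using continuous_compact_support_bounded[OF d_cont d0] by metis
  note [measurable] = borel_loc_integrableD(1)[OF v] borel_measurable_continuous_onI[OF d_cont]
  let ?F = "\<lambda>x t. v x * (d (x - t *\<^sub>R h) * indicator {0..1} t)"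
  have "integrable (lborel \<Otimes>\<^sub>M lborel) (\<lambda>(x, t). ?F x t)"
  proof (rule lborel_pair_integrableI)
    have "(\<integral>\<^sup>+ t. \<integral>\<^sup>+ x. ennreal \<bar>?F x t\<bar> \<partial>lborel \<partial>lborel) \<le>
      (\<integral>\<^sup>+ t. \<integral>\<^sup>+ x. ennreal B * indicator {0..1} (t::real) * (indicator (ball 0 (R + norm h)) x * ennreal \<bar>v x\<bar>) \<partial>lborel \<partial>lborel)"
    proof (intro nn_integral_mono)
      fix t :: real and x
      show "ennreal \<bar>?F x t\<bar> \<le> ennreal B * indicator {0..1} t * (indicator (ball 0 (R + norm h)) x * ennreal \<bar>v x\<bar>)"
      proof (cases "t \<in> {0..1} \<and> norm x < R + norm h")
        case True
        have "\<bar>v x * d (x - t *\<^sub>R h)\<bar> \<le> B * \<bar>v x\<bar>"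
          using B(2)[of "x - t *\<^sub>R h"] mult_left_mono[of "\<bar>d (x - t *\<^sub>R h)\<bar>" B "\<bar>v x\<bar>"] by (simp add: abs_mult mult.commute)
        then have "ennreal \<bar>v x * d (x - t *\<^sub>R h)\<bar> \<le> ennreal B * ennreal \<bar>v x\<bar>"
          using B(1) by (simp add: ennreal_leI flip: ennreal_mult)
        then show ?thesis using True by simp
      next
        case False
        have "R \<le> norm (x - t *\<^sub>R h)" if t: "t \<in> {0..1}"
        proof -
          have "norm (t *\<^sub>R h) \<le> norm h" using t by (simp add: mult_left_le_one_le)
          then show ?thesis using False t norm_triangle_ineq2[of x "t *\<^sub>R h"] by auto
        qed
        then have zero: "?F x t = 0" using d0 by (auto simp: indicator_def)
        show ?thesis unfolding zero by simp
      qed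
    qed
    also have "\<dots> = (\<integral>\<^sup>+ t. ennreal B * (\<integral>\<^sup>+ x. indicator (ball 0 (R + norm h)) x * ennreal \<bar>v x\<bar> \<partial>lborel) * indicator {0..1} (t::real) \<partial>lborel)"
      by (intro nn_integral_cong, subst nn_integral_cmult) (measurable, simp only: mult_ac)
    also have "\<dots> = ennreal B * (\<integral>\<^sup>+ x. indicator (ball 0 (R + norm h)) x * ennreal \<bar>v x\<bar> \<partial>lborel)"
      by (simp add: nn_integral_cmult_indicator)
    also have "\<dots> < top"
      using borel_loc_integrableD(2)[OF v] by (simp add: ennreal_mult_less_top)
    finally show "(\<integral>\<^sup>+ t. \<integral>\<^sup>+ x. ennreal \<bar>(\<lambda>(x, t). ?F x t) (x, t)\<bar> \<partial>lborel \<partial>lborel) < top" by simp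
  qed measurable
  from lborel_pair.Fubini_integral[OF this]
  have swap: "(LINT t|lborel. LINT x|lborel. ?F x t) = (LINT x|lborel. LINT t|lborel. ?F x t)" .
  have inner_t: "(LINT t|lborel. ?F x t) = v x * (\<phi> x - \<phi> (x - h))" for x
    using test_function_FTC[OF \<phi>, of h x] by (simp add: d_def)
  have inner_x: "(LINT x|lborel. ?F x t) = - (indicator {0..1} t * (LINT x|lborel. k x * \<phi> (x - t *\<^sub>R h)))" for t
  proof -
    have "d (x - t *\<^sub>R h) = (\<Sum>i\<in>UNIV. h $ i * partial_deriv i (\<lambda>x. \<phi> (x - t *\<^sub>R h)) x)" for x
      by (simp add: d_def partial_deriv_translate[OF test_function_differentiable(1)[OF \<phi>]])
    then have "(LINT x|lborel. v x * d (x - t *\<^sub>R h)) = - (LINT x|lborel. k x * \<phi> (x - t *\<^sub>R h))"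
      using weak[OF test_function_translate[OF \<phi>, of "t *\<^sub>R h"]] by simp
    moreover have "(LINT x|lborel. ?F x t) = indicator {0..1} t * (LINT x|lborel. v x * d (x - t *\<^sub>R h))"
      by (simp flip: mult.assoc)
    ultimately show ?thesis by simp
  qed
  have "(LINT x|lborel. v x * (\<phi> (x - h) - \<phi> x)) = (LINT x|lborel. - (v x * (\<phi> x - \<phi> (x - h))))"
    by (intro Bochner_Integration.integral_cong) (auto simp: algebra_simps)
  also have "\<dots> = - (LINT x|lborel. v x * (\<phi> x - \<phi> (x - h)))" by simp
  also have "\<dots> = (LINT t|lborel. indicator {0..1} t * (LINT x|lborel. k x * \<phi> (x - t *\<^sub>R h)))"
    using swap unfolding inner_t inner_x by simp
  finally show ?thesis .
qed

text \<open>Once all shifts are moved from the test function to \<open>v\<close> and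
  \<open>k\<close>, the difference of the two sides is a locally integrable function that
  annihilates every test function.\<close>

lemma weak_derivative_segment:
  fixes v k :: "real ^ 'n \<Rightarrow> real"
  assumes v: "borel_loc_integrable v" and k: "borel_loc_integrable k"
    and weak: "\<And>\<phi>. test_function \<phi> \<Longrightarrow>
      (LINT x|lborel. v x * (\<Sum>i\<in>UNIV. h $ i * partial_deriv i \<phi> x)) = - (LINT x|lborel. k x * \<phi> x)"
  shows "AE x in lborel. v (x + h) - v x = segment_integral h k x"
proof -
  let ?f = "\<lambda>x. v (x + h) + (- 1 * v x + - 1 * segment_integral h k x)"
  have f: "borel_loc_integrable ?f"
    by (intro borel_loc_integrable_add borel_loc_integrable_cmult borel_loc_integrable_translate
      borel_loc_integrable_segment_integral v k)
  note [measurable] = borel_loc_integrableD(1)[OF v] borel_loc_integrableD(1)[OF k]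
  have "(LINT x|lborel. ?f x * \<phi> x) = 0" if \<phi>: "test_function \<phi>" for \<phi>
  proof -
    have [measurable]: "\<phi> \<in> borel_measurable borel"
      by (intro borel_measurable_continuous_onI test_function_continuous(1) \<phi>)
    obtain R where R: "\<And>x. R \<le> norm x \<Longrightarrow> \<phi> x = 0"
      using test_function_support[OF \<phi>] by metis
    obtain B where B: "\<And>x. \<bar>\<phi> x\<bar> \<le> B"
      using continuous_compact_support_bounded[OF test_function_continuous(1)[OF \<phi>] R] by metis
    note int = borel_loc_integrable_test_function(1)
    have 1: "integrable lborel (\<lambda>x. v (x + h) * \<phi> x)"
      by (rule int[OF borel_loc_integrable_translate[OF v] \<phi>])
    have 2: "integrable lborel (\<lambda>x. v x * \<phi> x)" by (rule int[OF v \<phi>])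
    have 3: "integrable lborel (\<lambda>x. segment_integral h k x * \<phi> x)"
      by (rule int[OF borel_loc_integrable_segment_integral[OF k] \<phi>])
    have 4: "integrable lborel (\<lambda>x. v x * \<phi> (x - h))"
      by (rule int[OF v test_function_translate[OF \<phi>]])
    have "(LINT x|lborel. segment_integral h k x * \<phi> x) = (LINT t|lborel. indicator {0..1} t * (LINT x|lborel. k (x + t *\<^sub>R h) * \<phi> x))"
      by (rule integral_segment_integral[OF k _ B R, symmetric]) measurable
    also have "(\<lambda>t. LINT x|lborel. k (x + t *\<^sub>R h) * \<phi> x) = (\<lambda>t. LINT x|lborel. k x * \<phi> (x - t *\<^sub>R h))"
    proof
      fix t
      show "(LINT x|lborel. k (x + t *\<^sub>R h) * \<phi> x) = (LINT x|lborel. k x * \<phi> (x - t *\<^sub>R h))"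
        using integral_lborel_shift[of "\<lambda>x. k x * \<phi> (x - t *\<^sub>R h)" "t *\<^sub>R h"] by simp
    qed
    also have "(LINT t|lborel. indicator {0..1} t * (LINT x|lborel. k x * \<phi> (x - t *\<^sub>R h))) = (LINT x|lborel. v x * (\<phi> (x - h) - \<phi> x))"
      by (rule weak_derivative_difference[OF v k weak \<phi>, symmetric])
    also have "\<dots> = (LINT x|lborel. v x * \<phi> (x - h)) - (LINT x|lborel. v x * \<phi> x)"
      using 2 4 by (simp add: right_diff_distrib)
    also have "(LINT x|lborel. v x * \<phi> (x - h)) = (LINT x|lborel. v (x + h) * \<phi> x)"
      using integral_lborel_shift[of "\<lambda>x. v x * \<phi> (x - h)" h] by simp
    finally have "(LINT x|lborel. v (x + h) * \<phi> x - v x * \<phi> x - segment_integral h k x * \<phi> x) = 0"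
      using 1 2 3 by simp
    then show ?thesis by (simp add: algebra_simps)
  qed
  note zero = integral_box_eq_0[OF f this]
  have "AE x in lborel. ?f x = 0"
    by (rule AE_eq_0_if_integral_box_eq_0[OF borel_loc_integrableD(1)[OF f] zero])
  then show ?thesis by eventually_elim simp
qed

lemma gradient_bound_weak:
  fixes v :: "real ^ 'n \<Rightarrow> real" and \<gamma> :: "'n \<Rightarrow> real ^ 'n \<Rightarrow> real"
  assumes v: "borel_loc_integrable v" and \<gamma>: "\<And>i. borel_loc_integrable (\<gamma> i)"
    and weak: "\<And>\<phi> i. test_function \<phi> \<Longrightarrow>
      (LINT x|lborel. v x * partial_deriv i \<phi> x) = - (LINT x|lborel. \<gamma> i x * \<phi> x)"
  shows "gradient_bound v (\<lambda>x. norm (\<chi> i. \<gamma> i x))"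
  unfolding gradient_bound_def
proof (intro conjI allI)
  note \<gamma>_m [measurable] = borel_loc_integrableD(1)[OF \<gamma>]
  show "v \<in> borel_measurable borel" by (rule borel_loc_integrableD(1)[OF v])
  show [measurable]: "(\<lambda>x. norm (\<chi> i. \<gamma> i x)) \<in> borel_measurable borel"
    unfolding norm_vec_def L2_set_def by simp
  fix h :: "real ^ 'n"
  define k where "k = (\<lambda>x. \<Sum>i\<in>UNIV. h $ i * \<gamma> i x)"
  have k: "borel_loc_integrable k"
    unfolding k_def by (intro borel_loc_integrable_sum borel_loc_integrable_cmult \<gamma>) auto
  note [measurable] = borel_loc_integrableD(1)[OF k]
  have "AE x in lborel. v (x + h) - v x = segment_integral h k x"
  proof (rule weak_derivative_segment[OF v k])
    fix \<phi> :: "real ^ 'n \<Rightarrow> real" assume \<phi>: "test_function \<phi>"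
    have "(LINT x|lborel. v x * (\<Sum>i\<in>UNIV. h $ i * partial_deriv i \<phi> x)) = (LINT x|lborel. (\<Sum>i\<in>UNIV. h $ i * (v x * partial_deriv i \<phi> x)))"
      by (simp add: sum_distrib_left mult_ac)
    also have "\<dots> = (\<Sum>i\<in>UNIV. h $ i * (LINT x|lborel. v x * partial_deriv i \<phi> x))"
      using borel_loc_integrable_test_function(2)[OF v \<phi>] by (subst Bochner_Integration.integral_sum) auto
    also have "\<dots> = - (\<Sum>i\<in>UNIV. h $ i * (LINT x|lborel. \<gamma> i x * \<phi> x))"
      using weak[OF \<phi>] by (simp add: sum_negf)
    also have "(\<Sum>i\<in>UNIV. h $ i * (LINT x|lborel. \<gamma> i x * \<phi> x)) = (LINT x|lborel. (\<Sum>i\<in>UNIV. h $ i * (\<gamma> i x * \<phi> x)))"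
      using borel_loc_integrable_test_function(1)[OF \<gamma> \<phi>] by (subst Bochner_Integration.integral_sum) auto
    also have "\<dots> = (LINT x|lborel. k x * \<phi> x)"
      unfolding k_def sum_distrib_right by (simp only: mult.assoc)
    finally show "(LINT x|lborel. v x * (\<Sum>i\<in>UNIV. h $ i * partial_deriv i \<phi> x)) = - (LINT x|lborel. k x * \<phi> x)" .
  qed
  then show "AE z in lborel. ennreal \<bar>v z - v (z + h)\<bar> \<le>
      ennreal (norm h) * (\<integral>\<^sup>+ t. indicator {0..1} t * ennreal (norm (\<chi> i. \<gamma> i (z + t *\<^sub>R h))) \<partial>lborel)"
  proof eventually_elim
    case (elim z)
    have "ennreal \<bar>v z - v (z + h)\<bar> = ennreal \<bar>segment_integral h k z\<bar>"
      using elim by (simp add: abs_minus_commute)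
    also have "\<dots> \<le> (\<integral>\<^sup>+ t. indicator {0..1} t * ennreal \<bar>k (z + t *\<^sub>R h)\<bar> \<partial>lborel)"
      by (rule segment_integral_le) measurable
    also have "\<dots> \<le> (\<integral>\<^sup>+ t. ennreal (norm h) * (indicator {0..1} t * ennreal (norm (\<chi> i. \<gamma> i (z + t *\<^sub>R h)))) \<partial>lborel)"
    proof (rule nn_integral_mono)
      fix t :: real
      have "\<bar>k y\<bar> \<le> norm h * norm (\<chi> i. \<gamma> i y)" for y
        using Cauchy_Schwarz_ineq2[of h "\<chi> i. \<gamma> i y"] by (simp add: inner_vec_def k_def)
      then have "ennreal \<bar>k (z + t *\<^sub>R h)\<bar> \<le> ennreal (norm h) * ennreal (norm (\<chi> i. \<gamma> i (z + t *\<^sub>R h)))"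
        by (simp add: ennreal_leI flip: ennreal_mult)
      then show "indicator {0..1} t * ennreal \<bar>k (z + t *\<^sub>R h)\<bar> \<le> ennreal (norm h) * (indicator {0..1} t * ennreal (norm (\<chi> i. \<gamma> i (z + t *\<^sub>R h))))"
        by (auto simp: indicator_def)
    qed
    also have "\<dots> = ennreal (norm h) * (\<integral>\<^sup>+ t. indicator {0..1} t * ennreal (norm (\<chi> i. \<gamma> i (z + t *\<^sub>R h))) \<partial>lborel)"
    proof (rule nn_integral_cmult)
      have "(\<lambda>t. norm (\<chi> i. \<gamma> i (z + t *\<^sub>R h))) \<in> borel_measurable lborel"
        using measurable_compose[of "\<lambda>t. z + t *\<^sub>R h" lborel borel "\<lambda>x. norm (\<chi> i. \<gamma> i x)" borel] by measurable
      then show "(\<lambda>t. indicator {0..1} t * ennreal (norm (\<chi> i. \<gamma> i (z + t *\<^sub>R h)))) \<in> borel_measurable lborel"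
        by measurable
    qed
    finally show ?case .
  qed
qed simp

lemma locally_integrable_borel:
  fixes u v :: "real ^ 'n \<Rightarrow> real"
  assumes u: "locally_integrable u" and v [measurable]: "v \<in> borel_measurable borel" and eq: "AE x in lborel. u x = v x"
  shows "borel_loc_integrable v"
  unfolding borel_loc_integrable_def
proof (intro conjI allI v)
  fix R
  have int: "integrable lebesgue (\<lambda>x. indicator (cball 0 R) x *\<^sub>R u x)"
    using u by (simp add: locally_integrable_def set_integrable_def)
  have "(\<integral>\<^sup>+ x. indicator (ball 0 R) x * ennreal \<bar>v x\<bar> \<partial>lborel) \<le> (\<integral>\<^sup>+ x. ennreal (norm (indicator (cball 0 R) x *\<^sub>R u x)) \<partial>lborel)"
    using eq by (intro nn_integral_mono_AE, eventually_elim) (auto simp: indicator_def)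
  also have "\<dots> = (\<integral>\<^sup>+ x. ennreal (norm (indicator (cball 0 R) x *\<^sub>R u x)) \<partial>lebesgue)"
    by (rule nn_integral_completion[symmetric])
  also have "\<dots> < top"
    using int by (simp add: integrable_iff_bounded)
  finally show "(\<integral>\<^sup>+ x. indicator (ball 0 R) x * ennreal \<bar>v x\<bar> \<partial>lborel) < top" .
qed

lemma locally_integrable_measurable:
  fixes G :: "real ^ 'n \<Rightarrow> 'b::euclidean_space"
  assumes "locally_integrable G"
  shows "G \<in> borel_measurable lebesgue"
proof (rule borel_measurable_LIMSEQ_metric)
  show "(\<lambda>x. indicator (cball 0 (real k)) x *\<^sub>R G x) \<in> borel_measurable lebesgue" for k
    using assms by (intro borel_measurable_integrable) (simp add: locally_integrable_def set_integrable_def)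
  fix x :: "real ^ 'n"
  obtain K where K: "norm x \<le> real K" using real_arch_simple by blast
  have "eventually (\<lambda>k. indicator (cball 0 (real k)) x *\<^sub>R G x = G x) sequentially"
    using eventually_ge_at_top[of K] by eventually_elim (use K in \<open>auto simp: indicator_def\<close>)
  then show "(\<lambda>k. indicator (cball 0 (real k)) x *\<^sub>R G x) \<longlonglongrightarrow> G x"
    by (rule tendsto_eventually)
qed

lemma lebesgue_integral_eq_lborel:
  fixes u v :: "'a::euclidean_space \<Rightarrow> real"
  assumes [measurable]: "u \<in> borel_measurable lebesgue" "v \<in> borel_measurable borel" and eq: "AE x in lborel. u x = v x"
  shows "(LINT x|lebesgue. u x) = (LINT x|lborel. v x)"
proof -
  have [measurable]: "v \<in> borel_measurable lebesgue" by (simp add: measurable_completion)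
  have "(LINT x|lebesgue. u x) = (LINT x|lebesgue. v x)"
    using AE_completion[OF eq] by (intro integral_cong_AE) auto
  also have "\<dots> = (LINT x|lborel. v x)"
    by (rule integral_completion) simp
  finally show ?thesis .
qed

text \<open>Borel representatives are taken for each component of \<open>G\<close>; the finitely
  many exceptional null sets are then united to recover the Euclidean norm.\<close>

theorem weak_gradient_bound:
  fixes u v :: "real ^ 'n \<Rightarrow> real" and G :: "real ^ 'n \<Rightarrow> real ^ 'n"
  assumes u [measurable]: "u \<in> borel_measurable lebesgue" and G: "is_weak_gradient u G"
    and v [measurable]: "v \<in> borel_measurable borel" and eq: "AE x in lborel. u x = v x"
  shows "\<exists>g. gradient_bound v g \<and> (AE x in lborel. norm (G x) = g x)"
proof -
  have Gl: "locally_integrable G" and ul: "locally_integrable u"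
    and weak: "\<And>\<phi> i. test_function \<phi> \<Longrightarrow> (LINT x|lebesgue. u x * partial_deriv i \<phi> x) = - (LINT x|lebesgue. G x $ i * \<phi> x)"
    using G by (auto simp: is_weak_gradient_def)
  have Gm [measurable]: "G \<in> borel_measurable lebesgue" by (rule locally_integrable_measurable[OF Gl])
  have Gi [measurable]: "(\<lambda>x. G x $ i) \<in> borel_measurable lebesgue" for i
    by (rule measurable_compose[OF Gm]) (intro borel_measurable_continuous_onI continuous_intros)
  have "\<exists>g. g \<in> borel_measurable borel \<and> (AE x in lborel. G x $ i = g x)" for i
    using completion_ex_borel_measurable_real[OF Gi, of i] by auto
  then obtain \<gamma> where \<gamma>: "\<And>i. \<gamma> i \<in> borel_measurable borel" "\<And>i. AE x in lborel. G x $ i = \<gamma> i x"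
    by metis
  note [measurable] = \<gamma>(1)
  have Gil: "locally_integrable (\<lambda>x. G x $ i)" for i
    unfolding locally_integrable_def set_integrable_def
  proof (intro allI impI)
    fix K :: "(real ^ 'n) set" assume "compact K"
    then have "integrable lebesgue (\<lambda>x. indicator K x *\<^sub>R G x)"
      using Gl by (simp add: locally_integrable_def set_integrable_def)
    from integrable_bounded_linear[OF bounded_linear_vec_nth this, of i]
    show "integrable lebesgue (\<lambda>x. indicator K x *\<^sub>R G x $ i)" by simp
  qed
  have "gradient_bound v (\<lambda>x. norm (\<chi> i. \<gamma> i x))"
  proof (rule gradient_bound_weak)
    show "borel_loc_integrable v" by (rule locally_integrable_borel[OF ul v eq])
    show "borel_loc_integrable (\<gamma> i)" for i by (rule locally_integrable_borel[OF Gil \<gamma>])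
    fix \<phi> :: "real ^ 'n \<Rightarrow> real" and i assume \<phi>: "test_function \<phi>"
    have [measurable]: "\<phi> \<in> borel_measurable borel" "partial_deriv i \<phi> \<in> borel_measurable borel"
      by (intro borel_measurable_continuous_onI test_function_continuous \<phi>)+
    have [measurable]: "\<phi> \<in> borel_measurable lebesgue" "partial_deriv i \<phi> \<in> borel_measurable lebesgue"
      by (simp_all add: measurable_completion)
    have "(LINT x|lborel. v x * partial_deriv i \<phi> x) = (LINT x|lebesgue. u x * partial_deriv i \<phi> x)"
    proof (rule lebesgue_integral_eq_lborel[symmetric])
      show "AE x in lborel. u x * partial_deriv i \<phi> x = v x * partial_deriv i \<phi> x"
        using eq by eventually_elim simp
    qed measurable
    also have "\<dots> = - (LINT x|lebesgue. G x $ i * \<phi> x)" by (rule weak[OF \<phi>])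
    also have "(LINT x|lebesgue. G x $ i * \<phi> x) = (LINT x|lborel. \<gamma> i x * \<phi> x)"
    proof (rule lebesgue_integral_eq_lborel)
      show "AE x in lborel. G x $ i * \<phi> x = \<gamma> i x * \<phi> x"
        using \<gamma>(2)[of i] by eventually_elim simp
    qed measurable
    finally show "(LINT x|lborel. v x * partial_deriv i \<phi> x) = - (LINT x|lborel. \<gamma> i x * \<phi> x)" .
  qed
  moreover have "AE x in lborel. norm (G x) = norm (\<chi> i. \<gamma> i x)"
  proof -
    have "AE x in lborel. \<forall>i\<in>UNIV. G x $ i = \<gamma> i x"
      using \<gamma>(2) by (intro AE_finite_allI) auto
    then show ?thesis
    proof eventually_elim
      case (elim x)
      then have "(\<chi> i. \<gamma> i x) = G x" by (simp add: vec_eq_iff)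
      then show ?case by simp
    qed
  qed
  ultimately show ?thesis by blast
qed

subsection \<open>The seminorms in terms of Borel representatives\<close>

lemma sigma_finite_lebesgue: "sigma_finite_measure (lebesgue :: 'a::euclidean_space measure)"
proof
  obtain A :: "'a set set" where A: "countable A" "A \<subseteq> sets lborel" "\<Union>A = space lborel" "\<forall>a\<in>A. emeasure lborel a \<noteq> \<infinity>"
    using lborel.sigma_finite_countable by auto
  then show "\<exists>A. countable A \<and> A \<subseteq> sets lebesgue \<and> \<Union>A = space lebesgue \<and> (\<forall>a\<in>A. emeasure (lebesgue :: 'a measure) a \<noteq> \<infinity>)"
    by (intro exI[of _ A]) (auto simp: subset_eq)
qed

text \<open>A product of completed measures is not the completion of the product. The passage to
  \<open>lborel\<close> is therefore made in the iterated integral, one variable at a time.\<close>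

lemma nn_integral_lebesgue_pair:
  fixes F :: "'a::euclidean_space \<times> 'b::euclidean_space \<Rightarrow> ennreal"
  assumes "F \<in> borel_measurable (lebesgue \<Otimes>\<^sub>M lebesgue)"
  shows "(\<integral>\<^sup>+ z. F z \<partial>(lebesgue \<Otimes>\<^sub>M lebesgue)) = (\<integral>\<^sup>+ x. \<integral>\<^sup>+ y. F (x, y) \<partial>lborel \<partial>lborel)"
proof -
  interpret sigma_finite_measure "lebesgue :: 'b measure" by (rule sigma_finite_lebesgue)
  show ?thesis
    by (subst nn_integral_fst[OF assms, symmetric]) (simp add: nn_integral_completion)
qed

lemma borel_measurable_lebesgue_pair:
  fixes u :: "'a::euclidean_space \<Rightarrow> 'b::topological_space"
  assumes "u \<in> borel_measurable lebesgue"
  shows "(\<lambda>z. u (fst z)) \<in> borel_measurable (lebesgue \<Otimes>\<^sub>M lebesgue)"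
    "(\<lambda>z. u (snd z)) \<in> borel_measurable (lebesgue \<Otimes>\<^sub>M lebesgue)"
  by (rule measurable_compose[OF measurable_fst assms], rule measurable_compose[OF measurable_snd assms])

lemma nn_integral_AE_eq2:
  fixes u v :: "'a::euclidean_space \<Rightarrow> 'b"
  assumes eq: "AE x in lborel. u x = v x"
  shows "(\<integral>\<^sup>+ x. \<integral>\<^sup>+ y. f x y (u x) (u y) \<partial>lborel \<partial>lborel) = (\<integral>\<^sup>+ x. \<integral>\<^sup>+ y. f x y (v x) (v y) \<partial>lborel \<partial>lborel)"
proof -
  have inner: "(\<integral>\<^sup>+ y. f x y (v x) (u y) \<partial>lborel) = (\<integral>\<^sup>+ y. f x y (v x) (v y) \<partial>lborel)" for x
    using eq by (intro nn_integral_cong_AE, eventually_elim) simp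
  show ?thesis
    using eq by (intro nn_integral_cong_AE, eventually_elim) (simp add: inner)
qed

lemma Lp_norm_eq:
  fixes u :: "real ^ 'n \<Rightarrow> 'b::real_normed_vector"
  assumes "AE x in lborel. norm (u x) = g x"
  shows "Lp_norm p u = (\<integral>\<^sup>+ x. ennreal (g x powr p) \<partial>lborel) epowr (1 / p)"
proof -
  have "(\<integral>\<^sup>+ x. ennreal (norm (u x) powr p) \<partial>lborel) = (\<integral>\<^sup>+ x. ennreal (g x powr p) \<partial>lborel)"
    using assms by (intro nn_integral_cong_AE, eventually_elim) simp
  then show ?thesis by (simp add: Lp_norm_def nn_integral_completion)
qed

lemma gagliardo_seminorm_eq:
  fixes u v :: "real ^ 'n \<Rightarrow> real"
  assumes u: "u \<in> borel_measurable lebesgue" and eq: "AE x in lborel. u x = v x"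
    and sp: "s * p = real CARD('n)"
  shows "gagliardo_seminorm s p u = (ennreal (sobolev_const (real CARD('n)) s p) * gag_energy p v) epowr (1 / p)"
proof -
  have id: "(\<lambda>x. x) \<in> measurable lebesgue (borel :: (real ^ 'n) measure)"
    by (simp add: measurable_completion)
  let ?f = "\<lambda>x y a b. ennreal (\<bar>a - b\<bar> powr p / norm (x - y :: real ^ 'n) powr (real CARD('n) + s * p))"
  have "(\<integral>\<^sup>+ (x, y). ?f x y (u x) (u y) \<partial>(lebesgue \<Otimes>\<^sub>M lebesgue)) = (\<integral>\<^sup>+ x. \<integral>\<^sup>+ y. ?f x y (u x) (u y) \<partial>lborel \<partial>lborel)"
  proof -
    have "(\<lambda>z. \<bar>u (fst z) - u (snd z)\<bar> powr p / norm (fst z - snd z :: real ^ 'n) powr (real CARD('n) + s * p))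
      \<in> borel_measurable (lebesgue \<Otimes>\<^sub>M lebesgue)"
      by (intro borel_measurable_divide powr_real_measurable borel_measurable_abs borel_measurable_diff
        measurable_compose[OF borel_measurable_diff borel_measurable_norm] borel_measurable_const
        borel_measurable_lebesgue_pair[OF u] borel_measurable_lebesgue_pair[OF id])
    then show ?thesis
      unfolding case_prod_beta by (subst nn_integral_lebesgue_pair) simp_all
  qed
  also have "\<dots> = (\<integral>\<^sup>+ x. \<integral>\<^sup>+ y. ?f x y (v x) (v y) \<partial>lborel \<partial>lborel)"
    by (rule nn_integral_AE_eq2[OF eq])
  also have "\<dots> = gag_energy p v"
    unfolding gag_energy_def
  proof (intro nn_integral_cong)
    fix x y :: "real ^ 'n"
    show "?f x y (v x) (v y) = ennreal (\<bar>v x - v y\<bar> powr p) * ennreal (norm (x - y) powr (- 2 * real DIM(real ^ 'n)))"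
      unfolding sp by (simp add: powr_minus divide_inverse flip: ennreal_mult)
  qed
  finally show ?thesis by (simp add: gagliardo_seminorm_def)
qed

text \<open>On each ball the BMO functional of \<open>u\<close> equals \<open>osc v x r\<close>,
  because changing \<open>u\<close> on a null set does not affect the iterated integral.\<close>

lemma bmo_norm_le:
  fixes u v :: "real ^ 'n \<Rightarrow> real"
  assumes u: "u \<in> borel_measurable lebesgue" and [measurable]: "v \<in> borel_measurable borel" and eq: "AE x in lborel. u x = v x"
    and A: "\<And>x r. osc v x r \<le> A"
  shows "bmo_norm u \<le> A"
  unfolding bmo_norm_def
proof (intro SUP_least)
  fix x :: "real ^ 'n" and r :: real assume "r \<in> {0<..}"
  then have r: "0 < r" by simp
  let ?B = "ball x r"
  let ?c = "inverse (unit_ball_vol (real DIM(real ^ 'n)) * r ^ DIM(real ^ 'n))"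
  have [measurable]: "?B \<in> sets lebesgue" by simp
  define I :: "real ^ 'n \<Rightarrow> ennreal" where "I = indicator ?B"
  have I: "I \<in> borel_measurable lebesgue" and [measurable]: "I \<in> borel_measurable borel"
    by (simp_all add: I_def)
  let ?f = "\<lambda>y z a b. ennreal \<bar>a - b\<bar> * I y * I z"
  have "(\<integral>\<^sup>+ (y, z) \<in> ?B \<times> ?B. ennreal \<bar>u y - u z\<bar> \<partial>(lebesgue \<Otimes>\<^sub>M lebesgue)) =
    (\<integral>\<^sup>+ (y, z). ?f y z (u y) (u z) \<partial>(lebesgue \<Otimes>\<^sub>M lebesgue))"
    by (intro nn_integral_cong) (auto simp: I_def indicator_def)
  also have "\<dots> = (\<integral>\<^sup>+ y. \<integral>\<^sup>+ z. ?f y z (u y) (u z) \<partial>lborel \<partial>lborel)"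
    unfolding case_prod_beta
    by (subst nn_integral_lebesgue_pair)
       (intro measurable_compose[OF _ measurable_ennreal] borel_measurable_times_ennreal borel_measurable_abs
         borel_measurable_diff borel_measurable_lebesgue_pair u I, simp)
  also have "\<dots> = (\<integral>\<^sup>+ y. \<integral>\<^sup>+ z. ?f y z (v y) (v z) \<partial>lborel \<partial>lborel)"
    by (rule nn_integral_AE_eq2[OF eq])
  also have "\<dots> = (\<integral>\<^sup>+ y. I y * (\<integral>\<^sup>+ z. I z * ennreal \<bar>v y - v z\<bar> \<partial>lborel) \<partial>lborel)"
    by (intro nn_integral_cong, subst nn_integral_cmult[symmetric]) (measurable, simp only: mult_ac)
  finally have "(\<integral>\<^sup>+ (y, z) \<in> ?B \<times> ?B. ennreal \<bar>u y - u z\<bar> \<partial>(lebesgue \<Otimes>\<^sub>M lebesgue)) =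
    (\<integral>\<^sup>+ y. I y * (\<integral>\<^sup>+ z. I z * ennreal \<bar>v y - v z\<bar> \<partial>lborel) \<partial>lborel)" .
  moreover have "osc v x r = ennreal ?c * (ennreal ?c * (\<integral>\<^sup>+ y. I y * (\<integral>\<^sup>+ z. I z * ennreal \<bar>v y - v z\<bar> \<partial>lborel) \<partial>lborel))"
  proof -
    have "osc v x r = ennreal ?c * (\<integral>\<^sup>+ y. ennreal ?c * (I y * (\<integral>\<^sup>+ z. I z * ennreal \<bar>v y - v z\<bar> \<partial>lborel)) \<partial>lborel)"
      unfolding osc_def ball_avg_def I_def[symmetric] by (simp only: mult.left_commute)
    also have "(\<integral>\<^sup>+ y. ennreal ?c * (I y * (\<integral>\<^sup>+ z. I z * ennreal \<bar>v y - v z\<bar> \<partial>lborel)) \<partial>lborel) =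
      ennreal ?c * (\<integral>\<^sup>+ y. I y * (\<integral>\<^sup>+ z. I z * ennreal \<bar>v y - v z\<bar> \<partial>lborel) \<partial>lborel)"
      by (rule nn_integral_cmult) measurable
    finally show ?thesis .
  qed
  moreover have "1 / (measure lebesgue ?B)\<^sup>2 = ?c * ?c"
  proof -
    have "measure lebesgue ?B = unit_ball_vol (real DIM(real ^ 'n)) * r ^ DIM(real ^ 'n)"
      using content_ball[of r x] r by simp
    then show ?thesis by (simp add: power2_eq_square inverse_eq_divide)
  qed
  moreover have "ennreal (?c * ?c) = ennreal ?c * ennreal ?c"
    using r by (intro ennreal_mult) auto
  ultimately have "ennreal (1 / (measure lebesgue ?B)\<^sup>2) * (\<integral>\<^sup>+ (y, z) \<in> ?B \<times> ?B. ennreal \<bar>u y - u z\<bar> \<partial>(lebesgue \<Otimes>\<^sub>M lebesgue)) = osc v x r"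
    by (simp only: mult.assoc)
  then show "ennreal (1 / (measure lebesgue ?B)\<^sup>2) * (\<integral>\<^sup>+ (y, z) \<in> ?B \<times> ?B. ennreal \<bar>u y - u z\<bar> \<partial>(lebesgue \<Otimes>\<^sub>M lebesgue)) \<le> A"
    using A by simp
qed

section \<open>The constants and the two inequalities for Sobolev norms\<close>

lemma sobolev_const_pos:
  assumes "0 < s" "s < 1" "1 \<le> p" "s * p = real CARD('n::finite)"
  shows "0 < sobolev_const (real CARD('n)) s p"
proof -
  have N: "1 \<le> real CARD('n)" by simp
  \<comment> \<open>With \<open>s p = N\<close> the argument of Gamma is
    \<open>(2 N + p - 2) / 2\<close>, at least \<open>1 / 2\<close>. The other Gamma factor is
    positive because \<open>s < 1\<close>.\<close>
  have "p * s = real CARD('n)" using assms(4) by (simp add: mult.commute)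
  then have "0 < p * s + p + real CARD('n) - 2" using N assms(3) by linarith
  then have "0 < (p * s + p + real CARD('n) - 2) / 2" by simp
  then show ?thesis
    using assms by (auto simp: sobolev_const_def intro!: divide_pos_pos mult_pos_pos Gamma_real_pos)
qed

lemma le_sobolev_norm:
  assumes s: "s \<noteq> 0" and p: "1 \<le> p"
  shows "sobolev_seminorm s p u \<le> sobolev_norm s p u" "Lp_norm p u \<le> sobolev_norm s p u"
proof -
  have "x \<le> (x epowr p + y epowr p) epowr (1 / p)" "x \<le> (y epowr p + x epowr p) epowr (1 / p)" for x y
  proof -
    have "(x epowr p) epowr (1 / p) \<le> (x epowr p + y epowr p) epowr (1 / p)"
      "(x epowr p) epowr (1 / p) \<le> (y epowr p + x epowr p) epowr (1 / p)"
      using p by (intro epowr_mono add_increasing add_increasing2 order_refl; simp)+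
    then show "x \<le> (x epowr p + y epowr p) epowr (1 / p)" "x \<le> (y epowr p + x epowr p) epowr (1 / p)"
      using p by (simp_all add: epowr_cancel)
  qed
  then show "sobolev_seminorm s p u \<le> sobolev_norm s p u" "Lp_norm p u \<le> sobolev_norm s p u"
    using s by (auto simp: sobolev_norm_def)
qed

lemma borel_version:
  fixes u :: "real ^ 'n \<Rightarrow> real"
  assumes "u \<in> borel_measurable lebesgue"
  obtains v where "v \<in> borel_measurable borel" "AE x in lborel. u x = v x"
  using completion_ex_borel_measurable_real[OF assms] by auto

text \<open>The bound is available for every weak gradient, in particular for the one that the
  choice operator returns. Finiteness of the seminorm guarantees that there is one.\<close>

lemma weak_gradient_energy:
  fixes u v :: "real ^ 'n \<Rightarrow> real"
  assumes u: "u \<in> borel_measurable lebesgue" and v: "v \<in> borel_measurable borel" and eq: "AE x in lborel. u x = v x"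
    and fin: "sobolev_seminorm 1 p u < top" and p: "1 \<le> p"
  obtains g where "gradient_bound v g" "(\<integral>\<^sup>+ x. ennreal (g x powr p) \<partial>lborel) = sobolev_seminorm 1 p u epowr p"
proof -
  have ex: "\<exists>G. is_weak_gradient u G"
    using fin by (auto simp: sobolev_seminorm_def split: if_splits)
  then have wg: "is_weak_gradient u (weak_gradient u)"
    unfolding weak_gradient_def by (rule someI_ex)
  obtain g where g: "gradient_bound v g" "AE x in lborel. norm (weak_gradient u x) = g x"
    using weak_gradient_bound[OF u wg v eq] by blast
  have "sobolev_seminorm 1 p u = (\<integral>\<^sup>+ x. ennreal (g x powr p) \<partial>lborel) epowr (1 / p)"
    using ex Lp_norm_eq[OF g(2), of p] by (simp add: sobolev_seminorm_def)
  then have "sobolev_seminorm 1 p u epowr p = (\<integral>\<^sup>+ x. ennreal (g x powr p) \<partial>lborel)"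
    using p by (simp add: epowr_cancel)
  then show ?thesis using g(1) that by metis
qed

lemma gag_energy_seminorm:
  fixes u v :: "real ^ 'n \<Rightarrow> real"
  assumes u: "u \<in> borel_measurable lebesgue" and eq: "AE x in lborel. u x = v x"
    and s: "0 < s" "s < 1" and p: "1 \<le> p" and sp: "s * p = real CARD('n)"
  shows "sobolev_seminorm s p u epowr p = ennreal (sobolev_const (real CARD('n)) s p) * gag_energy p v"
    and "gag_energy p v = ennreal (1 / sobolev_const (real CARD('n)) s p) * sobolev_seminorm s p u epowr p"
proof -
  show 1: "sobolev_seminorm s p u epowr p = ennreal (sobolev_const (real CARD('n)) s p) * gag_energy p v"
    using gagliardo_seminorm_eq[OF u eq sp] s p by (simp add: sobolev_seminorm_def epowr_cancel)
  have "0 < sobolev_const (real CARD('n)) s p" by (rule sobolev_const_pos[OF s p sp])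
  then have "ennreal (1 / sobolev_const (real CARD('n)) s p) * ennreal (sobolev_const (real CARD('n)) s p) = 1"
    by (simp flip: ennreal_mult)
  then show "gag_energy p v = ennreal (1 / sobolev_const (real CARD('n)) s p) * sobolev_seminorm s p u epowr p"
    unfolding 1 mult.assoc[symmetric] by simp
qed

lemma bmo_norm_le_sobolev_norm:
  assumes s: "0 < s" "s \<le> 1" and p: "1 \<le> p" and sp: "s * p = real CARD('n)"
  shows "\<exists>C>0. \<forall>u :: real ^ 'n \<Rightarrow> real. u \<in> borel_measurable lebesgue \<longrightarrow> bmo_norm u \<le> ennreal C * sobolev_norm s p u"
proof -
  have "\<exists>K\<ge>0. \<forall>u v :: real ^ 'n \<Rightarrow> real. u \<in> borel_measurable lebesgue \<longrightarrow> v \<in> borel_measurable borel \<longrightarrow>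
    (AE x in lborel. u x = v x) \<longrightarrow> sobolev_seminorm s p u < top \<longrightarrow>
    (\<forall>x r. osc v x r epowr p \<le> ennreal K * sobolev_seminorm s p u epowr p)"
  proof (cases "s = 1")
    case True
    then have pN: "p = real DIM(real ^ 'n)" using sp by simp
    obtain K where K: "0 \<le> K" "\<And>v g (x :: real ^ 'n) r. gradient_bound v g \<Longrightarrow>
        osc v x r epowr real DIM(real ^ 'n) \<le> ennreal K * (\<integral>\<^sup>+ x. ennreal (g x powr real DIM(real ^ 'n)) \<partial>lborel)"
      using osc_le_gradient_energy[where 'a="real ^ 'n"] by blast
    show ?thesis
    proof (intro exI[of _ K] conjI K(1) allI impI)
      fix u v :: "real ^ 'n \<Rightarrow> real" and x r
      assume u: "u \<in> borel_measurable lebesgue" "v \<in> borel_measurable borel" "AE x in lborel. u x = v x"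
        and fin: "sobolev_seminorm s p u < top"
      obtain g where g: "gradient_bound v g" "(\<integral>\<^sup>+ x. ennreal (g x powr p) \<partial>lborel) = sobolev_seminorm 1 p u epowr p"
        using weak_gradient_energy[OF u fin[unfolded True] p] by blast
      show "osc v x r epowr p \<le> ennreal K * sobolev_seminorm s p u epowr p"
        using K(2)[OF g(1), of x r] g(2) unfolding pN[symmetric] True by simp
    qed
  next
    case False
    then have s1: "s < 1" using s by simp
    let ?\<kappa> = "sobolev_const (real CARD('n)) s p"
    let ?c = "4 powr p * (inverse (unit_ball_vol (real DIM(real ^ 'n))))\<^sup>2 * 2 powr (2 * real DIM(real ^ 'n))"
    have \<kappa>: "0 < ?\<kappa>" by (rule sobolev_const_pos[OF s(1) s1 p sp])
    show ?thesis
    proof (intro exI[of _ "?c * (1 / ?\<kappa>)"] conjI allI impI)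
      show "0 \<le> ?c * (1 / ?\<kappa>)" using \<kappa> by simp
      fix u v :: "real ^ 'n \<Rightarrow> real" and x r
      assume u: "u \<in> borel_measurable lebesgue" "v \<in> borel_measurable borel" "AE x in lborel. u x = v x"
      have "osc v x r epowr p \<le> ennreal ?c * gag_energy p v"
        by (rule osc_le_gag_energy[OF u(2) p])
      also have "\<dots> = ennreal ?c * (ennreal (1 / ?\<kappa>) * sobolev_seminorm s p u epowr p)"
        unfolding gag_energy_seminorm(2)[OF u(1,3) s(1) s1 p sp] ..
      also have "\<dots> = ennreal (?c * (1 / ?\<kappa>)) * sobolev_seminorm s p u epowr p"
        using \<kappa> by (subst ennreal_mult) (auto simp: mult.assoc)
      finally show "osc v x r epowr p \<le> ennreal (?c * (1 / ?\<kappa>)) * sobolev_seminorm s p u epowr p" .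
    qed
  qed
  then obtain K where K: "0 \<le> K" "\<And>(u :: real ^ 'n \<Rightarrow> real) v x r. u \<in> borel_measurable lebesgue \<Longrightarrow> v \<in> borel_measurable borel \<Longrightarrow>
    AE x in lborel. u x = v x \<Longrightarrow> sobolev_seminorm s p u < top \<Longrightarrow>
    osc v x r epowr p \<le> ennreal K * sobolev_seminorm s p u epowr p"
    by blast
  \<comment> \<open>The summand \<open>1\<close> keeps \<open>C\<close> positive even for
    \<open>K = 0\<close>, so that the inequality is trivial when the Sobolev norm is
    infinite.\<close>
  define C where "C = K powr (1 / p) + 1"
  have C: "0 < C" by (simp add: C_def add_nonneg_pos)
  have "bmo_norm u \<le> ennreal C * sobolev_norm s p u" if u: "u \<in> borel_measurable lebesgue" for u :: "real ^ 'n \<Rightarrow> real"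
  proof (cases "sobolev_norm s p u = top")
    case True
    then show ?thesis using C by (simp add: ennreal_mult_top)
  next
    case False
    have sem: "sobolev_seminorm s p u \<le> sobolev_norm s p u"
      using s p by (intro le_sobolev_norm) auto
    then have fin: "sobolev_seminorm s p u < top" using False by (auto simp: less_top top_unique)
    obtain v where v: "v \<in> borel_measurable borel" "AE x in lborel. u x = v x"
      using borel_version[OF u] by blast
    have "osc v x r \<le> ennreal C * sobolev_norm s p u" for x r
    proof -
      have "(osc v x r epowr p) epowr (1 / p) \<le> (ennreal K * sobolev_seminorm s p u epowr p) epowr (1 / p)"
        using p by (intro epowr_mono K(2)[OF u v fin]) auto
      then have "osc v x r \<le> ennreal (K powr (1 / p)) * sobolev_seminorm s p u"
        using p K(1) by (simp add: epowr_mult epowr_cancel epowr_ennreal)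
      also have "\<dots> \<le> ennreal C * sobolev_norm s p u"
        by (intro mult_mono sem ennreal_leI) (auto simp: C_def)
      finally show ?thesis .
    qed
    then show ?thesis by (rule bmo_norm_le[OF u v])
  qed
  then show ?thesis using C by blast
qed

lemma gag_energy_le_seminorm:
  assumes st: "0 < st" "st < s" "s \<le> 1" and p: "1 \<le> p" "1 \<le> pt" and sp: "s * p = real CARD('n)" "st * pt = real CARD('n)"
    and ne: "s \<noteq> p"
  shows "\<exists>C\<ge>0. \<forall>u v :: real ^ 'n \<Rightarrow> real. u \<in> borel_measurable lebesgue \<longrightarrow> v \<in> borel_measurable borel \<longrightarrow>
    (AE x in lborel. u x = v x) \<longrightarrow> sobolev_seminorm s p u < top \<longrightarrow>
    gag_energy pt v \<le> ennreal C * sobolev_seminorm s p u epowr pt"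
proof -
  \<comment> \<open>The strict inequality matters for \<open>s = 1\<close>: there
    \<open>p = N\<close>, and the gradient estimate requires an exponent above
    \<open>N\<close>.\<close>
  have ppt: "p < pt"
  proof (rule ccontr)
    assume "\<not> p < pt"
    then have "st * pt \<le> st * p" using st by (intro mult_left_mono) auto
    also have "\<dots> < s * p" using st p by (intro mult_strict_right_mono) auto
    finally show False using sp by simp
  qed
  show ?thesis
  proof (cases "s = 1")
    case True
    then have pN: "p = real DIM(real ^ 'n)" using sp by simp
    \<comment> \<open>In dimension one \<open>s = 1\<close> would force \<open>p = 1 = s\<close>,
      which \<open>ne\<close> excludes.\<close>
    have "CARD('n) \<noteq> 1" using sp ne True by auto
    then have "2 \<le> CARD('n)" using zero_less_card_finite[where 'a='n] by linarith
    then have N: "2 \<le> DIM(real ^ 'n)" by simp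
    obtain C where C: "0 \<le> C" "\<And>v (g :: real ^ 'n \<Rightarrow> real). gradient_bound v g \<Longrightarrow>
      (\<integral>\<^sup>+ x. ennreal (g x powr p) \<partial>lborel) < top \<Longrightarrow>
      gag_energy pt v \<le> ennreal C * (\<integral>\<^sup>+ x. ennreal (g x powr p) \<partial>lborel) epowr (pt / p)"
      using gag_energy_le_gradient_energy[OF N, of pt] ppt unfolding pN by blast
    show ?thesis
    proof (intro exI[of _ C] conjI C(1) allI impI)
      fix u v :: "real ^ 'n \<Rightarrow> real"
      assume u: "u \<in> borel_measurable lebesgue" "v \<in> borel_measurable borel" "AE x in lborel. u x = v x"
        and fin: "sobolev_seminorm s p u < top"
      obtain g where g: "gradient_bound v g" "(\<integral>\<^sup>+ x. ennreal (g x powr p) \<partial>lborel) = sobolev_seminorm 1 p u epowr p"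
        using weak_gradient_energy[OF u fin[unfolded True] p(1)] by blast
      have "gag_energy pt v \<le> ennreal C * (\<integral>\<^sup>+ x. ennreal (g x powr p) \<partial>lborel) epowr (pt / p)"
        using fin True by (intro C(2) g(1)) (simp add: g(2))
      then show "gag_energy pt v \<le> ennreal C * sobolev_seminorm s p u epowr pt"
        using p True by (simp add: g(2) epowr_epowr)
    qed
  next
    case False
    then have s: "0 < s" "s < 1" using st by auto
    let ?\<kappa> = "sobolev_const (real CARD('n)) s p"
    have \<kappa>: "0 < ?\<kappa>" by (rule sobolev_const_pos[OF s p(1) sp(1)])
    obtain C where C: "0 \<le> C" "\<And>v :: real ^ 'n \<Rightarrow> real. v \<in> borel_measurable borel \<Longrightarrow>
      gag_energy p v < top \<Longrightarrow> gag_energy pt v \<le> ennreal C * gag_energy p v epowr (pt / p)"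
      using gag_energy_embedding[OF p(1) less_imp_le[OF ppt], where 'a="real ^ 'n"] by blast
    show ?thesis
    proof (intro exI[of _ "C * (1 / ?\<kappa>) powr (pt / p)"] conjI allI impI)
      show "0 \<le> C * (1 / ?\<kappa>) powr (pt / p)" using C by simp
      fix u v :: "real ^ 'n \<Rightarrow> real"
      assume u: "u \<in> borel_measurable lebesgue" "v \<in> borel_measurable borel" "AE x in lborel. u x = v x"
        and fin: "sobolev_seminorm s p u < top"
      note gag = gag_energy_seminorm(2)[OF u(1,3) s p(1) sp(1)]
      have "gag_energy p v < top"
        unfolding gag using fin by (simp add: ennreal_mult_less_top)
      then have "gag_energy pt v \<le> ennreal C * gag_energy p v epowr (pt / p)"
        by (rule C(2)[OF u(2)])
      also have "\<dots> = ennreal (C * (1 / ?\<kappa>) powr (pt / p)) * sobolev_seminorm s p u epowr pt"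
        unfolding gag using p C(1) \<kappa> by (simp add: epowr_mult epowr_epowr epowr_ennreal ennreal_mult mult.assoc)
      finally show "gag_energy pt v \<le> ennreal (C * (1 / ?\<kappa>) powr (pt / p)) * sobolev_seminorm s p u epowr pt" .
    qed
  qed
qed

lemma sobolev_norm_embedding:
  assumes st: "0 < st" "st \<le> s" "s \<le> 1" and p: "1 \<le> p" "1 \<le> pt" and sp: "s * p = real CARD('n)" "st * pt = real CARD('n)"
    and ne: "s \<noteq> p"
  shows "\<exists>C>0. \<forall>u \<in> (sobolev_space s p :: (real ^ 'n \<Rightarrow> real) set). sobolev_norm st pt u \<le> ennreal C * sobolev_norm s p u"
proof (cases "st = s")
  case True
  \<comment> \<open>Equal smoothness forces equal exponents, and the constant is \<open>1\<close>.
    In the other case \<open>st < 1\<close>, so the target seminorm is fractional even when the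
    source is \<open>s = 1\<close>.\<close>
  then have "s * pt = s * p" using sp by simp
  then have "pt = p" using True st(1) by (metis less_irrefl mult_left_cancel)
  then show ?thesis using True by (intro exI[of _ 1]) auto
next
  case False
  then have st': "st < s" "st < 1" using st by auto
  have ppt: "p \<le> pt"
  proof (rule ccontr)
    assume "\<not> p \<le> pt"
    then have "st * pt < st * p" using st by (intro mult_strict_left_mono) auto
    also have "\<dots> \<le> s * p" using st p by (intro mult_right_mono) auto
    finally show False using sp by simp
  qed
  let ?\<kappa> = "sobolev_const (real CARD('n)) st pt"
  have \<kappa>: "0 < ?\<kappa>" by (rule sobolev_const_pos[OF st(1) st'(2) p(2) sp(2)])
  obtain A where A: "0 \<le> A" "\<And>u v :: real ^ 'n \<Rightarrow> real. u \<in> borel_measurable lebesgue \<Longrightarrow> v \<in> borel_measurable borel \<Longrightarrow>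
    AE x in lborel. u x = v x \<Longrightarrow> sobolev_seminorm s p u < top \<Longrightarrow>
    gag_energy pt v \<le> ennreal A * sobolev_seminorm s p u epowr pt"
    using gag_energy_le_seminorm[OF st(1) st'(1) st(3) p sp ne] by blast
  obtain B where B: "0 \<le> B" "\<And>v :: real ^ 'n \<Rightarrow> real. v \<in> borel_measurable borel \<Longrightarrow>
    (\<integral>\<^sup>+ x. ennreal (\<bar>v x\<bar> powr pt) \<partial>lborel) \<le> ennreal B * (gag_energy pt v + (\<integral>\<^sup>+ x. ennreal (\<bar>v x\<bar> powr p) \<partial>lborel) epowr (pt / p))"
    using nn_integral_powr_embedding[OF p(1) ppt, where 'a="real ^ 'n"] by blast
  \<comment> \<open>\<open>?\<kappa> * A\<close> bounds the seminorm, \<open>B * (A + 1)\<close>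
    bounds the Lebesgue norm through the energy and the \<open>p\<close>-norm, and \<open>1\<close>
    ensures positivity.\<close>
  define K where "K = ?\<kappa> * A + B * (A + 1) + 1"
  have K: "0 < K" using \<kappa> A(1) B(1) by (simp add: K_def add_nonneg_pos)
  have "sobolev_norm st pt u \<le> ennreal (K powr (1 / pt)) * sobolev_norm s p u" if "u \<in> sobolev_space s p" for u :: "real ^ 'n \<Rightarrow> real"
  proof -
    have u: "u \<in> borel_measurable lebesgue" and fin: "sobolev_seminorm s p u < top"
      using that by (auto simp: sobolev_space_def)
    obtain v where v: "v \<in> borel_measurable borel" "AE x in lborel. u x = v x"
      using borel_version[OF u] by blast
    then have abs_eq: "AE x in lborel. norm (u x) = \<bar>v x\<bar>" by auto
    let ?X = "sobolev_norm s p u"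
    have X: "sobolev_seminorm s p u \<le> ?X" "Lp_norm p u \<le> ?X"
      using st p by (intro le_sobolev_norm; simp)+
    have "gag_energy pt v \<le> ennreal A * sobolev_seminorm s p u epowr pt"
      by (rule A(2)[OF u v fin])
    also have "\<dots> \<le> ennreal A * ?X epowr pt"
      using p X by (intro mult_left_mono epowr_mono) auto
    finally have gag: "gag_energy pt v \<le> ennreal A * ?X epowr pt" .
    have "(\<integral>\<^sup>+ x. ennreal (\<bar>v x\<bar> powr p) \<partial>lborel) epowr (pt / p) = Lp_norm p u epowr pt"
      using p by (simp add: Lp_norm_eq[OF abs_eq] epowr_epowr)
    also have "\<dots> \<le> ?X epowr pt"
      using p X by (intro epowr_mono) auto
    finally have lp: "(\<integral>\<^sup>+ x. ennreal (\<bar>v x\<bar> powr p) \<partial>lborel) epowr (pt / p) \<le> ?X epowr pt" .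
    have "Lp_norm pt u epowr pt = (\<integral>\<^sup>+ x. ennreal (\<bar>v x\<bar> powr pt) \<partial>lborel)"
      using p by (simp add: Lp_norm_eq[OF abs_eq] epowr_cancel)
    also have "\<dots> \<le> ennreal B * (gag_energy pt v + (\<integral>\<^sup>+ x. ennreal (\<bar>v x\<bar> powr p) \<partial>lborel) epowr (pt / p))"
      by (rule B(2)[OF v(1)])
    also have "\<dots> \<le> ennreal B * (ennreal A * ?X epowr pt + ?X epowr pt)"
      by (intro mult_left_mono add_mono gag lp) simp
    finally have lpt: "Lp_norm pt u epowr pt \<le> ennreal B * (ennreal A * ?X epowr pt + ?X epowr pt)" .
    have sem: "sobolev_seminorm st pt u epowr pt \<le> ennreal ?\<kappa> * (ennreal A * ?X epowr pt)"
      unfolding gag_energy_seminorm(1)[OF u v(2) st(1) st'(2) p(2) sp(2)] by (intro mult_left_mono gag) simp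
    have "sobolev_seminorm st pt u epowr pt + Lp_norm pt u epowr pt \<le>
      ennreal ?\<kappa> * (ennreal A * ?X epowr pt) + ennreal B * (ennreal A * ?X epowr pt + ?X epowr pt)"
      by (intro add_mono sem lpt)
    also have "\<dots> = (ennreal ?\<kappa> * ennreal A + ennreal B * (ennreal A + 1)) * ?X epowr pt"
      by (simp only: distrib_left distrib_right mult.assoc mult_1_left)
    also have "ennreal ?\<kappa> * ennreal A + ennreal B * (ennreal A + 1) = ennreal (?\<kappa> * A + B * (A + 1))"
      using \<kappa> A(1) B(1) by (simp add: ennreal_plus ennreal_mult)
    also have "ennreal (?\<kappa> * A + B * (A + 1)) * ?X epowr pt \<le> ennreal K * ?X epowr pt"
      by (intro mult_right_mono ennreal_leI) (auto simp: K_def)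
    finally have "(sobolev_seminorm st pt u epowr pt + Lp_norm pt u epowr pt) epowr (1 / pt) \<le> (ennreal K * ?X epowr pt) epowr (1 / pt)"
      using p by (intro epowr_mono) auto
    also have "\<dots> = ennreal (K powr (1 / pt)) * ?X"
      using K p by (simp add: epowr_mult epowr_cancel epowr_ennreal)
    finally show ?thesis using st by (simp add: sobolev_norm_def)
  qed
  then show ?thesis using K by (intro exI[of _ "K powr (1 / pt)"]) auto
qed

text \<open>The two functions precede all parameters, so their arguments record what the constants
  depend on; the dimension is fixed by the type \<open>'n\<close>. The range
  \<open>st \<le> s\<close> means \<open>p \<le> pt\<close>, the direction in which the energies
  embed.\<close>

theorem corollary1p6:
  shows "\<exists>(C1 :: real \<Rightarrow> real \<Rightarrow> real) (C2 :: real \<Rightarrow> real \<Rightarrow> real \<Rightarrow> real \<Rightarrow> real).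
    \<forall>s p st pt :: real.
      0 < s \<and> s \<le> 1 \<and> 1 \<le> p \<and> s * p = real CARD('n) \<and> s \<noteq> p \<and>
      0 \<le> st \<and> st \<le> s \<and> 1 \<le> pt \<and> st * pt = real CARD('n) \<longrightarrow>
      0 < C1 st pt \<and> 0 < C2 s p st pt \<and>
      (\<forall>u \<in> (sobolev_space s p :: (real ^ 'n \<Rightarrow> real) set).
         bmo_norm u \<le> ennreal (C1 st pt) * sobolev_norm st pt u \<and>
         ennreal (C1 st pt) * sobolev_norm st pt u \<le> ennreal (C2 s p st pt) * sobolev_norm s p u)"
proof -
  define bmo_const where "bmo_const st pt C \<longleftrightarrow> 0 < C \<and>
    (\<forall>u :: real ^ 'n \<Rightarrow> real. u \<in> borel_measurable lebesgue \<longrightarrow> bmo_norm u \<le> ennreal C * sobolev_norm st pt u)" for st pt C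
  define emb_const where "emb_const s p st pt C \<longleftrightarrow> 0 < C \<and>
    (\<forall>u \<in> (sobolev_space s p :: (real ^ 'n \<Rightarrow> real) set). sobolev_norm st pt u \<le> ennreal C * sobolev_norm s p u)" for s p st pt C
  \<comment> \<open>The predicate behind \<open>C1\<close> mentions neither \<open>s\<close> nor
    \<open>p\<close>, so the chosen constant depends on \<open>st\<close> and \<open>pt\<close>
    alone; \<open>st \<le> s \<le> 1\<close> helps to show that such a constant exists.\<close>
  define C1 where "C1 st pt = (SOME C. bmo_const st pt C)" for st pt
  define C where "C s p st pt = (SOME C. emb_const s p st pt C)" for s p st pt
  show ?thesis
  proof (intro exI[of _ C1] exI[of _ "\<lambda>s p st pt. C1 st pt * C s p st pt"] allI impI)
    fix s p st pt :: real
    assume "0 < s \<and> s \<le> 1 \<and> 1 \<le> p \<and> s * p = real CARD('n) \<and> s \<noteq> p \<and>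
      0 \<le> st \<and> st \<le> s \<and> 1 \<le> pt \<and> st * pt = real CARD('n)"
    then have *: "0 < s" "s \<le> 1" "1 \<le> p" "s * p = real CARD('n)" "s \<noteq> p" "0 \<le> st" "st \<le> s" "1 \<le> pt" "st * pt = real CARD('n)"
      by auto
    have "st \<noteq> 0"
    proof
      assume "st = 0"
      then have "real CARD('n) = 0" using *(9) by simp
      then show False by simp
    qed
    then have st: "0 < st" using *(6) by simp
    have "\<exists>C. bmo_const st pt C"
      unfolding bmo_const_def using bmo_norm_le_sobolev_norm[OF st _ *(8,9)] *(2,7) by fastforce
    then have C1: "bmo_const st pt (C1 st pt)" unfolding C1_def by (rule someI_ex)
    have "\<exists>C. emb_const s p st pt C"
      unfolding emb_const_def using sobolev_norm_embedding[OF st *(7,2,3,8,4,9,5)] by blast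
    then have C: "emb_const s p st pt (C s p st pt)" unfolding C_def by (rule someI_ex)
    show "0 < C1 st pt \<and> 0 < C1 st pt * C s p st pt \<and>
      (\<forall>u \<in> (sobolev_space s p :: (real ^ 'n \<Rightarrow> real) set).
         bmo_norm u \<le> ennreal (C1 st pt) * sobolev_norm st pt u \<and>
         ennreal (C1 st pt) * sobolev_norm st pt u \<le> ennreal (C1 st pt * C s p st pt) * sobolev_norm s p u)"
    proof (intro conjI ballI)
      show "0 < C1 st pt" "0 < C1 st pt * C s p st pt"
        using C1 C by (auto simp: bmo_const_def emb_const_def)
      fix u :: "real ^ 'n \<Rightarrow> real" assume u: "u \<in> sobolev_space s p"
      show "bmo_norm u \<le> ennreal (C1 st pt) * sobolev_norm st pt u"
        using C1 u by (auto simp: bmo_const_def sobolev_space_def)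
      have "sobolev_norm st pt u \<le> ennreal (C s p st pt) * sobolev_norm s p u"
        using C u by (auto simp: emb_const_def)
      then have "ennreal (C1 st pt) * sobolev_norm st pt u \<le> ennreal (C1 st pt) * (ennreal (C s p st pt) * sobolev_norm s p u)"
        by (intro mult_left_mono) auto
      also have "\<dots> = ennreal (C1 st pt * C s p st pt) * sobolev_norm s p u"
        using C1 C by (simp add: bmo_const_def emb_const_def ennreal_mult mult.assoc)
      finally show "ennreal (C1 st pt) * sobolev_norm st pt u \<le> ennreal (C1 st pt * C s p st pt) * sobolev_norm s p u" .
    qed
  qed
qed

end
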